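(* Assume $ZF+DC$ and: (a) $\mu>\mathrm{cf}(\mu)=\kappa>\aleph_0$ ($\mu$ an aleph); (b) $\left|\bigcup_{\alpha<\mu}\mathcal{P}(\alpha)\right|=\mu$; (c) $E$ is a nice family of filters on $\kappa$ (as defined in the context). Then: ($\alpha$) $2^\mu$ (the cardinality of $\mathcal{P}(\mu)$) is an aleph; ($\beta$) $\mu^+$ is regular, and $\otimes^*_{2^\mu,R_0}$ holds where $R_0=\{\delta<2^\mu:\mathrm{cf}(\delta)>\mu\}$; moreover, if $\mu=\aleph_\gamma$ then $\otimes_{2^\mu,R}$ holds for some $R$ with $R\cap\mu=\mathrm{Reg}\cap\mu$ and $|R\setminus\mu|\le\theta({}^{\kappa}\gamma\times E\times E)$; ($\gamma$) if $\mu<\lambda\le 2^\mu$ then $\lambda$ is not measurable.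
   Context: Work in ZF+DC. An aleph is the cardinality of a well-orderable set. $\mathrm{Reg}$ is the class of regular alephs. For a set $A$, $\theta(A)$ is the supremum of the ordinals $\alpha$ such that there is a function from $A$ onto $\alpha$ or $\alpha$ is finite. A cardinal $\lambda$ is measurable if there is a non-principal $\lambda$-complete ultrafilter on $\lambda$. For a filter $D$ on a set $A^*$ and $f,g:A^*\to\mathrm{Ord}$ write $f<_D g$ if $\{a:f(a)<g(a)\}\in D$. $D^+=\{A\subseteq A^*: A^*\setminus A\notin D\}$, and for $A\in D^+$, $D+A=\{X\subseteq A^*: X\cup(A^*\setminus A)\in D\}$. Let $E$ be a set of $\aleph_1$-complete filters on $A^*$ such that $D\in E$, $A\in D^+$ imply $D+A\in E$. For $D\in E$, $f:A^*\to\mathrm{Ord}$ and an ordinal $\alpha$, define by recursion on $\alpha$: $\mathrm{rk}^2_D(f,E)\le\alpha$ iff for every $A\in D^+$ and every $f_1:A^*\to\mathrm{Ord}$ with $f_1<_{D+A}f$ there are $D_1\in E$ with $D+A\subseteq D_1$ and $\beta<\alpha$ such that $\mathrm{rk}^2_{D_1}(f_1,E)\le\beta$. $\mathrm{rk}^2_D(f,E)$ is the least such $\alpha$, or $\infty$ if there is none. $E$ is nice if $\mathrm{rk}^2_D(f,E)<\infty$ for all $D\in E$ and all $f:A^*\to\mathrm{Ord}$; "nice family of filters on $\kappa$" means $A^*=\kappa$. For an ordinal $\alpha$ and a class $R$ of ordinals, $\otimes_{\alpha,R}$ means: there is a function $e$ whose domain is the set of limit ordinals $\delta<\alpha$ such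 that for each such $\delta$, $e(\delta)$ is an unbounded subset of $\delta$ whose order type belongs to $R$. $\otimes^*_{\alpha,R}$ means $\otimes_{\alpha,R\cup(\alpha\cap\mathrm{Reg})}$. ${}^{\kappa}\gamma$ is the set of functions from $\kappa$ to $\gamma$. *)

theory Defs
  imports Main
begin

text \<open>
  HOL has a choice operator, so its own sets and ordinals cannot serve as a universe of ZF+DC.
  Instead we work in an arbitrary model of first-order ZF+DC: a type of class \<open>zf_dc\<close> is such a
  model, not assumed well-founded from outside. All set-theoretic notions below are those of the
  model; a statement about all types of this class is thus a statement of provability from ZF+DC.
\<close>

class set_mem =
  fixes mem :: "'a \<Rightarrow> 'a \<Rightarrow> bool"

datatype fm = MemF nat nat | EqF nat nat | NegF fm | ConjF fm fm | AllF nat fm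

primrec sat :: "fm \<Rightarrow> (nat \<Rightarrow> 'a::set_mem) \<Rightarrow> bool" where
  "sat (MemF i j) v \<longleftrightarrow> mem (v i) (v j)"
| "sat (EqF i j) v \<longleftrightarrow> v i = v j"
| "sat (NegF p) v \<longleftrightarrow> \<not> sat p v"
| "sat (ConjF p q) v \<longleftrightarrow> sat p v \<and> sat q v"
| "sat (AllF i p) v \<longleftrightarrow> (\<forall>x. sat p (v(i := x)))"

text \<open>
  Classes are first-order definable with parameters (the remaining values of \<open>v\<close>). Schemas for
  arbitrary HOL predicates would give full second-order ZF, in which HOL's choice yields AC.
\<close>

definition definable1 :: "('a::set_mem \<Rightarrow> bool) \<Rightarrow> bool" where
  "definable1 P \<longleftrightarrow> (\<exists>p v. \<forall>x. P x \<longleftrightarrow> sat p (v(0 := x)))"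

definition definable2 :: "('a::set_mem \<Rightarrow> 'a \<Rightarrow> bool) \<Rightarrow> bool" where
  "definable2 P \<longleftrightarrow> (\<exists>p v. \<forall>x y. P x y \<longleftrightarrow> sat p (v(0 := x, 1 := y)))"

definition definable3 :: "('a::set_mem \<Rightarrow> 'a \<Rightarrow> 'a \<Rightarrow> bool) \<Rightarrow> bool" where
  "definable3 P \<longleftrightarrow> (\<exists>p v. \<forall>x y z. P x y z \<longleftrightarrow> sat p (v(0 := x, 1 := y, 2 := z)))"

definition elts :: "'a::set_mem \<Rightarrow> 'a set" where
  "elts x = {y. mem y x}"

class zf = set_mem +
  assumes extensionality: "elts x = elts y \<Longrightarrow> x = y"
    and foundation: "elts x \<noteq> {} \<Longrightarrow> \<exists>y\<in>elts x. elts y \<inter> elts x = {}"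
    and pairing: "\<exists>c. elts c = {x, y}"
    and union: "\<exists>u. elts u = \<Union> (elts ` elts x)"
    and powerset: "\<exists>p. elts p = {y. elts y \<subseteq> elts x}"
    and infinity: "\<exists>w. (\<exists>z\<in>elts w. elts z = {}) \<and>
                       (\<forall>x\<in>elts w. \<exists>y\<in>elts w. elts y = insert x (elts x))"
    and separation: "definable1 P \<Longrightarrow> \<exists>b. elts b = {x \<in> elts a. P x}"
    and replacement: "definable2 R \<Longrightarrow> \<forall>x\<in>elts a. \<exists>!y. R x y \<Longrightarrow>
                      \<exists>b. elts b = {y. \<exists>x\<in>elts a. R x y}"

text \<open>Meaningful only if \<open>A\<close> is the extension of some element of the model; in every use below
  this follows from the axioms of ZF.\<close>

definition mkset :: "'a::zf set \<Rightarrow> 'a" where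
  "mkset A = (THE x. elts x = A)"

definition vempty :: "'a::zf" where
  "vempty = mkset {}"

definition vdiff :: "'a::zf \<Rightarrow> 'a \<Rightarrow> 'a" where
  "vdiff x y = mkset (elts x - elts y)"

definition vun :: "'a::zf \<Rightarrow> 'a \<Rightarrow> 'a" where
  "vun x y = mkset (elts x \<union> elts y)"

definition vpow :: "'a::zf \<Rightarrow> 'a" where
  "vpow x = mkset {y. elts y \<subseteq> elts x}"

definition opair :: "'a::zf \<Rightarrow> 'a \<Rightarrow> 'a" where
  "opair x y = mkset {mkset {x}, mkset {x, y}}"

definition vtimes :: "'a::zf \<Rightarrow> 'a \<Rightarrow> 'a" where
  "vtimes A B = mkset {opair x y | x y. x \<in> elts A \<and> y \<in> elts B}"

definition is_fun :: "'a::zf \<Rightarrow> 'a \<Rightarrow> bool" where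
  "is_fun f A \<longleftrightarrow> elts f \<subseteq> {opair x y | x y. x \<in> elts A} \<and>
                 (\<forall>x\<in>elts A. \<exists>!y. opair x y \<in> elts f)"

definition app :: "'a::zf \<Rightarrow> 'a \<Rightarrow> 'a" where
  "app f x = (THE y. opair x y \<in> elts f)"

definition maps :: "'a::zf \<Rightarrow> 'a \<Rightarrow> 'a \<Rightarrow> bool" where
  "maps f A B \<longleftrightarrow> is_fun f A \<and> app f ` elts A \<subseteq> elts B"

definition vfuns :: "'a::zf \<Rightarrow> 'a \<Rightarrow> 'a" where
  "vfuns A B = mkset {f. maps f A B}"

definition surjects :: "'a::zf \<Rightarrow> 'a \<Rightarrow> bool" where
  "surjects A B \<longleftrightarrow> (\<exists>f. maps f A B \<and> app f ` elts A = elts B)"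

definition eqpoll :: "'a::zf \<Rightarrow> 'a \<Rightarrow> bool" where
  "eqpoll A B \<longleftrightarrow> (\<exists>f. maps f A B \<and> bij_betw (app f) (elts A) (elts B))"

definition vtrans :: "'a::zf \<Rightarrow> bool" where
  "vtrans x \<longleftrightarrow> (\<forall>y\<in>elts x. elts y \<subseteq> elts x)"

text \<open>Von Neumann ordinals: the order \<open>\<alpha> < \<beta>\<close> is \<open>\<alpha> \<in> elts \<beta>\<close>, and \<open>\<alpha> \<le> \<beta>\<close> is
  \<open>elts \<alpha> \<subseteq> elts \<beta>\<close>.\<close>

definition Ord :: "'a::zf \<Rightarrow> bool" where
  "Ord x \<longleftrightarrow> vtrans x \<and> (\<forall>y\<in>elts x. vtrans y)"

definition least_ord :: "('a::zf \<Rightarrow> bool) \<Rightarrow> 'a" where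
  "least_ord P = (THE a. Ord a \<and> P a \<and> (\<forall>b\<in>elts a. \<not> P b))"

definition vsucc :: "'a::zf \<Rightarrow> 'a" where
  "vsucc x = mkset (insert x (elts x))"

definition Limit :: "'a::zf \<Rightarrow> bool" where
  "Limit d \<longleftrightarrow> Ord d \<and> d \<noteq> vempty \<and> (\<forall>a\<in>elts d. vsucc a \<in> elts d)"

definition omega :: "'a::zf" where
  "omega = least_ord Limit"

text \<open>Meaningful only if \<open>x\<close> is a set of ordinals.\<close>

definition otp :: "'a::zf \<Rightarrow> 'a" where
  "otp x = (THE a. Ord a \<and> (\<exists>h. maps h a x \<and> bij_betw (app h) (elts a) (elts x) \<and>
     (\<forall>i\<in>elts a. \<forall>j\<in>elts a. i \<in> elts j \<longleftrightarrow> app h i \<in> elts (app h j))))"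

definition unbounded_in :: "'a::zf \<Rightarrow> 'a \<Rightarrow> bool" where
  "unbounded_in x d \<longleftrightarrow> elts x \<subseteq> elts d \<and> (\<forall>a\<in>elts d. \<exists>b\<in>elts x. elts a \<subseteq> elts b)"

definition cf :: "'a::zf \<Rightarrow> 'a" where
  "cf d = least_ord (\<lambda>a. \<exists>x. unbounded_in x d \<and> otp x = a)"

text \<open>The cardinality of a well-orderable set is an initial ordinal; alephs are the infinite ones.
  Cardinalities of arbitrary sets are only compared for equality, by \<^const>\<open>eqpoll\<close>.\<close>

definition aleph :: "'a::zf \<Rightarrow> bool" where
  "aleph k \<longleftrightarrow> Ord k \<and> elts omega \<subseteq> elts k \<and> (\<forall>b\<in>elts k. \<not> eqpoll k b)"

text \<open>Meaningful only for well-orderable \<open>x\<close>.\<close>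

definition vcard :: "'a::zf \<Rightarrow> 'a" where
  "vcard x = least_ord (\<lambda>a. eqpoll x a)"

definition Reg :: "'a::zf \<Rightarrow> bool" where
  "Reg k \<longleftrightarrow> aleph k \<and> cf k = k"

definition csucc :: "'a::zf \<Rightarrow> 'a" where
  "csucc k = least_ord (\<lambda>a. aleph a \<and> k \<in> elts a)"

text \<open>The aleph with index \<open>g\<close> in the increasing enumeration of all alephs.\<close>

definition Aleph :: "'a::zf \<Rightarrow> 'a" where
  "Aleph g = (THE k. aleph k \<and> otp (mkset {j \<in> elts k. aleph j}) = g)"

text \<open>The supremum of a set of ordinals is its union.\<close>

definition theta :: "'a::zf \<Rightarrow> 'a" where
  "theta A = mkset (\<Union> {elts a | a. Ord a \<and> (surjects A a \<or> a \<in> elts omega)})"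

class zf_dc = zf +
  assumes dependent_choice:
    "elts X \<noteq> {} \<Longrightarrow> \<forall>x\<in>elts X. \<exists>y\<in>elts X. opair x y \<in> elts r \<Longrightarrow>
     \<exists>f. maps f omega X \<and> (\<forall>n\<in>elts omega. opair (app f n) (app f (vsucc n)) \<in> elts r)"

text \<open>Filters are proper: an improper filter \<open>D\<close> would have no positive sets, hence rank \<open>0\<close>
  for all \<open>f\<close>, and its presence in \<open>E\<close> would make niceness trivial.\<close>

definition is_filter :: "'a::zf \<Rightarrow> 'a \<Rightarrow> bool" where
  "is_filter S D \<longleftrightarrow> elts D \<subseteq> elts (vpow S) \<and> S \<in> elts D \<and> vempty \<notin> elts D \<and>
     (\<forall>X Y. X \<in> elts D \<and> elts X \<subseteq> elts Y \<and> elts Y \<subseteq> elts S \<longrightarrow> Y \<in> elts D) \<and>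
     (\<forall>X\<in>elts D. \<forall>Y\<in>elts D. mkset (elts X \<inter> elts Y) \<in> elts D)"

definition filter_complete :: "'a::zf \<Rightarrow> 'a \<Rightarrow> 'a \<Rightarrow> bool" where
  "filter_complete l S D \<longleftrightarrow> (\<forall>a\<in>elts l. \<forall>s. maps s a D \<longrightarrow>
     mkset {x \<in> elts S. \<forall>i\<in>elts a. x \<in> elts (app s i)} \<in> elts D)"

definition ultrafilter :: "'a::zf \<Rightarrow> 'a \<Rightarrow> bool" where
  "ultrafilter S D \<longleftrightarrow> is_filter S D \<and> (\<forall>X\<in>elts (vpow S). X \<in> elts D \<or> vdiff S X \<in> elts D)"

definition principal :: "'a::zf \<Rightarrow> 'a \<Rightarrow> bool" where
  "principal S D \<longleftrightarrow> (\<exists>B\<in>elts (vpow S). elts D = {X \<in> elts (vpow S). elts B \<subseteq> elts X})"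

definition measurable :: "'a::zf \<Rightarrow> bool" where
  "measurable l \<longleftrightarrow> (\<exists>D. ultrafilter l D \<and> \<not> principal l D \<and> filter_complete l l D)"

definition positive :: "'a::zf \<Rightarrow> 'a \<Rightarrow> 'a \<Rightarrow> bool" where
  "positive S D A \<longleftrightarrow> A \<in> elts (vpow S) \<and> vdiff S A \<notin> elts D"

definition filter_add :: "'a::zf \<Rightarrow> 'a \<Rightarrow> 'a \<Rightarrow> 'a" where
  "filter_add S D A = mkset {X \<in> elts (vpow S). vun X (vdiff S A) \<in> elts D}"

definition ord_fun :: "'a::zf \<Rightarrow> 'a \<Rightarrow> bool" where
  "ord_fun S f \<longleftrightarrow> is_fun f S \<and> (\<forall>x\<in>elts S. Ord (app f x))"

definition less_mod :: "'a::zf \<Rightarrow> 'a \<Rightarrow> 'a \<Rightarrow> 'a \<Rightarrow> bool" where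
  "less_mod S D f g \<longleftrightarrow> mkset {x \<in> elts S. app f x \<in> elts (app g x)} \<in> elts D"

text \<open>\<open>P D f \<alpha>\<close> satisfies the recursion on \<open>\<alpha>\<close> that defines \<open>rk\<^sup>2\<^sub>D(f, E) \<le> \<alpha>\<close>.\<close>

definition rk2_recursion :: "'a::zf \<Rightarrow> 'a \<Rightarrow> ('a \<Rightarrow> 'a \<Rightarrow> 'a \<Rightarrow> bool) \<Rightarrow> bool" where
  "rk2_recursion S E P \<longleftrightarrow>
     (\<forall>D\<in>elts E. \<forall>f a. ord_fun S f \<longrightarrow> Ord a \<longrightarrow>
        (P D f a \<longleftrightarrow>
           (\<forall>A f1. positive S D A \<and> ord_fun S f1 \<and> less_mod S (filter_add S D A) f1 f \<longrightarrow>
              (\<exists>D1\<in>elts E. elts (filter_add S D A) \<subseteq> elts D1 \<and> (\<exists>b\<in>elts a. P D1 f1 b)))))"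

text \<open>
  As \<open>f\<close> ranges over a proper class, the relation defined by the recursion is a class. Any two
  definable solutions agree, by induction on \<open>\<alpha>\<close> inside the model. A definable solution exists:
  \<open>rk\<^sup>2\<^sub>D(f, E) \<le> \<alpha>\<close> fails iff \<open>(D, f, \<alpha>)\<close> belongs to some set of triples each of which has \<open>A\<close>
  and \<open>f1\<close> as in the recursion with \<open>(D1, f1, \<beta>)\<close> in the set for all \<open>D1\<close> and \<open>\<beta>\<close>.
\<close>

definition rk2_le :: "'a::zf \<Rightarrow> 'a \<Rightarrow> 'a \<Rightarrow> 'a \<Rightarrow> 'a \<Rightarrow> bool" where
  "rk2_le S E D f a \<longleftrightarrow> (\<exists>P. definable3 P \<and> rk2_recursion S E P \<and> P D f a)"

text \<open>The family is required to be nonempty; \<open>csucc omega\<close> is \<open>\<aleph>\<^sub>1\<close>.\<close>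

definition nice_family :: "'a::zf \<Rightarrow> 'a \<Rightarrow> bool" where
  "nice_family S E \<longleftrightarrow> elts E \<noteq> {} \<and>
     (\<forall>D\<in>elts E. is_filter S D \<and> filter_complete (csucc omega) S D \<and>
        (\<forall>A. positive S D A \<longrightarrow> filter_add S D A \<in> elts E) \<and>
        (\<forall>f. ord_fun S f \<longrightarrow> (\<exists>a. Ord a \<and> rk2_le S E D f a)))"

text \<open>\<open>R\<close> is a class of ordinals. \<^const>\<open>Limit\<close> excludes \<open>0\<close>.\<close>

definition otimes :: "'a::zf \<Rightarrow> ('a \<Rightarrow> bool) \<Rightarrow> bool" where
  "otimes a R \<longleftrightarrow> (\<exists>e. is_fun e (mkset {d \<in> elts a. Limit d}) \<and>
     (\<forall>d\<in>elts a. Limit d \<longrightarrow> unbounded_in (app e d) d \<and> R (otp (app e d))))"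

definition otimes_star :: "'a::zf \<Rightarrow> ('a \<Rightarrow> bool) \<Rightarrow> bool" where
  "otimes_star a R \<longleftrightarrow> otimes a (\<lambda>x. R x \<or> x \<in> elts a \<and> Reg x)"

end

theory Submission
  imports Defs
begin

text \<open>
  The proof uses the Galvin-Hajnal rank \<open>rk S f\<close> of functions on \<open>\<kappa>\<close>, taken modulo bounded
  subsets of an unbounded set \<open>S\<close>; this rank exists by dependent choice, as \<open>\<kappa>\<close> has uncountable
  cofinality. Code the subsets of \<open>\<mu>\<close> by functions \<open>\<kappa> \<rightarrow> \<mu>\<close> any two of which are eventually
  different. Such a function is determined by its rank together with the family of those \<open>S\<close> on which
  the rank is attained, because the remaining \<open>S\<close> form an ideal. By Koenig's theorem \<open>\<mu>\<close> is a strong limit, so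
  there are few such families, and the power set of \<open>\<mu>\<close> is well-ordered. Choice for families indexed
  by this power set gives the regularity of \<open>\<mu>\<^sup>+\<close> and short cofinal sequences, and a
  \<open>\<lambda>\<close>-complete ultrafilter decides \<open>i \<in> A\<^sub>j\<close> for all \<open>i < \<mu>\<close> at once.

  For the bound on \<open>R\<close>, let \<open>T\<close> prescribe a set \<open>T\<^sub>i \<subseteq> \<mu>\<close> of possible values for every \<open>i\<close>, and let
  \<open>nrk T\<close> be the rank of \<open>i \<mapsto> |T\<^sub>i|\<close>. Among the coding functions compatible with \<open>T\<close> choose greedily
  a sequence of length \<open>ell T\<close> such that each function lies below one of the sequence on a set that
  computes \<open>nrk T\<close>; the functions below a given one are covered by fewer than \<open>\<mu>\<close> sets \<open>T'\<close> of smaller rank. Given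
  \<open>\<delta>\<close> of cofinality greater than \<open>\<mu>\<close>, a \<open>T\<close> of least rank that is compatible with cofinally many members of
  a sequence of length \<open>\<delta>\<close> yields a cofinal map from \<open>ell T\<close> to \<open>\<delta>\<close>. Its length is at most some
  \<open>Th c \<le> \<delta>\<close>, where \<open>c\<close> maps \<open>\<kappa>\<close> to the cardinals up to \<open>\<mu>\<close>, and iterating the construction makes the
  length equal to some \<open>Th c\<close>.
\<close>

section \<open>Definability\<close>

text \<open>No choice function is at hand inside the model, and orders that it takes for
  well-founded may be ill-founded from outside. So every recursion, minimum and collection goes
  through a formula, each construction carries a \<open>dfn\<close> or \<open>dft\<close>
  certificate, and choices are made canonical by least ordinals or unique descriptions.

  For cf \<delta> > \<mu> no cofinal subset of \<delta> can be picked via subsets of \<mu>, being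
  too large to be coded by one. It is read off a canonical object, a T of least rank. Large
  cofinality enters by pigeonhole: there are at most 2^\<kappa> < \<mu> sets S that compute a rank,
  so one S serves cofinally many members of the sequence, and cutting T along it lowers the rank.
  With least rank, therefore, the members below one greedy function are bounded in \<delta>.

  The threshold rank in \<open>Th c\<close> depends only on cardinalities of rows, that is, on a
  function from \<kappa> to the cardinals up to \<mu>. These cardinals are an image of \<gamma> if
  \<mu> is the \<gamma>-th aleph, whence the bound by \<theta>. The iteration stops because the
  length is strictly below \<delta> unless \<delta> is some \<open>Th c\<close>.\<close>

primrec rename_fm :: "(nat \<Rightarrow> nat) \<Rightarrow> fm \<Rightarrow> fm" where
  "rename_fm r (MemF i j) = MemF (r i) (r j)"
| "rename_fm r (EqF i j) = EqF (r i) (r j)"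
| "rename_fm r (NegF p) = NegF (rename_fm r p)"
| "rename_fm r (ConjF p q) = ConjF (rename_fm r p) (rename_fm r q)"
| "rename_fm r (AllF i p) = AllF (r i) (rename_fm r p)"

text \<open>Injectivity prevents capture: bound variables are renamed too, and the update at
  \<open>r i\<close> must not affect any other renamed variable.\<close>

lemma sat_rename_fm: "inj r \<Longrightarrow> sat (rename_fm r p) v \<longleftrightarrow> sat p (v \<circ> r)"
proof (induction p arbitrary: v)
  case (AllF i p)
  have "(v(r i := x)) \<circ> r = (v \<circ> r)(i := x)" for x
    using AllF.prems by (auto simp: fun_eq_iff inj_eq)
  then show ?case using AllF by (simp del: fun_upd_apply add: comp_def)
qed auto

definition mix :: "(nat \<Rightarrow> 'a) \<Rightarrow> (nat \<Rightarrow> 'a) \<Rightarrow> nat \<Rightarrow> 'a" where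
  "mix v w n = (if even n then v (n div 2) else w (n div 2))"

text \<open>Bound variables are treated a la de Bruijn: a quantifier shifts the environment, so that
  definability goals are solved by resolution with syntax-directed rules. Even variables of the
  formula hold the environment, odd ones the parameters.\<close>

definition dfn :: "((nat \<Rightarrow> 'a::set_mem) \<Rightarrow> bool) \<Rightarrow> bool" where
  "dfn P \<longleftrightarrow> (\<exists>p w. \<forall>v. P v \<longleftrightarrow> sat p (mix v w))"

text \<open>A term is definable when its graph is. The value takes slot 0 and the arguments move up,
  the same convention as for a quantifier, so that an existential quantifier can absorb the
  value.\<close>

definition dft :: "((nat \<Rightarrow> 'a::set_mem) \<Rightarrow> 'a) \<Rightarrow> bool" where
  "dft t \<longleftrightarrow> dfn (\<lambda>v. t (\<lambda>i. v (Suc i)) = v 0)"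

named_theorems dfn_intros

lemma dfn_rename:
  assumes "dfn P" "inj r"
  shows "dfn (\<lambda>v. P (\<lambda>i. v (r i)))"
proof -
  obtain p w where p: "\<And>v. P v \<longleftrightarrow> sat p (mix v w)" using assms(1) unfolding dfn_def by blast
  \<comment> \<open>Only the even positions, those of the environment, are renamed; the parameters
    stay in place.\<close>
  define s where "s n = (if even n then 2 * r (n div 2) else n)" for n
  have "inj s"
  proof (rule injI)
    fix x y assume h: "s x = s y"
    show "x = y"
    proof (cases "even x")
      case True
      then have "even (s x)" by (simp add: s_def)
      then have "even y" using h by (metis s_def)
      then show ?thesis using h True assms(2) unfolding s_def
        by (metis dvd_div_eq_cancel inj_eq mult_cancel_left zero_neq_numeral)
    next
      case False
      then have "odd (s x)" by (simp add: s_def)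
      then have "odd y" using h by (metis s_def dvd_triv_left)
      then show ?thesis using h False by (simp add: s_def)
    qed
  qed
  moreover have "mix v w \<circ> s = mix (\<lambda>i. v (r i)) w" for v
    by (auto simp: fun_eq_iff mix_def s_def)
  ultimately have "P (\<lambda>i. v (r i)) \<longleftrightarrow> sat (rename_fm s p) (mix v w)" for v
    by (simp add: p sat_rename_fm)
  then show ?thesis unfolding dfn_def by blast
qed

lemma dfn_const [dfn_intros]: "dfn (\<lambda>v. B)"
proof (cases B)
  case True
  then have "\<forall>v. B \<longleftrightarrow> sat (EqF 0 0) (mix v (\<lambda>_. undefined))" by simp
  then show ?thesis unfolding dfn_def by blast
next
  case False
  then have "\<forall>v. B \<longleftrightarrow> sat (NegF (EqF 0 0)) (mix v (\<lambda>_. undefined))" by simp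
  then show ?thesis unfolding dfn_def by blast
qed

lemma dfn_not [dfn_intros]: "dfn P \<Longrightarrow> dfn (\<lambda>v. \<not> P v)"
  unfolding dfn_def by (metis sat.simps(3))

lemma dfn_conj [dfn_intros]:
  assumes "dfn P" "dfn Q"
  shows "dfn (\<lambda>v. P v \<and> Q v)"
proof -
  obtain p w where p: "\<And>v. P v \<longleftrightarrow> sat p (mix v w)" using assms(1) unfolding dfn_def by blast
  obtain q u where q: "\<And>v. Q v \<longleftrightarrow> sat q (mix v u)" using assms(2) unfolding dfn_def by blast
  \<comment> \<open>The merged parameters are \<open>mix w u\<close>: entry k of \<open>w\<close>
    becomes parameter 2k, at position 4k+1, and entry k of \<open>u\<close> becomes parameter 2k+1,
    at position 4k+3.\<close>
  define r where "r n = (if even n then n else 4 * (n div 2) + 1)" for n :: nat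
  define s where "s n = (if even n then n else 4 * (n div 2) + 3)" for n :: nat
  have odd: "odd (4 * k + 1)" "odd (4 * k + 3)" "(4 * k + 1) div 2 = 2 * k" "(4 * k + 3) div 2 = 2 * k + 1"
    for k :: nat by presburger+
  have "(4 * k + 1) div 4 = k" "(4 * k + 3) div 4 = k" for k :: nat by simp_all
  then have "(\<lambda>m. if even m then m else 2 * (m div 4) + 1) (r n) = n"
    "(\<lambda>m. if even m then m else 2 * (m div 4) + 1) (s n) = n" for n
    using odd[of "n div 2"] unfolding r_def s_def by (cases "even n"; simp)+
  then have r: "inj r" and s: "inj s"
    using inj_on_inverseI[of UNIV "\<lambda>m. if even m then m else 2 * (m div 4) + 1"] by blast+
  have "mix v (mix w u) (r n) = mix v w n" for v n
    using odd(1,3)[of "n div 2"] by (cases "even n") (auto simp: mix_def r_def elim!: oddE)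
  then have "mix v (mix w u) \<circ> r = mix v w" for v by (simp add: fun_eq_iff)
  moreover have "mix v (mix w u) (s n) = mix v u n" for v n
    using odd(2,4)[of "n div 2"] by (cases "even n") (auto simp: mix_def s_def elim!: oddE)
  then have "mix v (mix w u) \<circ> s = mix v u" for v by (simp add: fun_eq_iff)
  ultimately have "\<forall>v. P v \<and> Q v \<longleftrightarrow>
      sat (ConjF (rename_fm r p) (rename_fm s q)) (mix v (mix w u))"
    by (simp add: p q sat_rename_fm r s)
  then show ?thesis unfolding dfn_def by blast
qed

lemma dfn_all [dfn_intros]:
  assumes "dfn (\<lambda>v. Q (v 0) (\<lambda>i. v (Suc i)))"
  shows "dfn (\<lambda>v. \<forall>y. Q y v)"
proof -
  obtain p w where p: "\<And>v. Q (v 0) (\<lambda>i. v (Suc i)) \<longleftrightarrow> sat p (mix v w)"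
    using assms unfolding dfn_def by blast
  \<comment> \<open>Position 1, that of the first parameter, is freed to carry the bound variable.
    The other parameters move up by one place and the environment moves down by one slot.\<close>
  define r where "r n = (if n = 0 then 1 else if even n then n - 2 else n + 2)" for n :: nat
  have r_even: "r (2 * Suc j) = 2 * j" and r_odd: "r (2 * j + 1) = 2 * (j + 1) + 1" and r0: "r 0 = 1" for j
    by (simp_all add: r_def)
  have cases: "n = 0 \<or> (\<exists>j. n = 2 * Suc j) \<or> (\<exists>j. n = 2 * j + 1)" for n :: nat by presburger
  have r: "inj r"
  proof (rule injI)
    fix x y assume "r x = r y"
    then show "x = y"
      using cases[of x] cases[of y] by (elim disjE exE) (simp_all only: r_even r_odd r0; presburger)+
  qed
  define u where "u = case_nat undefined w"
  have *: "(mix v u)(1 := y) \<circ> r = mix (case_nat y v) w" for v y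
  proof
    fix n
    have "mix v u (2 * j) = v j" "mix (case_nat y v) w (2 * Suc j) = v j"
      "mix v u (2 * (j + 1) + 1) = w j" "mix (case_nat y v) w (2 * j + 1) = w j"
      "mix (case_nat y v) w 0 = y" for j
      by (simp_all add: mix_def u_def)
    moreover have "2 * j \<noteq> 1" "2 * (j + 1) + 1 \<noteq> 1" for j :: nat by presburger+
    ultimately show "((mix v u)(1 := y) \<circ> r) n = mix (case_nat y v) w n"
      using cases[of n] by (elim disjE exE) (simp_all only: comp_def r_even r_odd r0 fun_upd_apply if_False simp_thms if_True)
  qed
  have "(\<forall>y. Q y v) \<longleftrightarrow> sat (AllF 1 (rename_fm r p)) (mix v u)" for v
  proof -
    have "Q y v \<longleftrightarrow> sat p (mix (case_nat y v) w)" for y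
      using p[of "case_nat y v"] by simp
    then show ?thesis by (simp add: sat_rename_fm[OF r] *[unfolded One_nat_def] del: fun_upd_apply)
  qed
  then show ?thesis unfolding dfn_def by blast
qed

lemma dfn_disj [dfn_intros]: "dfn P \<Longrightarrow> dfn Q \<Longrightarrow> dfn (\<lambda>v. P v \<or> Q v)"
  using dfn_not[OF dfn_conj[OF dfn_not dfn_not], of P Q] by (simp only: de_Morgan_conj not_not)

lemma dfn_imp [dfn_intros]: "dfn P \<Longrightarrow> dfn Q \<Longrightarrow> dfn (\<lambda>v. P v \<longrightarrow> Q v)"
  unfolding imp_conv_disj by (intro dfn_disj dfn_not)

lemma dfn_iff [dfn_intros]:
  assumes "dfn P" "dfn Q"
  shows "dfn (\<lambda>v. P v = Q v)"
proof -
  have "(\<lambda>v. P v = Q v) = (\<lambda>v. (P v \<longrightarrow> Q v) \<and> (Q v \<longrightarrow> P v))" by auto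
  then show ?thesis using assms by (simp add: dfn_conj dfn_imp)
qed

lemma dfn_ex [dfn_intros]: "dfn (\<lambda>v. Q (v 0) (\<lambda>i. v (Suc i))) \<Longrightarrow> dfn (\<lambda>v. \<exists>y. Q y v)"
  using dfn_not[OF dfn_all[of "\<lambda>y v. \<not> Q y v"]] dfn_not[of "\<lambda>v. Q (v 0) (\<lambda>i. v (Suc i))"] by simp

lemma dfn_var_mem: "dfn (\<lambda>v. mem (v i) (v j))"
proof -
  have "\<forall>v. mem (v i) (v j) \<longleftrightarrow> sat (MemF (2 * i) (2 * j)) (mix v (\<lambda>_. undefined))"
    by (simp add: mix_def)
  then show ?thesis unfolding dfn_def by blast
qed

lemma dfn_var_eq: "dfn (\<lambda>v. v i = v j)"
proof -
  have "\<forall>v. v i = v j \<longleftrightarrow> sat (EqF (2 * i) (2 * j)) (mix v (\<lambda>_. undefined))"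
    by (simp add: mix_def)
  then show ?thesis unfolding dfn_def by blast
qed

lemma dft_const [dfn_intros]: "dft (\<lambda>v. c)"
proof -
  have "\<forall>v. c = v 0 \<longleftrightarrow> sat (EqF 1 0) (mix v (\<lambda>_. c))" by (simp add: mix_def)
  then show ?thesis unfolding dft_def dfn_def by blast
qed

lemma dft_var [dfn_intros]: "dft (\<lambda>v. v n)"
  unfolding dft_def by (rule dfn_var_eq)

section \<open>Substitution of definable terms\<close>

lemma dfn_inst:
  assumes "dft t" "dfn (\<lambda>v. Q (v 0) (\<lambda>i. v (Suc i)))"
  shows "dfn (\<lambda>v. Q (t v) v)"
proof -
  have "dfn (\<lambda>v. \<exists>y. t v = y \<and> Q y v)"
    using assms unfolding dft_def by (intro dfn_ex dfn_conj)
  then show ?thesis by simp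
qed

lemma dft_shift: "dft t \<Longrightarrow> dft (\<lambda>v. t (\<lambda>i. v (Suc i)))"
  using dfn_rename[of "\<lambda>v. t (\<lambda>i. v (Suc i)) = v 0" "case_nat 0 (\<lambda>i. Suc (Suc i))"]
  unfolding dft_def by (simp add: inj_def split: nat.split)

lemma dfn_sub1: "dfn (\<lambda>v. R (v 0)) \<Longrightarrow> dft s \<Longrightarrow> dfn (\<lambda>v. R (s v))"
  by (rule dfn_inst[where Q = "\<lambda>y v. R y"])

text \<open>\<open>dfn_inst\<close> substitutes at slot 0 only, so the variables are permuted to
  bring each of them there in turn; \<open>dfn_sub3\<close> works likewise.\<close>

lemma dfn_sub2:
  assumes "dfn (\<lambda>v. R (v 0) (v 1))" "dft s" "dft t"
  shows "dfn (\<lambda>v. R (s v) (t v))"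
proof -
  have "dfn (\<lambda>v. R (v 1) (v 0))"
    using dfn_rename[OF assms(1), of "\<lambda>i. if i = 0 then 1 else if i = 1 then 0 else i"]
    by (auto simp: inj_def)
  then have "dfn (\<lambda>v. R (v 0) (t (\<lambda>i. v (Suc i))))"
    using dfn_inst[of "\<lambda>v. t (\<lambda>i. v (Suc i))" "\<lambda>y v. R (v 0) y"] dft_shift[OF assms(3)] by simp
  then show ?thesis using dfn_inst[OF assms(2), of "\<lambda>y v. R y (t v)"] by simp
qed

lemma dfn_sub3:
  assumes "dfn (\<lambda>v. R (v 0) (v 1) (v 2))" "dft s" "dft t" "dft u"
  shows "dfn (\<lambda>v. R (s v) (t v) (u v))"
proof -
  have "dfn (\<lambda>v. R (v (Suc 0)) (v (Suc (Suc 0))) (v 0))"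
    using dfn_rename[OF assms(1), of "\<lambda>i. if i = 0 then 1 else if i = 1 then 2 else if i = 2 then 0 else i"]
    by (auto simp: inj_def numeral_2_eq_2)
  then have 1: "dfn (\<lambda>v. R (v 0) (v (Suc 0)) (u (\<lambda>i. v (Suc (Suc i)))))"
    using dfn_inst[of "\<lambda>v. u (\<lambda>i. v (Suc (Suc i)))" "\<lambda>y v. R (v 0) (v (Suc 0)) y"]
      dft_shift[OF dft_shift[OF assms(4)]] by simp
  then have "dfn (\<lambda>v. R (v (Suc 0)) (v 0) (u (\<lambda>i. v (Suc (Suc i)))))"
    using dfn_rename[OF 1, of "\<lambda>i. if i = 0 then 1 else if i = 1 then 0 else i"]
    by (auto simp: inj_def)
  then have "dfn (\<lambda>v. R (v 0) (t (\<lambda>i. v (Suc i))) (u (\<lambda>i. v (Suc i))))"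
    using dfn_inst[of "\<lambda>v. t (\<lambda>i. v (Suc i))" "\<lambda>y v. R (v 0) y (u (\<lambda>i. v (Suc i)))"]
      dft_shift[OF assms(3)] by simp
  then show ?thesis using dfn_inst[OF assms(2), of "\<lambda>y v. R y (t v) (u v)"] by simp
qed

lemma dft_sub1:
  assumes "dft (\<lambda>v. F (v 0))" "dft s"
  shows "dft (\<lambda>v. F (s v))"
proof -
  have "dfn (\<lambda>v. F (v 0) = v 1)"
    using dfn_rename[OF assms(1)[unfolded dft_def], of "\<lambda>i. if i = 0 then 1 else if i = 1 then 0 else i"]
    by (auto simp: inj_def)
  then show ?thesis unfolding dft_def
    by (rule dfn_sub2) (rule dft_shift[OF assms(2)], rule dft_var)
qed

lemma dft_sub2:
  assumes "dft (\<lambda>v. F (v 0) (v 1))" "dft s" "dft t"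
  shows "dft (\<lambda>v. F (s v) (t v))"
proof -
  have "dfn (\<lambda>v. F (v 0) (v 1) = v 2)"
    using dfn_rename[OF assms(1)[unfolded dft_def], of "\<lambda>i. if i = 0 then 2 else if i = 1 then 0 else if i = 2 then 1 else i"]
    by (auto simp: inj_def numeral_2_eq_2)
  then show ?thesis unfolding dft_def
    by (rule dfn_sub3) (rule dft_shift[OF assms(2)], rule dft_shift[OF assms(3)], rule dft_var)
qed

lemma dfn_mem [dfn_intros]: "dft s \<Longrightarrow> dft t \<Longrightarrow> dfn (\<lambda>v. s v \<in> elts (t v))"
  unfolding elts_def mem_Collect_eq by (rule dfn_sub2[of mem, OF dfn_var_mem])

lemma dfn_eq [dfn_intros]: "dft s \<Longrightarrow> dft t \<Longrightarrow> dfn (\<lambda>v. s v = t v)"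
  by (rule dfn_sub2[of "(=)", OF dfn_var_eq])

lemma dfn_ball [dfn_intros]:
  assumes "dft s" "dfn (\<lambda>v. Q (v 0) (\<lambda>i. v (Suc i)))"
  shows "dfn (\<lambda>v. \<forall>y\<in>elts (s v). Q y v)"
  unfolding Ball_def
  by (rule dfn_all, rule dfn_imp[OF _ assms(2)]) (intro dfn_intros dft_shift assms(1))

lemma dfn_bex [dfn_intros]:
  assumes "dft s" "dfn (\<lambda>v. Q (v 0) (\<lambda>i. v (Suc i)))"
  shows "dfn (\<lambda>v. \<exists>y\<in>elts (s v). Q y v)"
  unfolding Bex_def
  by (rule dfn_ex, rule dfn_conj[OF _ assms(2)]) (intro dfn_intros dft_shift assms(1))

lemma dfn_subset [dfn_intros]: "dft s \<Longrightarrow> dft t \<Longrightarrow> dfn (\<lambda>v. elts (s v) \<subseteq> elts (t v))"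
  unfolding subset_iff by (intro dfn_intros dft_shift)

lemma dft_if [dfn_intros]:
  assumes "dfn P" "dft s" "dft t"
  shows "dft (\<lambda>v. if P v then s v else t v)"
proof -
  have "dfn (\<lambda>v. P (\<lambda>i. v (Suc i)))" using dfn_rename[OF assms(1), of Suc] by simp
  then have "dfn (\<lambda>v. (P (\<lambda>i. v (Suc i)) \<longrightarrow> s (\<lambda>i. v (Suc i)) = v 0) \<and>
      (\<not> P (\<lambda>i. v (Suc i)) \<longrightarrow> t (\<lambda>i. v (Suc i)) = v 0))"
    using assms(2,3)[unfolded dft_def] by (intro dfn_conj dfn_imp dfn_not)
  then show ?thesis unfolding dft_def by (rule back_subst[of dfn]) auto
qed

text \<open>If no element satisfies \<open>P\<close>, the description is a constant of the model, so it stays definable.\<close>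

lemma dft_The:
  assumes d: "dfn (\<lambda>v. P (v 0) (\<lambda>i. v (Suc i)))"
    and u: "\<And>v x y. P x v \<Longrightarrow> P y v \<Longrightarrow> x = y"
  shows "dft (\<lambda>v. THE x. P x v)"
proof -
  let ?c = "THE x. False"
  have e: "(THE x. P x v) = y \<longleftrightarrow> P y v \<or> ((\<forall>x. \<not> P x v) \<and> y = ?c)" for y v
  proof (cases "\<exists>x. P x v")
    case True
    then obtain x where x: "P x v" by blast
    then have "(THE x. P x v) = x" using u by blast
    then show ?thesis using x u by blast
  next
    case False
    then have "(\<lambda>x. P x v) = (\<lambda>x. False)" by auto
    then have "(THE x. P x v) = ?c" by (rule arg_cong)
    then show ?thesis using False by auto
  qed
  have 2: "dfn (\<lambda>v. \<exists>x. P x (\<lambda>i. v (Suc i)))"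
    using dfn_rename[OF dfn_ex[OF d], of Suc] by simp
  have "dfn (\<lambda>v. P (v 0) (\<lambda>i. v (Suc i)) \<or> (\<not> (\<exists>x. P x (\<lambda>i. v (Suc i)))) \<and> v 0 = ?c)"
    using d 2 by (intro dfn_disj dfn_conj dfn_not dfn_eq dft_var dft_const)
  then show ?thesis unfolding dft_def e by simp
qed

section \<open>Passage to the definability notions of the axioms\<close>

lemma dfn_definable1: 
  assumes "dfn (\<lambda>v. P (v 0))"
  shows "definable1 P"
proof -
  obtain p w where p: "\<And>v. P (v 0) \<longleftrightarrow> sat p (mix v w)" using assms unfolding dfn_def by blast
  have "(mix (\<lambda>_. undefined) w)(0 := x) = mix ((\<lambda>_. undefined)(0 := x)) w" for x
    by (auto simp: fun_eq_iff mix_def)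
  then have "P x \<longleftrightarrow> sat p ((mix (\<lambda>_. undefined) w)(0 := x))" for x
    using p[of "(\<lambda>_. undefined)(0 := x)"] by simp
  then show ?thesis unfolding definable1_def by blast
qed

lemma dfn_definable2:
  assumes "dfn (\<lambda>v. R (v 0) (v 1))"
  shows "definable2 R"
proof -
  obtain p w where p: "\<And>v. R (v 0) (v 1) \<longleftrightarrow> sat p (mix v w)" using assms unfolding dfn_def by blast
  \<comment> \<open>\<open>definable2\<close> keeps its second argument at position 1, whereas
    \<open>mix\<close> places slot 1 of the environment at position 2; hence the swap.\<close>
  define r :: "nat \<Rightarrow> nat" where "r i = (if i = 1 then 2 else if i = 2 then 1 else i)" for i
  have r: "inj r" by (auto simp: inj_def r_def)
  define m where "m = mix (\<lambda>_. undefined) w \<circ> r"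
  have "m(0 := x, 1 := y) \<circ> r = mix ((\<lambda>_. undefined)(0 := x, 1 := y)) w" for x y
    by (auto simp: fun_eq_iff mix_def r_def m_def)
  then have "R x y \<longleftrightarrow> sat (rename_fm r p) (m(0 := x, 1 := y))" for x y
    using p[of "(\<lambda>_. undefined)(0 := x, 1 := y)"] by (simp add: sat_rename_fm r)
  then show ?thesis unfolding definable2_def by blast
qed

section \<open>Sets and functions\<close>

definition small :: "'a::zf set \<Rightarrow> bool" where
  "small A \<longleftrightarrow> (\<exists>x. elts x = A)"

lemma elts_inject: "elts x = elts y \<longleftrightarrow> x = (y::'a::zf)"
  using extensionality by blast

lemma elts_mkset: "small A \<Longrightarrow> elts (mkset A) = A"
  unfolding small_def mkset_def by (metis (mono_tags, lifting) elts_inject theI)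

lemma mkset_elts [simp]: "mkset (elts x) = (x::'a::zf)"
  unfolding mkset_def by (simp add: elts_inject)

lemma small_elts [simp, intro]: "small (elts x)"
  unfolding small_def by blast

text \<open>Extensionality gives uniqueness, and a proper class falls under the constant default of
  \<open>dft_The\<close>. So definability can be settled before it is known that the class is a
  set.\<close>

lemma dft_mkset [dfn_intros]:
  assumes "dfn (\<lambda>v. Q (v 0) (\<lambda>i. v (Suc i)))"
  shows "dft (\<lambda>v. mkset {x::'a::zf. Q x v})"
proof -
  have 1: "dfn (\<lambda>v. Q (v 0) (\<lambda>i. v (Suc (Suc i))))"
    using dfn_rename[OF assms, of "case_nat 0 (\<lambda>i. Suc (Suc i))"] by (simp add: inj_def split: nat.split)
  have "dft (\<lambda>v. THE x. \<forall>y. (y \<in> elts x) = Q y v)"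
  proof (rule dft_The)
    show "dfn (\<lambda>v. \<forall>y. (y \<in> elts (v 0)) = Q y (\<lambda>i. v (Suc i)))"
      by (intro dfn_intros 1)
    show "x = y" if "\<forall>z. (z \<in> elts x) = Q z v" "\<forall>z. (z \<in> elts y) = Q z v" for x y v
      using that by (intro extensionality) auto
  qed
  then show ?thesis unfolding mkset_def by (simp add: set_eq_iff)
qed

lemma small_Collect:
  assumes "dfn (\<lambda>v. P (v 0))" "\<And>x. P x \<Longrightarrow> x \<in> elts b"
  shows "small {x::'a::zf. P x}"
proof -
  obtain c where "elts c = {x \<in> elts b. P x}" using separation[OF dfn_definable1[OF assms(1)]] by blast
  moreover have "{x \<in> elts b. P x} = {x. P x}" using assms(2) by blast
  ultimately show ?thesis unfolding small_def by auto
qed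

lemma small_sep: "dfn (\<lambda>v. P (v 0)) \<Longrightarrow> small {x \<in> elts b. P x}"
  by (rule small_Collect[of _ b]) (auto intro!: dfn_intros)

lemma small_image:
  assumes "dft (\<lambda>v. F (v 0))"
  shows "small (F ` elts (a::'a::zf))"
proof -
  have "dfn (\<lambda>v. F (v 0) = v 1)" using dft_sub1[OF assms dft_var] by (intro dfn_intros)
  then obtain b where "elts b = {y. \<exists>x\<in>elts a. F x = y}"
    using replacement[OF dfn_definable2, of "\<lambda>x y. F x = y" a] by blast
  moreover have "{y. \<exists>x\<in>elts a. F x = y} = F ` elts a" by auto
  ultimately show ?thesis unfolding small_def by auto
qed

lemma small_UN:
  assumes "dft (\<lambda>v. F (v 0))"
  shows "small (\<Union>x\<in>elts (a::'a::zf). elts (F x))"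
proof -
  obtain u where "elts u = \<Union> (elts ` elts (mkset (F ` elts a)))" using union by blast
  then show ?thesis unfolding small_def by (metis elts_mkset[OF small_image[OF assms]] image_image)
qed

lemma small_pair [simp, intro]: "small {x, y :: 'a::zf}"
  using pairing unfolding small_def by blast

lemma small_singleton [simp, intro]: "small {x :: 'a::zf}"
  using small_pair[of x x] by simp

lemma small_empty [simp, intro]: "small ({} :: 'a::zf set)"
  using infinity unfolding small_def by blast

lemma small_Un: 
  assumes "small A" "small B"
  shows "small (A \<union> B :: 'a::zf set)"
proof -
  have "small (\<Union>x\<in>elts (mkset {mkset A, mkset B}). elts x)" by (rule small_UN) (rule dft_var)
  then show ?thesis by (simp add: elts_mkset assms)
qed

lemma small_insert [simp, intro]: "small A \<Longrightarrow> small (insert (x::'a::zf) A)"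
  using small_Un[of "{x}" A] by simp

lemma small_Pow: "small {y. elts y \<subseteq> elts (x::'a::zf)}"
  using powerset unfolding small_def by blast

lemma small_subset: "small B \<Longrightarrow> dfn (\<lambda>v. v 0 \<in> A) \<Longrightarrow> A \<subseteq> B \<Longrightarrow> small (A::'a::zf set)"
  using small_Collect[of "\<lambda>x. x \<in> A" "mkset B"] by (auto simp: elts_mkset)

lemma elts_vempty [simp]: "elts (vempty::'a::zf) = {}"
  by (simp add: vempty_def elts_mkset)

lemma elts_vpow [simp]: "elts (vpow x) = {y. elts y \<subseteq> elts (x::'a::zf)}"
  by (simp add: vpow_def elts_mkset small_Pow)

lemma elts_vsucc [simp]: "elts (vsucc x) = insert x (elts (x::'a::zf))"
  by (simp add: vsucc_def elts_mkset)

lemma elts_vun [simp]: "elts (vun x y) = elts x \<union> elts (y::'a::zf)"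
  by (simp add: vun_def elts_mkset small_Un)

lemma elts_vdiff [simp]: "elts (vdiff x y) = elts x - elts (y::'a::zf)"
proof -
  have "small {z \<in> elts x. z \<notin> elts y}" by (rule small_sep) (intro dfn_intros)
  then show ?thesis by (simp add: vdiff_def elts_mkset set_diff_eq)
qed

lemma eq_vempty_iff: "x = vempty \<longleftrightarrow> elts x = {}"
  using elts_inject[of x vempty] by simp

lemma dft_vsucc [dfn_intros]: "dft s \<Longrightarrow> dft (\<lambda>v. vsucc (s v :: 'a::zf))"
  by (rule dft_sub1[of vsucc]) (unfold vsucc_def insert_def Un_iff mem_Collect_eq Un_def, intro dfn_intros)

lemma dft_vun [dfn_intros]: "dft s \<Longrightarrow> dft t \<Longrightarrow> dft (\<lambda>v. vun (s v) (t v :: 'a::zf))"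
  by (rule dft_sub2[of vun]) (unfold vun_def Un_def, intro dfn_intros)

lemma dft_vdiff [dfn_intros]: "dft s \<Longrightarrow> dft t \<Longrightarrow> dft (\<lambda>v. vdiff (s v) (t v :: 'a::zf))"
  by (rule dft_sub2[of vdiff]) (unfold vdiff_def set_diff_eq, intro dfn_intros)

lemma dft_vpow [dfn_intros]: "dft s \<Longrightarrow> dft (\<lambda>v. vpow (s v :: 'a::zf))"
  by (rule dft_sub1[of vpow]) (unfold vpow_def, intro dfn_intros)

section \<open>Ordered pairs, products and functions\<close>

lemma opair_eq_iff [simp]: "opair x y = opair x' y' \<longleftrightarrow> x = x' \<and> y = (y'::'a::zf)"
proof
  assume h: "opair x y = opair x' y'"
  have e: "elts (opair x y) = {mkset {x}, mkset {x, y}}" for x y :: 'a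
    by (simp add: opair_def elts_mkset)
  have inj: "mkset A = mkset B \<longleftrightarrow> A = B" if "small A" "small B" for A B :: "'a set"
    using elts_mkset that by metis
  have "{mkset {x}, mkset {x, y}} = {mkset {x'}, mkset {x', y'}}" using h e by metis
  then have "{{x}, {x, y}} = {{x'}, {x', y'}}" by (simp add: doubleton_eq_iff inj)
  then show "x = x' \<and> y = y'" by (auto simp: doubleton_eq_iff)
qed auto

lemma dft_opair [dfn_intros]: "dft s \<Longrightarrow> dft t \<Longrightarrow> dft (\<lambda>v. opair (s v) (t v :: 'a::zf))"
  by (rule dft_sub2[of opair])
    (unfold opair_def insert_def Un_def mem_Collect_eq empty_iff, intro dfn_intros)

lemma opair_in_Pow: "x \<in> elts a \<Longrightarrow> y \<in> elts a \<Longrightarrow> opair x y \<in> elts (vpow (vpow (a::'a::zf)))"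
  by (simp add: opair_def elts_mkset)

lemma elts_vtimes: "elts (vtimes A B) = {opair x y | x y. x \<in> elts A \<and> y \<in> elts (B::'a::zf)}"
  unfolding vtimes_def
proof (rule elts_mkset, rule small_Collect[of _ "vpow (vpow (vun A B))"])
  show "dfn (\<lambda>v. \<exists>x y. v 0 = opair x y \<and> x \<in> elts A \<and> y \<in> elts B)" by (intro dfn_intros)
  show "p \<in> elts (vpow (vpow (vun A B)))" if "\<exists>x y. p = opair x y \<and> x \<in> elts A \<and> y \<in> elts B" for p
    using that opair_in_Pow[of _ "vun A B"] by (metis UnCI elts_vun)
qed

lemma opair_in_vtimes [simp]: "opair x y \<in> elts (vtimes A B) \<longleftrightarrow> x \<in> elts A \<and> y \<in> elts (B::'a::zf)"
  by (auto simp: elts_vtimes)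

lemma in_vtimesE:
  assumes "p \<in> elts (vtimes A (B::'a::zf))"
  obtains x y where "p = opair x y" "x \<in> elts A" "y \<in> elts B"
  using assms by (auto simp: elts_vtimes)

text \<open>Collecting the members of the component, instead of describing the component, leaves no
  uniqueness condition to check when definability is proved.\<close>

definition vfst :: "'a::zf \<Rightarrow> 'a" where
  "vfst p = mkset {z. \<exists>x y. p = opair x y \<and> z \<in> elts x}"

definition vsnd :: "'a::zf \<Rightarrow> 'a" where
  "vsnd p = mkset {z. \<exists>x y. p = opair x y \<and> z \<in> elts y}"

lemma vfst_opair [simp]: "vfst (opair x y) = x"
  by (simp add: vfst_def)

lemma vsnd_opair [simp]: "vsnd (opair x y) = y"
  by (simp add: vsnd_def)

lemma dft_vfst [dfn_intros]: "dft s \<Longrightarrow> dft (\<lambda>v. vfst (s v :: 'a::zf))"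
  by (rule dft_sub1[of vfst]) (unfold vfst_def, intro dfn_intros)

lemma dft_vsnd [dfn_intros]: "dft s \<Longrightarrow> dft (\<lambda>v. vsnd (s v :: 'a::zf))"
  by (rule dft_sub1[of vsnd]) (unfold vsnd_def, intro dfn_intros)

text \<open>Unlike \<^const>\<open>app\<close>, whose value is unspecified where \<open>f\<close> is multivalued, this operation is
  definable outright; the two agree on functions.\<close>

definition fapp :: "'a::zf \<Rightarrow> 'a \<Rightarrow> 'a" (infixl "\<cdot>" 90) where
  "f \<cdot> x = mkset {z. \<exists>y. opair x y \<in> elts f \<and> z \<in> elts y}"

definition lam :: "'a::zf \<Rightarrow> ('a \<Rightarrow> 'a) \<Rightarrow> 'a" where
  "lam A F = mkset ((\<lambda>x. opair x (F x)) ` elts A)"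

lemma dft_fapp [dfn_intros]: "dft s \<Longrightarrow> dft t \<Longrightarrow> dft (\<lambda>v. s v \<cdot> (t v :: 'a::zf))"
  by (rule dft_sub2[of fapp]) (unfold fapp_def, intro dfn_intros)

lemma dft_lam [dfn_intros]:
  assumes "dft s" "dft (\<lambda>v. F (v 0) (\<lambda>i. v (Suc i)))"
  shows "dft (\<lambda>v. lam (s v) (\<lambda>x. F x (v :: nat \<Rightarrow> 'a::zf)))"
proof -
  \<comment> \<open>Unfolding \<open>lam\<close> introduces a binder for the resulting pair. It lies
    between the argument and the outer environment and has to be skipped.\<close>
  have 1: "dft (\<lambda>v. F (v 0) (\<lambda>i. v (Suc (Suc i))))"
    unfolding dft_def using dfn_rename[OF assms(2)[unfolded dft_def],
        of "\<lambda>i. case i of 0 \<Rightarrow> 0 | Suc 0 \<Rightarrow> 1 | Suc (Suc k) \<Rightarrow> Suc (Suc (Suc k))"]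
    by (auto simp: inj_def split: nat.splits)
  show ?thesis unfolding lam_def image_def
    by (intro dfn_intros dft_shift 1 assms(1))
qed

lemma elts_lam: "dft (\<lambda>v. F (v 0)) \<Longrightarrow> elts (lam A F) = (\<lambda>x. opair x (F x)) ` elts (A::'a::zf)"
  unfolding lam_def by (rule elts_mkset, rule small_image) (intro dfn_intros)

lemma fappI: "(\<And>z. opair x z \<in> elts f \<longleftrightarrow> z = y) \<Longrightarrow> f \<cdot> x = (y::'a::zf)"
  by (simp add: fapp_def)

lemma is_fun_lam [intro]: "dft (\<lambda>v. F (v 0)) \<Longrightarrow> is_fun (lam A F) (A::'a::zf)"
  by (auto simp: is_fun_def elts_lam)

lemma lam_app: "dft (\<lambda>v. F (v 0)) \<Longrightarrow> x \<in> elts A \<Longrightarrow> lam A F \<cdot> x = (F x::'a::zf)"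
  by (rule fappI) (auto simp: elts_lam)

lemma lam_cong: "(\<And>x. x \<in> elts A \<Longrightarrow> F x = G x) \<Longrightarrow> lam A F = lam A (G::'a::zf \<Rightarrow> 'a)"
  by (simp add: lam_def)

lemma is_fun_fapp: "is_fun f A \<Longrightarrow> x \<in> elts A \<Longrightarrow> opair x (f \<cdot> x) \<in> elts (f::'a::zf)"
proof -
  assume "is_fun f A" "x \<in> elts A"
  then obtain y where y: "\<And>z. opair x z \<in> elts f \<longleftrightarrow> z = y" unfolding is_fun_def by blast
  then show ?thesis using fappI[OF y] by simp
qed

lemma is_fun_opair: "is_fun f A \<Longrightarrow> opair x y \<in> elts f \<longleftrightarrow> x \<in> elts A \<and> y = f \<cdot> (x::'a::zf)"
proof -
  assume f: "is_fun f A"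
  show ?thesis
  proof
    assume h: "opair x y \<in> elts f"
    then have x: "x \<in> elts A" using f unfolding is_fun_def by auto
    then have "\<exists>!y. opair x y \<in> elts f" using f unfolding is_fun_def by blast
    then show "x \<in> elts A \<and> y = f \<cdot> x" using x h is_fun_fapp[OF f x] by blast
  qed (use is_fun_fapp[OF f] in blast)
qed

lemma app_eq: "is_fun f A \<Longrightarrow> x \<in> elts A \<Longrightarrow> app f x = f \<cdot> (x::'a::zf)"
  unfolding app_def by (simp add: is_fun_opair)

lemma is_fun_ext:
  assumes "is_fun f A" "is_fun g A" "\<And>x. x \<in> elts A \<Longrightarrow> f \<cdot> x = g \<cdot> (x::'a::zf)"
  shows "f = g"
proof (rule extensionality, rule set_eqI)
  fix p
  have "p \<in> elts f \<longleftrightarrow> (\<exists>x y. p = opair x y \<and> opair x y \<in> elts f)"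
    "p \<in> elts g \<longleftrightarrow> (\<exists>x y. p = opair x y \<and> opair x y \<in> elts g)"
    using assms(1,2) unfolding is_fun_def by blast+
  then show "p \<in> elts f \<longleftrightarrow> p \<in> elts g"
    using is_fun_opair[OF assms(1)] is_fun_opair[OF assms(2)] assms(3) by auto
qed

lemma dfn_is_fun [dfn_intros]: "dft s \<Longrightarrow> dft t \<Longrightarrow> dfn (\<lambda>v. is_fun (s v) (t v :: 'a::zf))"
  by (rule dfn_sub2[of is_fun])
    (unfold is_fun_def subset_iff mem_Collect_eq Ex1_def, intro dfn_intros)

lemma maps_iff: "maps f A B \<longleftrightarrow> is_fun f A \<and> (\<forall>x\<in>elts A. f \<cdot> x \<in> elts (B::'a::zf))"
  unfolding maps_def by (auto simp: app_eq)

lemma dfn_maps [dfn_intros]: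
  "dft s \<Longrightarrow> dft t \<Longrightarrow> dft u \<Longrightarrow> dfn (\<lambda>v. maps (s v) (t v) (u v :: 'a::zf))"
  by (rule dfn_sub3[of maps]) (unfold maps_iff, intro dfn_intros)

lemma maps_app: "maps f A B \<Longrightarrow> x \<in> elts A \<Longrightarrow> f \<cdot> x \<in> elts (B::'a::zf)"
  by (simp add: maps_iff)

lemma maps_lam:
  "dft (\<lambda>v. F (v 0)) \<Longrightarrow> (\<And>x. x \<in> elts A \<Longrightarrow> F x \<in> elts B) \<Longrightarrow> maps (lam A F) A (B::'a::zf)"
  by (auto simp: maps_iff lam_app)

lemma elts_vfuns: "elts (vfuns A B) = {f. maps f A (B::'a::zf)}"
  unfolding vfuns_def
proof (rule elts_mkset, rule small_Collect[of _ "vpow (vtimes A B)"])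
  show "dfn (\<lambda>v. maps (v 0) A B)" by (intro dfn_intros)
  fix f assume f: "maps f A B"
  then have "elts f \<subseteq> {opair x y | x y. x \<in> elts A}" unfolding maps_iff is_fun_def by blast
  then show "f \<in> elts (vpow (vtimes A B))"
    using f is_fun_opair[of f A] by (fastforce simp: maps_iff)
qed

lemma eqpoll_iff: "eqpoll A B \<longleftrightarrow> (\<exists>f. is_fun f A \<and> bij_betw (fapp f) (elts A) (elts (B::'a::zf)))"
proof -
  have "maps f A B \<and> bij_betw (app f) (elts A) (elts B) \<longleftrightarrow> is_fun f A \<and> bij_betw (fapp f) (elts A) (elts B)"
    for f
    using bij_betw_cong[of "elts A" "app f" "fapp f"] by (auto simp: maps_iff app_eq bij_betw_apply)
  then show ?thesis unfolding eqpoll_def by simp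
qed

lemma eqpollI:
  assumes "dft (\<lambda>v. F (v 0))" "bij_betw F (elts A) (elts (B::'a::zf))"
  shows "eqpoll A B"
proof -
  have "bij_betw (fapp (lam A F)) (elts A) (elts B)"
    using assms by (subst bij_betw_cong[of _ _ F]) (auto simp: lam_app)
  then show ?thesis unfolding eqpoll_iff using assms(1) by blast
qed

lemma eqpollE:
  assumes "eqpoll A (B::'a::zf)"
  obtains f where "is_fun f A" "bij_betw (fapp f) (elts A) (elts B)"
  using assms unfolding eqpoll_iff by blast

lemma dfn_bij [dfn_intros]:
  "dft s \<Longrightarrow> dft t \<Longrightarrow> dft u \<Longrightarrow> dfn (\<lambda>v. bij_betw (fapp (s v)) (elts (t v)) (elts (u v :: 'a::zf)))"
  unfolding bij_betw_def inj_on_def set_eq_iff image_iff by (intro dfn_intros dft_shift)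

lemma dfn_eqpoll [dfn_intros]: "dft s \<Longrightarrow> dft t \<Longrightarrow> dfn (\<lambda>v. eqpoll (s v) (t v :: 'a::zf))"
  unfolding eqpoll_iff by (intro dfn_intros dft_shift)

lemma inj_inverse:
  assumes "dft (\<lambda>v. F (v 0))" "inj_on F (elts (A::'a::zf))"
  obtains G where "dft (\<lambda>v. G (v 0))" "\<And>x. x \<in> elts A \<Longrightarrow> G (F x) = x"
proof
  \<comment> \<open>The union of all preimages of \<open>y\<close>: for injective \<open>F\<close>
    this is the preimage itself, obtained without choosing anything.\<close>
  let ?G = "\<lambda>y. mkset {z. \<exists>x\<in>elts A. F x = y \<and> z \<in> elts x}"
  have "dft (\<lambda>v. F (v n))" for n using dft_sub1[OF assms(1) dft_var] .
  then show "dft (\<lambda>v. ?G (v 0))" by (intro dfn_intros)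
  show "?G (F x) = x" if "x \<in> elts A" for x
  proof -
    have "{z. \<exists>x'\<in>elts A. F x' = F x \<and> z \<in> elts x'} = elts x" using that assms(2) by (auto simp: inj_on_def)
    then show ?thesis by simp
  qed
qed

lemma bij_inverse:
  assumes "dft (\<lambda>v. F (v 0))" "bij_betw F (elts (A::'a::zf)) (elts B)"
  obtains G where "dft (\<lambda>v. G (v 0))" "bij_betw G (elts B) (elts A)"
    "\<And>x. x \<in> elts A \<Longrightarrow> G (F x) = x" "\<And>y. y \<in> elts B \<Longrightarrow> F (G y) = y"
proof -
  obtain G where G: "dft (\<lambda>v. G (v 0))" "\<And>x. x \<in> elts A \<Longrightarrow> G (F x) = x"
    using inj_inverse[OF assms(1)] assms(2) by (metis bij_betw_def)
  have "F (G y) = y" "G y \<in> elts A" if "y \<in> elts B" for y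
    using assms(2) that G(2) by (metis bij_betw_def imageE)+
  then have "bij_betw G (elts B) (elts A)"
    using G(2) assms(2) by (intro bij_betw_byWitness[of _ F]) (auto simp: bij_betw_def)
  then show ?thesis using that G \<open>\<And>y. y \<in> elts B \<Longrightarrow> F (G y) = y\<close> by blast
qed

lemma eqpoll_sym: "eqpoll A B \<Longrightarrow> eqpoll B (A::'a::zf)"
proof -
  assume "eqpoll A B"
  then obtain f where f: "bij_betw (fapp f) (elts A) (elts B)" by (elim eqpollE)
  have "dft (\<lambda>v. f \<cdot> v 0)" by (intro dfn_intros)
  then obtain G where "dft (\<lambda>v. G (v 0))" "bij_betw G (elts B) (elts A)" using bij_inverse f by metis
  then show "eqpoll B A" by (rule eqpollI)
qed

lemma eqpoll_trans:
  assumes "eqpoll A B" "eqpoll B (C::'a::zf)"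
  shows "eqpoll A C"
proof -
  obtain f g where "bij_betw (fapp f) (elts A) (elts B)" "bij_betw (fapp g) (elts B) (elts C)"
    using assms by (metis eqpollE)
  then have "bij_betw (\<lambda>x. g \<cdot> (f \<cdot> x)) (elts A) (elts C)"
    using bij_betw_trans by (fastforce simp: comp_def)
  then show ?thesis by (intro eqpollI[of "\<lambda>x. g \<cdot> (f \<cdot> x)"]) (intro dfn_intros)
qed

section \<open>Recursion along orders that are well-founded inside the model\<close>

definition seg :: "('a::zf \<Rightarrow> 'a \<Rightarrow> bool) \<Rightarrow> 'a \<Rightarrow> 'a \<Rightarrow> 'a" where
  "seg lt X x = mkset {y \<in> elts X. lt y x}"

text \<open>Minimal elements are demanded only for subsets that are elements of the model. This is
  what can be verified there, and it supports induction for definable predicates.\<close>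

locale wf_order =
  fixes lt :: "'a::zf \<Rightarrow> 'a \<Rightarrow> bool" and X :: 'a
  assumes dfn_lt: "dfn (\<lambda>v. lt (v 0) (v 1))"
    and lt_trans: "\<lbrakk>x \<in> elts X; y \<in> elts X; z \<in> elts X; lt x y; lt y z\<rbrakk> \<Longrightarrow> lt x z"
    and lt_min: "\<lbrakk>elts Y \<subseteq> elts X; elts Y \<noteq> {}\<rbrakk> \<Longrightarrow> \<exists>m\<in>elts Y. \<forall>y\<in>elts Y. \<not> lt y m"
begin

lemma dfn_lt' [dfn_intros]: "dft s \<Longrightarrow> dft t \<Longrightarrow> dfn (\<lambda>v. lt (s v) (t v))"
  by (rule dfn_sub2[of lt, OF dfn_lt])

lemma elts_seg: "elts (seg lt X x) = {y \<in> elts X. lt y x}"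
  unfolding seg_def by (rule elts_mkset, rule small_sep) (intro dfn_intros)

lemma dft_seg [dfn_intros]: "dft s \<Longrightarrow> dft (\<lambda>v. seg lt X (s v))"
  by (rule dft_sub1[of "seg lt X"]) (unfold seg_def, intro dfn_intros)

lemma wf_induct:
  assumes "dfn (\<lambda>v. P (v 0))" "x \<in> elts X"
    and "\<And>x. x \<in> elts X \<Longrightarrow> (\<And>y. y \<in> elts X \<Longrightarrow> lt y x \<Longrightarrow> P y) \<Longrightarrow> P x"
  shows "P x"
proof (rule ccontr)
  assume n: "\<not> P x"
  have "small {x \<in> elts X. \<not> P x}" by (rule small_sep) (intro dfn_intros assms(1))
  then obtain Y where Y: "elts Y = {x \<in> elts X. \<not> P x}" unfolding small_def by blast
  then obtain m where "m \<in> elts Y" "\<forall>y\<in>elts Y. \<not> lt y m" using lt_min[of Y] n assms(2) by blast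
  then show False using Y assms(3)[of m] by blast
qed

text \<open>Approximations \<open>att\<close> on initial segments are unique by induction. Hence the
  approximation is a definable function \<open>T\<close> of its endpoint, and replacement glues the
  values \<open>G y (T y)\<close> into one function.\<close>

theorem wf_rec:
  assumes dG: "dft (\<lambda>v. G (v 0) (v 1))"
  obtains f where "is_fun f X" "\<And>x. x \<in> elts X \<Longrightarrow> f \<cdot> x = G x (lam (seg lt X x) (fapp f))"
proof -
  have dG' [dfn_intros]: "dft s \<Longrightarrow> dft t \<Longrightarrow> dft (\<lambda>v. G (s v) (t v))" for s t
    by (rule dft_sub2[of G, OF dG])
  let ?S = "seg lt X"
  define att where "att g x \<longleftrightarrow> x \<in> elts X \<and> is_fun g (?S x) \<and>
    (\<forall>y\<in>elts (?S x). g \<cdot> y = G y (lam (?S y) (fapp g)))" for g x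
  have datt [dfn_intros]: "dft s \<Longrightarrow> dft t \<Longrightarrow> dfn (\<lambda>v. att (s v) (t v))" for s t
    by (rule dfn_sub2[of att]) (unfold att_def, intro dfn_intros)
  have uniq: "g = h" if g: "att g x" and h: "att h x" for g h x
  proof (rule is_fun_ext[of _ "?S x"])
    have x: "x \<in> elts X" using g by (simp add: att_def)
    fix y assume y: "y \<in> elts (?S x)"
    have "y \<in> elts (?S x) \<longrightarrow> g \<cdot> y = h \<cdot> y"
    proof (rule wf_induct[where P = "\<lambda>y. y \<in> elts (?S x) \<longrightarrow> g \<cdot> y = h \<cdot> y"])
      show "dfn (\<lambda>v. v 0 \<in> elts (?S x) \<longrightarrow> g \<cdot> v 0 = h \<cdot> v 0)" by (intro dfn_intros)
      show "y \<in> elts X" using y by (simp add: elts_seg)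
      fix y assume y: "y \<in> elts X" and IH: "\<And>z. z \<in> elts X \<Longrightarrow> lt z y \<Longrightarrow> z \<in> elts (?S x) \<longrightarrow> g \<cdot> z = h \<cdot> z"
      have "lam (?S y) (fapp g) = lam (?S y) (fapp h)" if "y \<in> elts (?S x)"
        using that IH lt_trans[OF _ y x] by (intro lam_cong) (auto simp: elts_seg)
      then show "y \<in> elts (?S x) \<longrightarrow> g \<cdot> y = h \<cdot> y" using g h by (auto simp: att_def)
    qed
    then show "g \<cdot> y = h \<cdot> y" using y by simp
  qed (use g h in \<open>auto simp: att_def\<close>)
  define T where "T x = (THE g. att g x)" for x
  have T_eq: "T x = g" if "att g x" for g x unfolding T_def by (rule the_equality) (use that uniq in auto)
  have dT [dfn_intros]: "dft s \<Longrightarrow> dft (\<lambda>v. T (s v))" for s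
    by (rule dft_sub1[of T]) (unfold T_def, rule dft_The, intro dfn_intros, rule uniq)
  let ?L = "\<lambda>A. lam A (\<lambda>y. G y (T y))"
  have dL: "dft (\<lambda>v. G (v 0) (T (v 0)))" by (intro dfn_intros)
  have step: "?L A \<cdot> y = G y (lam (?S y) (fapp (?L A)))"
    if "y \<in> elts A" "elts (?S y) \<subseteq> elts A" "att (?L (?S y)) y" for A y
  proof -
    have "?L (?S y) = lam (?S y) (fapp (?L A))" using that(2) by (intro lam_cong) (auto simp: lam_app[OF dL])
    then show ?thesis using lam_app[OF dL that(1)] T_eq[OF that(3)] by simp
  qed
  have ex: "att (?L (?S x)) x" if "x \<in> elts X" for x
  proof (rule wf_induct[where P = "\<lambda>x. att (?L (?S x)) x"])
    show "dfn (\<lambda>v. att (?L (?S (v 0))) (v 0))" by (intro dfn_intros)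
    fix x assume x: "x \<in> elts X" and IH: "\<And>y. y \<in> elts X \<Longrightarrow> lt y x \<Longrightarrow> att (?L (?S y)) y"
    have "?L (?S x) \<cdot> y = G y (lam (?S y) (fapp (?L (?S x))))" if "y \<in> elts (?S x)" for y
    proof (rule step[OF that])
      have y: "y \<in> elts X" "lt y x" using that by (simp_all add: elts_seg)
      then show "att (?L (?S y)) y" by (rule IH)
      show "elts (?S y) \<subseteq> elts (?S x)" using lt_trans[OF _ y(1) x _ y(2)] by (auto simp: elts_seg)
    qed
    then show "att (?L (?S x)) x" unfolding att_def using x is_fun_lam[OF dL] by blast
  qed (rule that)
  show thesis
  proof
    show "is_fun (?L X) X" by (rule is_fun_lam[OF dL])
    show "?L X \<cdot> x = G x (lam (?S x) (fapp (?L X)))" if "x \<in> elts X" for x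
      by (rule step[OF that _ ex[OF that]]) (auto simp: elts_seg)
  qed
qed

end

section \<open>Ordinals\<close>

lemma mem_irrefl: "x \<notin> elts (x::'a::zf)"
  using foundation[of "mkset {x}"] by (simp add: elts_mkset)

lemma mem_asym: "x \<in> elts y \<Longrightarrow> y \<notin> elts (x::'a::zf)"
  using foundation[of "mkset {x, y}"] by (auto simp: elts_mkset)

lemma dfn_vtrans [dfn_intros]: "dft s \<Longrightarrow> dfn (\<lambda>v. vtrans (s v :: 'a::zf))"
  unfolding vtrans_def by (intro dfn_intros dft_shift)

lemma dfn_Ord [dfn_intros]: "dft s \<Longrightarrow> dfn (\<lambda>v. Ord (s v :: 'a::zf))"
  unfolding Ord_def by (intro dfn_intros)

lemma dfn_Limit [dfn_intros]: "dft s \<Longrightarrow> dfn (\<lambda>v. Limit (s v :: 'a::zf))"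
  unfolding Limit_def by (intro dfn_intros dft_shift)

lemma Ord_mem: "Ord a \<Longrightarrow> b \<in> elts a \<Longrightarrow> Ord (b::'a::zf)"
  unfolding Ord_def vtrans_def by blast

lemma Ord_trans: "Ord c \<Longrightarrow> a \<in> elts b \<Longrightarrow> b \<in> elts c \<Longrightarrow> a \<in> elts (c::'a::zf)"
  unfolding Ord_def vtrans_def by blast

lemma Ord_mem_subset: "Ord b \<Longrightarrow> a \<in> elts b \<Longrightarrow> elts a \<subseteq> elts (b::'a::zf)"
  using Ord_trans by blast

lemma OrdI: "(\<And>b. b \<in> elts a \<Longrightarrow> Ord b) \<Longrightarrow> (\<And>b c. b \<in> elts a \<Longrightarrow> c \<in> elts b \<Longrightarrow> c \<in> elts a) \<Longrightarrow> Ord (a::'a::zf)"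
  unfolding Ord_def vtrans_def by blast

lemma Ord_vsucc: "Ord a \<Longrightarrow> Ord (vsucc (a::'a::zf))"
  by (rule OrdI) (auto intro: Ord_mem Ord_trans)

lemma Ord_vempty [simp]: "Ord (vempty::'a::zf)"
  by (rule OrdI) auto

text \<open>The counterexamples up to \<open>a\<close> form a set by separation, and foundation
  yields a least one. Definability of \<open>P\<close> is what makes them a set of the
  model.\<close>

lemma Ord_induct:
  assumes "dfn (\<lambda>v. P (v 0))" "Ord (a::'a::zf)"
    and "\<And>a. Ord a \<Longrightarrow> (\<And>b. b \<in> elts a \<Longrightarrow> P b) \<Longrightarrow> P a"
  shows "P a"
proof (rule ccontr)
  assume n: "\<not> P a"
  have "small {x \<in> elts (vsucc a). \<not> P x}" by (rule small_sep) (intro dfn_intros assms(1))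
  then obtain Y where Y: "elts Y = {x \<in> elts (vsucc a). \<not> P x}" unfolding small_def by blast
  then have "elts Y \<noteq> {}" using n by auto
  then obtain m where m: "m \<in> elts Y" "elts m \<inter> elts Y = {}" using foundation by blast
  then have "Ord m" "\<not> P m" using Y Ord_mem[OF Ord_vsucc[OF assms(2)]] by auto
  moreover have "elts m \<subseteq> elts (vsucc a)" using m Y Ord_mem_subset[OF Ord_vsucc[OF assms(2)]] by blast
  ultimately show False using m Y assms(3)[of m] by blast
qed

lemma Ord_linear:
  assumes "Ord (a::'a::zf)" "Ord b"
  shows "a \<in> elts b \<or> a = b \<or> b \<in> elts a"
proof -
  have "\<forall>b. Ord b \<longrightarrow> a \<in> elts b \<or> a = b \<or> b \<in> elts a"
  proof (rule Ord_induct[where P = "\<lambda>a. \<forall>b. Ord b \<longrightarrow> a \<in> elts b \<or> a = b \<or> b \<in> elts a"])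
    show "dfn (\<lambda>v. \<forall>b. Ord b \<longrightarrow> v 0 \<in> elts b \<or> v 0 = b \<or> b \<in> elts (v 0 :: 'a))" by (intro dfn_intros)
    fix a :: 'a assume a: "Ord a" and IH: "\<And>x. x \<in> elts a \<Longrightarrow> \<forall>b. Ord b \<longrightarrow> x \<in> elts b \<or> x = b \<or> b \<in> elts x"
    show "\<forall>b. Ord b \<longrightarrow> a \<in> elts b \<or> a = b \<or> b \<in> elts a"
    proof (intro allI impI)
      fix b :: 'a assume "Ord b"
      then show "a \<in> elts b \<or> a = b \<or> b \<in> elts a"
      proof (rule Ord_induct[where P = "\<lambda>b. a \<in> elts b \<or> a = b \<or> b \<in> elts a", rotated])
        show "dfn (\<lambda>v. a \<in> elts (v 0) \<or> a = v 0 \<or> v 0 \<in> elts a)" by (intro dfn_intros)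
        fix b :: 'a assume b: "Ord b" and IH2: "\<And>y. y \<in> elts b \<Longrightarrow> a \<in> elts y \<or> a = y \<or> y \<in> elts a"
        show "a \<in> elts b \<or> a = b \<or> b \<in> elts a"
        proof (rule ccontr)
          assume n: "\<not> (a \<in> elts b \<or> a = b \<or> b \<in> elts a)"
          have "elts a \<subseteq> elts b" using IH b n Ord_trans[OF a] by blast
          moreover have "elts b \<subseteq> elts a" using IH2 n Ord_trans[OF b] by blast
          ultimately show False using n extensionality by blast
        qed
      qed
    qed
  qed (rule assms(1))
  then show ?thesis using assms(2) by blast
qed

lemma Ord_subset_iff: "Ord a \<Longrightarrow> Ord b \<Longrightarrow> elts a \<subseteq> elts b \<longleftrightarrow> a = b \<or> a \<in> elts (b::'a::zf)"
  using Ord_linear[of a b] Ord_mem_subset[of b a] mem_irrefl by blast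

lemma Ord_not_subset: "Ord a \<Longrightarrow> Ord b \<Longrightarrow> \<not> elts a \<subseteq> elts b \<longleftrightarrow> b \<in> elts (a::'a::zf)"
  using Ord_linear[of a b] Ord_mem_subset[of b a] Ord_mem_subset[of a b] mem_irrefl by blast

lemma Ord_not_mem: "Ord a \<Longrightarrow> Ord b \<Longrightarrow> a \<notin> elts b \<longleftrightarrow> elts b \<subseteq> elts (a::'a::zf)"
  using Ord_not_subset by blast

lemma Ord_subset_mem: "Ord c \<Longrightarrow> Ord a \<Longrightarrow> elts a \<subseteq> elts b \<Longrightarrow> b \<in> elts c \<Longrightarrow> a \<in> elts (c::'a::zf)"
  using Ord_mem[of c b] Ord_subset_iff[of a b] Ord_trans by blast

lemma Ord_vsucc_subset: "Ord b \<Longrightarrow> a \<in> elts b \<Longrightarrow> elts (vsucc a) \<subseteq> elts (b::'a::zf)"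
  using Ord_mem_subset by auto

section \<open>Suprema, least ordinals and \<omega>\<close>

definition vsup :: "'a::zf \<Rightarrow> 'a" where
  "vsup X = mkset {z. \<exists>x\<in>elts X. z \<in> elts x}"

lemma elts_vsup: "elts (vsup X) = (\<Union>x\<in>elts X. elts (x::'a::zf))"
proof -
  have "{z. \<exists>x\<in>elts X. z \<in> elts x} = (\<Union>x\<in>elts X. elts x)" by auto
  then show ?thesis unfolding vsup_def by (metis elts_mkset small_UN[OF dft_var])
qed

lemma dft_vsup [dfn_intros]: "dft s \<Longrightarrow> dft (\<lambda>v. vsup (s v :: 'a::zf))"
  by (rule dft_sub1[of vsup]) (unfold vsup_def, intro dfn_intros)

lemma Ord_vsup: "(\<And>x. x \<in> elts X \<Longrightarrow> Ord x) \<Longrightarrow> Ord (vsup (X::'a::zf))"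
proof (rule OrdI)
  assume X: "\<And>x. x \<in> elts X \<Longrightarrow> Ord x"
  show "Ord b" if "b \<in> elts (vsup X)" for b using that X Ord_mem unfolding elts_vsup by blast
  show "c \<in> elts (vsup X)" if "b \<in> elts (vsup X)" "c \<in> elts b" for b c
    using that X Ord_trans unfolding elts_vsup by blast
qed

lemma least_ord_ex:
  assumes "dfn (\<lambda>v. P (v 0))" "Ord (a::'a::zf)" "P a"
  shows "Ord (least_ord P) \<and> P (least_ord P) \<and> (\<forall>b\<in>elts (least_ord P). \<not> P b)"
proof -
  have "\<exists>m. Ord m \<and> P m \<and> (\<forall>b\<in>elts m. \<not> P b)"
  proof (rule ccontr)
    assume n: "\<not> ?thesis"
    have "\<not> P a"
    proof (rule Ord_induct[where P = "\<lambda>a. \<not> P a", OF _ assms(2)])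
      show "dfn (\<lambda>v. \<not> P (v 0))" by (intro dfn_intros assms(1))
    qed (use n in blast)
    then show False using assms(3) by blast
  qed
  then obtain m where m: "Ord m \<and> P m \<and> (\<forall>b\<in>elts m. \<not> P b)" by blast
  show ?thesis unfolding least_ord_def
  proof (rule theI)
    show "Ord m \<and> P m \<and> (\<forall>b\<in>elts m. \<not> P b)" by (rule m)
    show "x = m" if "Ord x \<and> P x \<and> (\<forall>b\<in>elts x. \<not> P b)" for x
      using Ord_linear[of x m] m that by blast
  qed
qed

lemma least_ord_le: "dfn (\<lambda>v. P (v 0)) \<Longrightarrow> Ord (a::'a::zf) \<Longrightarrow> P a \<Longrightarrow> elts (least_ord P) \<subseteq> elts a"
  using least_ord_ex[of P a] Ord_not_subset[of "least_ord P" a] by blast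

lemma least_ord_eq:
  assumes "Ord (a::'a::zf)" "P a" "\<And>b. b \<in> elts a \<Longrightarrow> \<not> P b"
  shows "least_ord P = a"
  unfolding least_ord_def using assms Ord_linear by (intro the_equality) blast+

lemma dft_least_ord [dfn_intros]:
  assumes "dfn (\<lambda>v. P (v 0) (\<lambda>i. v (Suc i)))"
  shows "dft (\<lambda>v. least_ord (\<lambda>a::'a::zf. P a v))"
  unfolding least_ord_def
proof (rule dft_The)
  have "dfn (\<lambda>v. P (v 0) (\<lambda>i. v (Suc (Suc i))))"
    using dfn_rename[OF assms, of "case_nat 0 (\<lambda>i. Suc (Suc i))"] by (simp add: inj_def split: nat.split)
  then show "dfn (\<lambda>v. Ord (v 0) \<and> P (v 0) (\<lambda>i. v (Suc i)) \<and> (\<forall>b\<in>elts (v 0). \<not> P b (\<lambda>i. v (Suc i))))"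
    using assms by (intro dfn_intros)
qed (use Ord_linear in blast)

lemma omega_ex: "\<exists>w::'a::zf. Limit w"
proof -
  obtain w :: 'a where w: "\<exists>z\<in>elts w. elts z = {}" "\<forall>x\<in>elts w. \<exists>y\<in>elts w. elts y = insert x (elts x)"
    using infinity by blast
  \<comment> \<open>The axiom of infinity does not say that the members of \<open>w\<close> are
    ordinals. Those that are ordinals are closed under successor, so their union is a limit
    ordinal.\<close>
  let ?A = "mkset {x \<in> elts w. Ord x}"
  have A: "elts ?A = {x \<in> elts w. Ord x}" by (rule elts_mkset, rule small_sep) (intro dfn_intros)
  have sA: "vsucc x \<in> elts ?A" if x: "x \<in> elts ?A" for x
  proof -
    obtain y where "y \<in> elts w" "elts y = insert x (elts x)" using w(2) x A by blast
    then have "vsucc x \<in> elts w" using extensionality[of y "vsucc x"] by simp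
    moreover have "Ord (vsucc x)" using x A by (intro Ord_vsucc) simp
    ultimately show ?thesis using A by simp
  qed
  have O: "Ord (vsup ?A)" using A by (intro Ord_vsup) auto
  have sub: "x \<in> elts (vsup ?A)" if "x \<in> elts ?A" for x
    using sA[OF that] unfolding elts_vsup by (intro UN_I) auto
  have "vempty \<in> elts ?A"
  proof -
    obtain z where z: "z \<in> elts w" "elts z = {}" using w(1) by blast
    then show ?thesis using A eq_vempty_iff[of z] by simp
  qed
  then have ne: "vsup ?A \<noteq> vempty" using sub eq_vempty_iff by blast
  have "vsucc a \<in> elts (vsup ?A)" if a: "a \<in> elts (vsup ?A)" for a
  proof -
    obtain x where x: "x \<in> elts ?A" "a \<in> elts x" using a by (auto simp: elts_vsup)
    then have "Ord x" using A by simp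
    then have "elts (vsucc a) \<subseteq> elts x" "Ord (vsucc a)"
      using Ord_vsucc_subset[OF _ x(2)] Ord_vsucc[OF Ord_mem[OF _ x(2)]] by blast+
    then show ?thesis using Ord_subset_mem[OF O _ _ sub[OF x(1)]] by blast
  qed
  then show ?thesis unfolding Limit_def using O ne by blast
qed

lemma omega_Limit: "Limit (omega::'a::zf)"
  and omega_least: "Limit d \<Longrightarrow> elts (omega::'a) \<subseteq> elts d"
proof -
  have d: "dfn (\<lambda>v. Limit (v 0 :: 'a))" by (intro dfn_intros)
  obtain w :: 'a where "Limit w" using omega_ex by blast
  then show "Limit (omega::'a)" unfolding omega_def using least_ord_ex[OF d, of w] Limit_def by blast
  show "Limit d \<Longrightarrow> elts (omega::'a) \<subseteq> elts d" unfolding omega_def using least_ord_le[OF d] Limit_def by blast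
qed

lemma Ord_omega: "Ord (omega::'a::zf)"
  using omega_Limit Limit_def by blast

lemma vempty_in_Limit: "Limit d \<Longrightarrow> vempty \<in> elts (d::'a::zf)"
  unfolding Limit_def using Ord_linear[of vempty d] by auto

text \<open>A member that is neither zero nor a successor would be a limit ordinal below the least
  one.\<close>

lemma omega_cases:
  assumes "n \<in> elts (omega::'a::zf)"
  shows "n = vempty \<or> (\<exists>m\<in>elts omega. n = vsucc m)"
proof (rule ccontr)
  assume n: "\<not> ?thesis"
  have O: "Ord n" using Ord_mem[OF Ord_omega assms] .
  have "vsucc a \<in> elts n" if a: "a \<in> elts n" for a
  proof -
    have "a \<in> elts omega" using Ord_trans[OF Ord_omega a assms] .
    then have "n \<noteq> vsucc a" using n by blast
    then show ?thesis using Ord_vsucc_subset[OF O a] Ord_subset_iff[OF Ord_vsucc[OF Ord_mem[OF O a]] O] by blast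
  qed
  then have "Limit n" unfolding Limit_def using O n by blast
  then have "elts omega \<subseteq> elts n" by (rule omega_least)
  then show False using assms mem_irrefl by blast
qed

lemma omega_induct:
  assumes "dfn (\<lambda>v. P (v 0))" "n \<in> elts (omega::'a::zf)" "P vempty"
    and "\<And>n. n \<in> elts omega \<Longrightarrow> P n \<Longrightarrow> P (vsucc n)"
  shows "P n"
proof -
  have "n \<in> elts omega \<longrightarrow> P n"
  proof (rule Ord_induct[where P = "\<lambda>n. n \<in> elts omega \<longrightarrow> P n"])
    show "dfn (\<lambda>v. v 0 \<in> elts omega \<longrightarrow> P (v 0))" by (intro dfn_intros assms(1))
    show "Ord n" using Ord_mem[OF Ord_omega assms(2)] .
    fix n :: 'a assume "\<And>m. m \<in> elts n \<Longrightarrow> m \<in> elts omega \<longrightarrow> P m"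
    then show "n \<in> elts omega \<longrightarrow> P n" using omega_cases[of n] assms(3,4) by fastforce
  qed
  then show ?thesis using assms(2) by blast
qed

section \<open>Ranks and order types\<close>

lemma Ord_wf_order:
  assumes "\<And>x. x \<in> elts X \<Longrightarrow> Ord x"
  shows "wf_order (\<lambda>x y. x \<in> elts y) (X::'a::zf)"
proof unfold_locales
  show "dfn (\<lambda>v. v 0 \<in> elts (v 1 :: 'a))" by (intro dfn_intros)
  show "\<exists>m\<in>elts Y. \<forall>y\<in>elts Y. y \<notin> elts m" if "elts Y \<subseteq> elts X" "elts Y \<noteq> {}" for Y :: 'a
    using foundation[OF that(2)] by blast
  show "x \<in> elts z" if "z \<in> elts X" "x \<in> elts y" "y \<in> elts z" for x y z
    using Ord_trans[OF assms[OF that(1)] that(2,3)] .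
qed

context wf_order
begin

text \<open>The Mostowski collapse of the order. Transitivity of \<open>lt\<close> makes each value
  a transitive set of ordinals.\<close>

lemma rank_exists:
  obtains r where "is_fun r X"
    "\<And>x. x \<in> elts X \<Longrightarrow> elts (r \<cdot> x) = {r \<cdot> y | y. y \<in> elts X \<and> lt y x}"
    "\<And>x. x \<in> elts X \<Longrightarrow> Ord (r \<cdot> x)"
proof -
  let ?G = "\<lambda>x g. mkset {z. \<exists>y\<in>elts (seg lt X x). z = g \<cdot> y}"
  have dG: "dft (\<lambda>v. ?G (v 0) (v 1))" by (intro dfn_intros)
  obtain r where r: "is_fun r X" "\<forall>x\<in>elts X. r \<cdot> x = ?G x (lam (seg lt X x) (fapp r))"
    by (rule wf_rec[of ?G, OF dG]) blast
  have dr: "dft (\<lambda>v. r \<cdot> v 0)" by (intro dfn_intros)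
  have e: "elts (r \<cdot> x) = {r \<cdot> y | y. y \<in> elts X \<and> lt y x}" if x: "x \<in> elts X" for x
  proof -
    have "{z. \<exists>y\<in>elts (seg lt X x). z = lam (seg lt X x) (fapp r) \<cdot> y} = (fapp r) ` elts (seg lt X x)"
      using lam_app[OF dr, of _ "seg lt X x"] by auto
    then have "elts (r \<cdot> x) = (fapp r) ` elts (seg lt X x)" using bspec[OF r(2) x] elts_mkset[OF small_image[OF dr]] by simp
    then show ?thesis by (auto simp: elts_seg)
  qed
  have "Ord (r \<cdot> x)" if "x \<in> elts X" for x
  proof (rule wf_induct[where P = "\<lambda>x. Ord (r \<cdot> x)", OF _ that])
    show "dfn (\<lambda>v. Ord (r \<cdot> v 0))" by (intro dfn_intros)
    fix x assume x: "x \<in> elts X" and IH: "\<And>y. y \<in> elts X \<Longrightarrow> lt y x \<Longrightarrow> Ord (r \<cdot> y)"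
    show "Ord (r \<cdot> x)"
    proof (rule OrdI)
      show "Ord b" if "b \<in> elts (r \<cdot> x)" for b using that IH e[OF x] by auto
      show "c \<in> elts (r \<cdot> x)" if b: "b \<in> elts (r \<cdot> x)" and c: "c \<in> elts b" for b c
      proof -
        obtain y where y: "y \<in> elts X" "lt y x" "b = r \<cdot> y" using b e[OF x] by auto
        then obtain z where z: "z \<in> elts X" "lt z y" "c = r \<cdot> z" using c e[OF y(1)] by auto
        then show ?thesis using lt_trans[OF z(1) y(1) x z(2) y(2)] e[OF x] by blast
      qed
    qed
  qed
  then show thesis using that r(1) e by blast
qed

lemma linear_rank:
  assumes lin: "\<And>x y. x \<in> elts X \<Longrightarrow> y \<in> elts X \<Longrightarrow> x \<noteq> y \<Longrightarrow> lt x y \<or> lt y x"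
  obtains r a where "is_fun r X" "Ord a" "bij_betw (fapp r) (elts X) (elts a)"
    "\<forall>x\<in>elts X. \<forall>y\<in>elts X. r \<cdot> x \<in> elts (r \<cdot> y) \<longleftrightarrow> lt x y"
    "\<forall>x\<in>elts X. elts (r \<cdot> x) = {r \<cdot> y | y. y \<in> elts X \<and> lt y x}"
proof -
  obtain r where r: "is_fun r X"
    "\<And>x. x \<in> elts X \<Longrightarrow> elts (r \<cdot> x) = {r \<cdot> y | y. y \<in> elts X \<and> lt y x}"
    "\<And>x. x \<in> elts X \<Longrightarrow> Ord (r \<cdot> x)"
    using rank_exists by blast
  have mono: "r \<cdot> x \<in> elts (r \<cdot> y)" if "x \<in> elts X" "y \<in> elts X" "lt x y" for x y
    using r(2)[OF that(2)] that by auto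
  have iff: "r \<cdot> x \<in> elts (r \<cdot> y) \<longleftrightarrow> lt x y" if "x \<in> elts X" "y \<in> elts X" for x y
    using mono[OF that] mono[OF that(2,1)] lin[OF that] mem_irrefl[of "r \<cdot> x"] mem_asym[of "r \<cdot> x" "r \<cdot> y"]
    by (cases "x = y") auto
  have inj: "inj_on (fapp r) (elts X)"
  proof (rule inj_onI, rule ccontr)
    fix x y assume "x \<in> elts X" "y \<in> elts X" "r \<cdot> x = r \<cdot> y" "x \<noteq> y"
    then show False using lin[of x y] mono[of x y] mono[of y x] mem_irrefl[of "r \<cdot> y"] by auto
  qed
  define a where "a = mkset (fapp r ` elts X)"
  have dr: "dft (\<lambda>v. r \<cdot> v 0)" by (intro dfn_intros)
  have ea: "elts a = fapp r ` elts X" unfolding a_def using elts_mkset[OF small_image[OF dr]] .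
  have "Ord a"
  proof (rule OrdI)
    show "Ord b" if "b \<in> elts a" for b using that r(3) unfolding ea by (elim imageE) simp
    show "c \<in> elts a" if "b \<in> elts a" "c \<in> elts b" for b c
    proof -
      obtain x where x: "x \<in> elts X" "b = r \<cdot> x" using \<open>b \<in> elts a\<close> unfolding ea by (elim imageE) simp
      then obtain y where "y \<in> elts X" "c = r \<cdot> y" using r(2)[OF x(1)] \<open>c \<in> elts b\<close> by auto
      then show ?thesis unfolding ea by (intro image_eqI)
    qed
  qed
  moreover have "bij_betw (fapp r) (elts X) (elts a)" using inj ea by (simp add: bij_betw_def)
  ultimately show thesis using that r(1,2) iff by blast
qed

end

text \<open>The formula inside \<open>otp\<close>, rewritten with \<open>fapp\<close> in place of
  \<open>app\<close> so that the definability rules apply to it.\<close>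

definition ord_iso :: "'a::zf \<Rightarrow> 'a \<Rightarrow> 'a \<Rightarrow> bool" where
  "ord_iso h a x \<longleftrightarrow> is_fun h a \<and> bij_betw (fapp h) (elts a) (elts x) \<and>
     (\<forall>i\<in>elts a. \<forall>j\<in>elts a. i \<in> elts j \<longleftrightarrow> h \<cdot> i \<in> elts (h \<cdot> j))"

lemma dfn_ord_iso [dfn_intros]:
  "dft s \<Longrightarrow> dft t \<Longrightarrow> dft u \<Longrightarrow> dfn (\<lambda>v. ord_iso (s v) (t v) (u v :: 'a::zf))"
  by (rule dfn_sub3[of ord_iso]) (unfold ord_iso_def, intro dfn_intros)

lemma otp_altdef: "otp x = (THE a. Ord a \<and> (\<exists>h. ord_iso h a (x::'a::zf)))"
proof -
  have "maps h a x \<and> bij_betw (app h) (elts a) (elts x) \<and>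
      (\<forall>i\<in>elts a. \<forall>j\<in>elts a. i \<in> elts j \<longleftrightarrow> app h i \<in> elts (app h j)) \<longleftrightarrow> ord_iso h a x" for h a
    unfolding ord_iso_def using bij_betw_cong[of "elts a" "app h" "fapp h"]
    by (auto simp: maps_iff app_eq bij_betw_apply)
  then show ?thesis unfolding otp_def by simp
qed

lemma incr_le:
  assumes "dft (\<lambda>v. F (v 0))" "Ord (a::'a::zf)" "\<And>i. i \<in> elts a \<Longrightarrow> Ord (F i)"
    and "\<And>i j. i \<in> elts a \<Longrightarrow> j \<in> elts a \<Longrightarrow> i \<in> elts j \<Longrightarrow> F i \<in> elts (F j)" "i \<in> elts a"
  shows "elts i \<subseteq> elts (F i)"
proof -
  have "i \<in> elts a \<longrightarrow> elts i \<subseteq> elts (F i)"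
  proof (rule Ord_induct[where P = "\<lambda>i. i \<in> elts a \<longrightarrow> elts i \<subseteq> elts (F i)"])
    have "dft (\<lambda>v. F (v n))" for n using dft_sub1[OF assms(1) dft_var] .
    then show "dfn (\<lambda>v. v 0 \<in> elts a \<longrightarrow> elts (v 0) \<subseteq> elts (F (v 0)))" by (intro dfn_intros)
    show "Ord i" using Ord_mem assms(2,5) by blast
    fix j assume IH: "\<And>b. b \<in> elts j \<Longrightarrow> b \<in> elts a \<longrightarrow> elts b \<subseteq> elts (F b)"
    show "j \<in> elts a \<longrightarrow> elts j \<subseteq> elts (F j)"
    proof (intro impI subsetI)
      fix k assume j: "j \<in> elts a" and k: "k \<in> elts j"
      have ka: "k \<in> elts a" using Ord_trans[OF assms(2) k j] .
      then have "elts k \<subseteq> elts (F k)" "F k \<in> elts (F j)" using IH[OF k] assms(4)[OF ka j k] by blast+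
      then show "k \<in> elts (F j)"
        using Ord_subset_mem[of "F j" k "F k"] assms(3)[OF j] Ord_mem[OF assms(2) ka] by blast
    qed
  qed
  then show ?thesis using assms(5) by blast
qed

lemma ord_isoD:
  assumes "ord_iso h a (x::'a::zf)"
  shows "i \<in> elts a \<Longrightarrow> h \<cdot> i \<in> elts x"
    and "y \<in> elts x \<Longrightarrow> \<exists>i\<in>elts a. h \<cdot> i = y"
    and "i \<in> elts a \<Longrightarrow> j \<in> elts a \<Longrightarrow> h \<cdot> i \<in> elts (h \<cdot> j) \<longleftrightarrow> i \<in> elts j"
    and "i \<in> elts a \<Longrightarrow> j \<in> elts a \<Longrightarrow> h \<cdot> i = h \<cdot> j \<longleftrightarrow> i = j"
    and "is_fun h a" and "bij_betw (fapp h) (elts a) (elts x)"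
proof -
  have b: "bij_betw (fapp h) (elts a) (elts x)" using assms by (simp add: ord_iso_def)
  then show "i \<in> elts a \<Longrightarrow> h \<cdot> i \<in> elts x" by (rule bij_betw_apply)
  show "y \<in> elts x \<Longrightarrow> \<exists>i\<in>elts a. h \<cdot> i = y" using bij_betw_imp_surj_on[OF b] by (metis imageE)
  show "i \<in> elts a \<Longrightarrow> j \<in> elts a \<Longrightarrow> h \<cdot> i = h \<cdot> j \<longleftrightarrow> i = j"
    using b by (auto simp: bij_betw_def inj_on_def)
  show "bij_betw (fapp h) (elts a) (elts x)" by (rule b)
qed (use assms in \<open>auto simp: ord_iso_def\<close>)

lemma ord_iso_le:
  assumes h: "ord_iso h a (x::'a::zf)" and a: "Ord a" and b: "Ord b"
    and F: "dft (\<lambda>v. F (v 0))" "\<And>i. i \<in> elts x \<Longrightarrow> F i \<in> elts b"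
    "\<And>i j. i \<in> elts x \<Longrightarrow> j \<in> elts x \<Longrightarrow> i \<in> elts j \<Longrightarrow> F i \<in> elts (F j)"
  shows "elts a \<subseteq> elts b"
proof
  fix i assume i: "i \<in> elts a"
  note hx = ord_isoD(1)[OF h]
  have dF: "dft s \<Longrightarrow> dft (\<lambda>v. F (s v))" for s by (rule dft_sub1[OF F(1)])
  have "elts i \<subseteq> elts (F (h \<cdot> i))"
  proof (rule incr_le[where F = "\<lambda>i. F (h \<cdot> i)", OF _ a _ _ i])
    show "dft (\<lambda>v. F (h \<cdot> v 0))" by (intro dF dfn_intros)
    show "Ord (F (h \<cdot> i))" if "i \<in> elts a" for i using F(2)[OF hx[OF that]] Ord_mem b by blast
    show "F (h \<cdot> i) \<in> elts (F (h \<cdot> j))" if "i \<in> elts a" "j \<in> elts a" "i \<in> elts j" for i j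
      using F(3)[OF hx[OF that(1)] hx[OF that(2)]] ord_isoD(3)[OF h that(1,2)] that(3) by simp
  qed
  then show "i \<in> elts b" using Ord_subset_mem[OF b Ord_mem[OF a i]] F(2)[OF hx[OF i]] by blast
qed

lemma ord_iso_unique:
  assumes "ord_iso h a (x::'a::zf)" "Ord a" "ord_iso g b x" "Ord b"
  shows "a = b"
proof -
  have *: "elts a \<subseteq> elts b" if h: "ord_iso h a x" "Ord a" and g: "ord_iso g b x" "Ord b" for a b h g
  proof -
    have dg: "dft (\<lambda>v. g \<cdot> v 0)" by (intro dfn_intros)
    have bg: "bij_betw (fapp g) (elts b) (elts x)" using g unfolding ord_iso_def by blast
    obtain G where G: "dft (\<lambda>v. G (v 0))" "bij_betw G (elts x) (elts b)"
      "\<And>y. y \<in> elts x \<Longrightarrow> g \<cdot> G y = y"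
      using bij_inverse[OF dg bg] by metis
    have Gb: "G y \<in> elts b" if "y \<in> elts x" for y using G(2) that by (rule bij_betw_apply)
    show ?thesis
    proof (rule ord_iso_le[OF h g(2) G(1)])
      show "G i \<in> elts b" if "i \<in> elts x" for i using Gb[OF that] .
      show "G i \<in> elts (G j)" if "i \<in> elts x" "j \<in> elts x" "i \<in> elts j" for i j
        using ord_isoD(3)[OF g(1) Gb[OF that(1)] Gb[OF that(2)]] G(3)[OF that(1)] G(3)[OF that(2)] that(3)
        by simp
    qed
  qed
  show ?thesis using *[OF assms] *[OF assms(3,4,1,2)] by (intro extensionality) blast
qed

lemma dft_otp [dfn_intros]: "dft s \<Longrightarrow> dft (\<lambda>v. otp (s v :: 'a::zf))"
  by (rule dft_sub1[of otp])
    (unfold otp_altdef, rule dft_The, intro dfn_intros, elim conjE exE, rule ord_iso_unique)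

lemma otp_eqI: "ord_iso h a x \<Longrightarrow> Ord a \<Longrightarrow> otp x = (a::'a::zf)"
  unfolding otp_altdef by (rule the_equality) (blast, elim conjE exE, rule ord_iso_unique)

lemma otp_exists:
  assumes "\<And>y. y \<in> elts x \<Longrightarrow> Ord (y::'a::zf)"
  obtains h where "Ord (otp x)" "ord_iso h (otp x) x"
proof -
  interpret wf_order "\<lambda>x y. x \<in> elts y" x by (rule Ord_wf_order) (rule assms)
  have lin: "y \<in> elts z \<or> z \<in> elts y" if "y \<in> elts x" "z \<in> elts x" "y \<noteq> z" for y z
    using Ord_linear[OF assms assms] that by blast
  obtain r a where r: "is_fun r x" "Ord a" "bij_betw (fapp r) (elts x) (elts a)"
    "\<forall>y\<in>elts x. \<forall>z\<in>elts x. r \<cdot> y \<in> elts (r \<cdot> z) \<longleftrightarrow> y \<in> elts z"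
    by (rule linear_rank[OF lin]) blast+
  have dr: "dft (\<lambda>v. r \<cdot> v 0)" by (intro dfn_intros)
  obtain G where G: "dft (\<lambda>v. G (v 0))" "bij_betw G (elts a) (elts x)" "\<And>y. y \<in> elts a \<Longrightarrow> r \<cdot> G y = y"
    using bij_inverse[OF dr r(3)] by metis
  have Gx: "G i \<in> elts x" if "i \<in> elts a" for i using G(2) that by (rule bij_betw_apply)
  have Ga: "lam a G \<cdot> i = G i" if "i \<in> elts a" for i using lam_app[OF G(1) that] .
  have "ord_iso (lam a G) a x" unfolding ord_iso_def
  proof (intro conjI ballI)
    show "is_fun (lam a G) a" using G(1) by blast
    show "bij_betw (fapp (lam a G)) (elts a) (elts x)" using G(2) Ga by (subst bij_betw_cong[of _ _ G]) auto
    show "(i \<in> elts j) = (lam a G \<cdot> i \<in> elts (lam a G \<cdot> j))" if "i \<in> elts a" "j \<in> elts a" for i j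
      using bspec[OF bspec[OF r(4) Gx[OF that(1)]] Gx[OF that(2)]] G(3)[OF that(1)] G(3)[OF that(2)] Ga[OF that(1)] Ga[OF that(2)] by simp
  qed
  then show thesis using otp_eqI[OF _ r(2)] that r(2) by blast
qed

lemma otp_le:
  assumes "\<And>y. y \<in> elts x \<Longrightarrow> Ord (y::'a::zf)" "Ord b"
    and "dft (\<lambda>v. F (v 0))" "\<And>i. i \<in> elts x \<Longrightarrow> F i \<in> elts b"
    "\<And>i j. i \<in> elts x \<Longrightarrow> j \<in> elts x \<Longrightarrow> i \<in> elts j \<Longrightarrow> F i \<in> elts (F j)"
  shows "elts (otp x) \<subseteq> elts b"
proof -
  obtain h where "Ord (otp x)" "ord_iso h (otp x) x" using otp_exists[OF assms(1)] by blast
  then show ?thesis using ord_iso_le[OF _ _ assms(2,3)] assms(4,5) by blast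
qed

lemma ord_iso_lam:
  assumes "dft (\<lambda>v. F (v 0))" "bij_betw F (elts a) (elts (x::'a::zf))"
    "\<And>i j. i \<in> elts a \<Longrightarrow> j \<in> elts a \<Longrightarrow> i \<in> elts j \<longleftrightarrow> F i \<in> elts (F j)"
  shows "ord_iso (lam a F) a x"
  unfolding ord_iso_def
proof (intro conjI ballI)
  show "is_fun (lam a F) a" using assms(1) by blast
  show "bij_betw (fapp (lam a F)) (elts a) (elts x)"
    using assms(2) lam_app[OF assms(1)] by (subst bij_betw_cong[of _ _ F]) auto
qed (use assms(3) lam_app[OF assms(1)] in simp)

lemma otp_Ord: "Ord a \<Longrightarrow> otp a = (a::'a::zf)"
  by (rule otp_eqI[OF ord_iso_lam[of "\<lambda>x. x"]]) (auto simp: bij_betw_def intro: dfn_intros)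

lemma otp_subset:
  assumes "Ord b" "elts x \<subseteq> elts (b::'a::zf)"
  shows "elts (otp x) \<subseteq> elts b"
  by (rule otp_le[OF _ assms(1), of _ "\<lambda>x. x"]) (use assms Ord_mem in \<open>auto intro: dfn_intros\<close>)

section \<open>Cofinality and cardinals\<close>

lemma dfn_unbounded_in [dfn_intros]: "dft s \<Longrightarrow> dft t \<Longrightarrow> dfn (\<lambda>v. unbounded_in (s v) (t v :: 'a::zf))"
  unfolding unbounded_in_def by (intro dfn_intros dft_shift)

lemma dft_cf [dfn_intros]: "dft s \<Longrightarrow> dft (\<lambda>v. cf (s v :: 'a::zf))"
  by (rule dft_sub1[of cf]) (unfold cf_def, intro dfn_intros)

lemma unbounded_in_self: "unbounded_in d (d::'a::zf)"
  unfolding unbounded_in_def by blast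

lemma cf_props:
  assumes "Ord (d::'a::zf)"
  shows "Ord (cf d)" "\<exists>x. unbounded_in x d \<and> otp x = cf d" "elts (cf d) \<subseteq> elts d"
    "unbounded_in x d \<Longrightarrow> elts (cf d) \<subseteq> elts (otp x)"
proof -
  let ?P = "\<lambda>a. \<exists>x. unbounded_in x d \<and> otp x = a"
  have d: "dfn (\<lambda>v. ?P (v 0))" by (intro dfn_intros)
  have P: "?P d" using unbounded_in_self otp_Ord[OF assms] by blast
  show "Ord (cf d)" "\<exists>x. unbounded_in x d \<and> otp x = cf d" "elts (cf d) \<subseteq> elts d"
    unfolding cf_def using least_ord_ex[OF d assms P] least_ord_le[OF d assms P] by blast+
  show "elts (cf d) \<subseteq> elts (otp x)" if x: "unbounded_in x d"
  proof -
    have "Ord y" if "y \<in> elts x" for y using x that Ord_mem[OF assms] unfolding unbounded_in_def by blast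
    then have "Ord (otp x)" using otp_exists[of x] by blast
    moreover have "?P (otp x)" using x by blast
    ultimately show ?thesis unfolding cf_def by (rule least_ord_le[OF d])
  qed
qed

text \<open>The record values of the sequence \<open>p\<close>, those above all earlier values. They
  turn a map with unbounded range, monotone or not, into a cofinal set whose order type does not
  exceed the length.\<close>

definition records :: "'a::zf \<Rightarrow> 'a \<Rightarrow> 'a" where
  "records p a = mkset {y. \<exists>i\<in>elts a. y = p \<cdot> i \<and> (\<forall>k\<in>elts i. p \<cdot> k \<in> elts y)}"

lemma dft_records [dfn_intros]: "dft s \<Longrightarrow> dft t \<Longrightarrow> dft (\<lambda>v. records (s v) (t v :: 'a::zf))"
  by (rule dft_sub2[of records]) (unfold records_def, intro dfn_intros)

lemma elts_records: "elts (records p a) = {y. \<exists>i\<in>elts a. y = p \<cdot> i \<and> (\<forall>k\<in>elts i. p \<cdot> k \<in> elts (y::'a::zf))}"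
  unfolding records_def
proof (rule elts_mkset, rule small_Collect)
  have "dft (\<lambda>v. p \<cdot> v 0)" by (intro dfn_intros)
  then show "y \<in> elts (mkset (fapp p ` elts a))"
    if "\<exists>i\<in>elts a. y = p \<cdot> i \<and> (\<forall>k\<in>elts i. p \<cdot> k \<in> elts y)" for y
    using that elts_mkset[OF small_image[of "fapp p" a]] by auto
qed (intro dfn_intros)

text \<open>For \<open>b\<close> in \<open>d\<close> the first \<open>i\<close> with
  \<open>p \<cdot> i\<close> at least \<open>b\<close> gives a record. Sending a record to the first
  index where it is attained is strictly increasing, which bounds the order type.\<close>

lemma records_cofinal:
  assumes a: "Ord (a::'a::zf)" and d: "Ord d" and p: "\<And>i. i \<in> elts a \<Longrightarrow> p \<cdot> i \<in> elts d"
    and unb: "\<And>b. b \<in> elts d \<Longrightarrow> \<exists>i\<in>elts a. elts b \<subseteq> elts (p \<cdot> i)"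
  shows "unbounded_in (records p a) d" "elts (otp (records p a)) \<subseteq> elts a"
proof -
  have sub: "elts (records p a) \<subseteq> elts d" using p by (auto simp: elts_records)
  have pO: "Ord (p \<cdot> i)" if "i \<in> elts a" for i using Ord_mem[OF d p[OF that]] .
  show "unbounded_in (records p a) d" unfolding unbounded_in_def
  proof (intro conjI sub ballI)
    fix b assume b: "b \<in> elts d"
    let ?P = "\<lambda>i. i \<in> elts a \<and> elts b \<subseteq> elts (p \<cdot> i)"
    have dP: "dfn (\<lambda>v. ?P (v 0))" by (intro dfn_intros)
    obtain i0 where "i0 \<in> elts a" "elts b \<subseteq> elts (p \<cdot> i0)" using unb[OF b] by blast
    then obtain i where i: "?P i" "\<forall>k\<in>elts i. \<not> ?P k" using least_ord_ex[OF dP, of i0] Ord_mem[OF a] by blast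
    have "p \<cdot> k \<in> elts (p \<cdot> i)" if k: "k \<in> elts i" for k
    proof -
      have ka: "k \<in> elts a" using Ord_trans[OF a k] i(1) by blast
      then have "\<not> elts b \<subseteq> elts (p \<cdot> k)" using i(2) k by blast
      then have "p \<cdot> k \<in> elts b" using Ord_not_subset[OF Ord_mem[OF d b] pO[OF ka]] by blast
      then show ?thesis using i(1) by blast
    qed
    then have "p \<cdot> i \<in> elts (records p a)" using i(1) by (auto simp: elts_records)
    then show "\<exists>x\<in>elts (records p a). elts b \<subseteq> elts x" using i(1) by blast
  qed
  let ?Q = "\<lambda>y i. i \<in> elts a \<and> y = p \<cdot> i"
  have dQ: "dfn (\<lambda>v. ?Q y (v 0))" for y by (intro dfn_intros)
  define F where "F y = least_ord (?Q y)" for y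
  have dF: "dft (\<lambda>v. F (v 0))" unfolding F_def by (intro dfn_intros)
  have F: "F y \<in> elts a" "y = p \<cdot> F y" "k \<in> elts (F y) \<Longrightarrow> p \<cdot> k \<in> elts y" if y: "y \<in> elts (records p a)" for y k
  proof -
    obtain i where i: "i \<in> elts a" "y = p \<cdot> i" "\<forall>k\<in>elts i. p \<cdot> k \<in> elts y" using y by (auto simp: elts_records)
    have *: "Ord (F y) \<and> ?Q y (F y) \<and> (\<forall>b\<in>elts (F y). \<not> ?Q y b)"
      unfolding F_def using least_ord_ex[OF dQ, of i] i Ord_mem[OF a] by blast
    then show "F y \<in> elts a" "y = p \<cdot> F y" by blast+
    have "elts (F y) \<subseteq> elts i" unfolding F_def using least_ord_le[OF dQ, of i] i Ord_mem[OF a] by blast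
    then show "k \<in> elts (F y) \<Longrightarrow> p \<cdot> k \<in> elts y" using i(3) by blast
  qed
  show "elts (otp (records p a)) \<subseteq> elts a"
  proof (rule otp_le[OF _ a dF F(1)])
    show "Ord y" if "y \<in> elts (records p a)" for y using sub that Ord_mem[OF d] by blast
    fix y z assume y: "y \<in> elts (records p a)" and z: "z \<in> elts (records p a)" and yz: "y \<in> elts z"
    show "F y \<in> elts (F z)"
    proof (rule ccontr)
      assume n: "F y \<notin> elts (F z)"
      have "Ord (F y)" "Ord (F z)" using Ord_mem[OF a] F(1)[OF y] F(1)[OF z] by blast+
      then consider "F z = F y" | "F z \<in> elts (F y)" using Ord_linear n by blast
      then show False
      proof cases
        case 1
        have "p \<cdot> F y = z" unfolding 1[symmetric] by (rule F(2)[OF z, symmetric])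
        then have "z = y" using F(2)[OF y] by simp
        then show False using yz mem_irrefl[of y] by simp
      next
        case 2
        have "p \<cdot> F z \<in> elts y" by (rule F(3)[OF y 2])
        then have "z \<in> elts y" by (simp only: F(2)[OF z, symmetric])
        then show False using mem_asym[OF yz] by simp
      qed
    qed
  qed
qed

lemma cf_le_map:
  assumes a: "Ord (a::'a::zf)" and d: "Ord d" and F: "dft (\<lambda>v. F (v 0))" "\<And>i. i \<in> elts a \<Longrightarrow> F i \<in> elts d"
    and unb: "\<And>b. b \<in> elts d \<Longrightarrow> \<exists>i\<in>elts a. elts b \<subseteq> elts (F i)"
  shows "elts (cf d) \<subseteq> elts a"
proof -
  have l: "lam a F \<cdot> i = F i" if "i \<in> elts a" for i using lam_app[OF F(1) that] .
  have 1: "lam a F \<cdot> i \<in> elts d" if "i \<in> elts a" for i using F(2)[OF that] l[OF that] by simp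
  have 2: "\<exists>i\<in>elts a. elts b \<subseteq> elts (lam a F \<cdot> i)" if "b \<in> elts d" for b using unb[OF that] l by auto
  have u: "unbounded_in (records (lam a F) a) d" and o: "elts (otp (records (lam a F) a)) \<subseteq> elts a"
    using records_cofinal[OF a d 1 2] by blast+
  show ?thesis using cf_props(4)[OF d u] o by blast
qed

text \<open>A pigeonhole principle. If every fibre were bounded, the least bounds of the fibres
  would form a map from \<open>m\<close> to \<open>d\<close> with unbounded range, although
  \<open>m\<close> is below \<open>cf d\<close>. Taking least bounds avoids choice.\<close>

lemma unbounded_fibre:
  assumes d: "Ord (d::'a::zf)" and m: "m \<in> elts (cf d)" and dP: "dfn (\<lambda>v. P (v 0))" and dF: "dft (\<lambda>v. F (v 0))"
    and P: "\<And>a. a \<in> elts d \<Longrightarrow> \<exists>j\<in>elts d. P j \<and> elts a \<subseteq> elts j"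
    and F: "\<And>j. j \<in> elts d \<Longrightarrow> P j \<Longrightarrow> F j \<in> elts m"
  shows "\<exists>i\<in>elts m. \<forall>a\<in>elts d. \<exists>j\<in>elts d. P j \<and> F j = i \<and> elts a \<subseteq> elts j"
proof (rule ccontr)
  assume n: "\<not> ?thesis"
  have dP' [dfn_intros]: "dft s \<Longrightarrow> dfn (\<lambda>v. P (s v))" and dF' [dfn_intros]: "dft s \<Longrightarrow> dft (\<lambda>v. F (s v))" for s
    by (rule dfn_sub1[of P, OF dP], assumption, rule dft_sub1[of F, OF dF], assumption)
  have mO: "Ord m" using Ord_mem[OF cf_props(1)[OF d] m] .
  let ?Q = "\<lambda>i a. a \<in> elts d \<and> (\<forall>j\<in>elts d. P j \<and> F j = i \<longrightarrow> \<not> elts a \<subseteq> elts j)"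
  have dQ: "dfn (\<lambda>v. ?Q i (v 0))" for i by (intro dfn_intros)
  have Q: "?Q i (least_ord (?Q i))" if i: "i \<in> elts m" for i
  proof -
    obtain a where a: "?Q i a" using n i by blast
    then have "Ord a" using Ord_mem[OF d] by blast
    from least_ord_ex[OF dQ this a] show ?thesis by (elim conjE) (intro conjI)
  qed
  have "elts (cf d) \<subseteq> elts m"
  proof (rule cf_le_map[OF mO d])
    show "dft (\<lambda>v. least_ord (?Q (v 0)))" by (intro dfn_intros)
    show "least_ord (?Q i) \<in> elts d" if "i \<in> elts m" for i using Q[OF that] by blast
    fix b assume b: "b \<in> elts d"
    then obtain j where j: "j \<in> elts d" "P j" "elts b \<subseteq> elts j" using P by blast
    let ?a = "least_ord (?Q (F j))"
    have a: "?a \<in> elts d" "\<not> elts ?a \<subseteq> elts j" using Q[OF F[OF j(1,2)]] j by blast+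
    then have "j \<in> elts ?a" using Ord_not_subset[of ?a j] Ord_mem[OF d] j(1) by blast
    then have "elts b \<subseteq> elts ?a" using j(3) Ord_mem_subset[OF Ord_mem[OF d a(1)]] by blast
    then show "\<exists>i\<in>elts m. elts b \<subseteq> elts (least_ord (?Q i))" using F[OF j(1,2)] by blast
  qed
  then show False using m mem_irrefl by blast
qed

lemma Limit_Ord: "Limit d \<Longrightarrow> Ord (d::'a::zf)"
  unfolding Limit_def by blast

lemma otp_unbounded_Limit:
  assumes d: "Limit (d::'a::zf)" and x: "unbounded_in x d"
  shows "Limit (otp x)"
proof -
  have xd: "elts x \<subseteq> elts d" using x unfolding unbounded_in_def by blast
  have xO: "Ord y" if "y \<in> elts x" for y using xd that Ord_mem[OF Limit_Ord[OF d]] by blast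
  obtain h where O: "Ord (otp x)" and h: "ord_iso h (otp x) x" using otp_exists[of x] xO by blast
  obtain y where "y \<in> elts x" using x vempty_in_Limit[OF d] unfolding unbounded_in_def by blast
  then obtain i where "i \<in> elts (otp x)" using ord_isoD(2)[OF h] by blast
  then have ne: "otp x \<noteq> vempty" by auto
  have "vsucc i \<in> elts (otp x)" if i: "i \<in> elts (otp x)" for i
  proof -
    have "vsucc (h \<cdot> i) \<in> elts d" using d xd ord_isoD(1)[OF h i] unfolding Limit_def by blast
    then obtain y where y: "y \<in> elts x" "elts (vsucc (h \<cdot> i)) \<subseteq> elts y" using x unfolding unbounded_in_def by blast
    obtain j where j: "j \<in> elts (otp x)" "h \<cdot> j = y" using ord_isoD(2)[OF h y(1)] by blast
    have "i \<in> elts j" using ord_isoD(3)[OF h i j(1)] j(2) y(2) by simp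
    then show ?thesis
      using Ord_subset_mem[OF O Ord_vsucc[OF Ord_mem[OF O i]] Ord_vsucc_subset[OF Ord_mem[OF O j(1)]] j(1)] by blast
  qed
  then show ?thesis unfolding Limit_def using O ne by blast
qed

lemma cf_Limit: "Limit d \<Longrightarrow> Limit (cf (d::'a::zf))"
  using cf_props(2)[OF Limit_Ord] otp_unbounded_Limit by metis

lemma cf_enum:
  assumes "Ord (d::'a::zf)"
  obtains h where "is_fun h (cf d)" "\<forall>i\<in>elts (cf d). h \<cdot> i \<in> elts d"
    "\<forall>b\<in>elts d. \<exists>i\<in>elts (cf d). elts b \<subseteq> elts (h \<cdot> i)"
    "\<forall>i\<in>elts (cf d). \<forall>j\<in>elts (cf d). h \<cdot> i \<in> elts (h \<cdot> j) \<longleftrightarrow> i \<in> elts j"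
proof -
  obtain x where x: "unbounded_in x d" "otp x = cf d" using cf_props(2)[OF assms] by blast
  have xd: "elts x \<subseteq> elts d" using x(1) unfolding unbounded_in_def by blast
  have "Ord y" if "y \<in> elts x" for y using xd that Ord_mem[OF assms] by blast
  then obtain h where h: "ord_iso h (cf d) x" using otp_exists[of x] x(2) by metis
  have "\<exists>i\<in>elts (cf d). elts b \<subseteq> elts (h \<cdot> i)" if "b \<in> elts d" for b
    using x(1) that ord_isoD(2)[OF h] unfolding unbounded_in_def by metis
  then show thesis using that ord_isoD(1,3,5)[OF h] xd by blast
qed

lemma cf_cf:
  assumes d: "Ord (d::'a::zf)"
  shows "cf (cf d) = cf d"
proof -
  let ?a = "cf d"
  note O = cf_props(1)[OF d]
  obtain h where h: "\<forall>i\<in>elts ?a. h \<cdot> i \<in> elts d" "\<forall>b\<in>elts d. \<exists>i\<in>elts ?a. elts b \<subseteq> elts (h \<cdot> i)"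
    "\<forall>i\<in>elts ?a. \<forall>j\<in>elts ?a. h \<cdot> i \<in> elts (h \<cdot> j) \<longleftrightarrow> i \<in> elts j"
    by (rule cf_enum[OF d]) blast
  obtain g where g: "\<forall>i\<in>elts (cf ?a). g \<cdot> i \<in> elts ?a" "\<forall>b\<in>elts ?a. \<exists>i\<in>elts (cf ?a). elts b \<subseteq> elts (g \<cdot> i)"
    by (rule cf_enum[OF O]) blast
  have "elts ?a \<subseteq> elts (cf ?a)"
  proof (rule cf_le_map[OF cf_props(1)[OF O] d])
    show "dft (\<lambda>v. h \<cdot> (g \<cdot> v 0))" by (intro dfn_intros)
    show "h \<cdot> (g \<cdot> i) \<in> elts d" if "i \<in> elts (cf ?a)" for i using h(1) g(1) that by blast
    fix b assume "b \<in> elts d"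
    then obtain i where i: "i \<in> elts ?a" "elts b \<subseteq> elts (h \<cdot> i)" using h(2) by blast
    then obtain j where j: "j \<in> elts (cf ?a)" "elts i \<subseteq> elts (g \<cdot> j)" using g(2) by blast
    have gj: "g \<cdot> j \<in> elts ?a" using g(1) j(1) by blast
    then have "i = g \<cdot> j \<or> i \<in> elts (g \<cdot> j)" using Ord_subset_iff[OF Ord_mem[OF O i(1)] Ord_mem[OF O gj]] j(2) by blast
    then have "elts (h \<cdot> i) \<subseteq> elts (h \<cdot> (g \<cdot> j))"
      using h(1,3) i(1) gj Ord_mem_subset[OF Ord_mem[OF d]] by blast
    then show "\<exists>i\<in>elts (cf ?a). elts b \<subseteq> elts (h \<cdot> (g \<cdot> i))" using i(2) j(1) by blast
  qed
  then show ?thesis using cf_props(3)[OF O] by (intro extensionality) blast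
qed

text \<open>The image of such an injection is a set of ordinals below \<open>b\<close>. Its order
  type is at most \<open>b\<close> and equipollent to \<open>k\<close>, against initiality.\<close>

lemma no_inj_lower:
  assumes k: "Ord (k::'a::zf)" "\<And>b. b \<in> elts k \<Longrightarrow> \<not> eqpoll k b" and b: "b \<in> elts k"
    and F: "dft (\<lambda>v. F (v 0))" "\<And>x. x \<in> elts k \<Longrightarrow> F x \<in> elts b"
  shows "\<not> inj_on F (elts k)"
proof
  assume inj: "inj_on F (elts k)"
  let ?y = "mkset (F ` elts k)"
  have y: "elts ?y = F ` elts k" by (rule elts_mkset[OF small_image[OF F(1)]])
  have yb: "elts ?y \<subseteq> elts b" using y F(2) by auto
  note bO = Ord_mem[OF k(1) b]
  have yO: "Ord z" if "z \<in> elts ?y" for z using Ord_mem[OF bO] yb that by blast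
  obtain h where O: "Ord (otp ?y)" and h: "ord_iso h (otp ?y) ?y" using otp_exists[OF yO] by blast
  have "elts (otp ?y) \<subseteq> elts b" by (rule otp_subset[OF bO yb])
  then have mem: "otp ?y \<in> elts k" using Ord_subset_mem[OF k(1) O _ b] by blast
  have "bij_betw F (elts k) (elts ?y)" using inj y by (simp add: bij_betw_def)
  then have 1: "eqpoll k ?y" by (rule eqpollI[OF F(1)])
  have "eqpoll (otp ?y) ?y" unfolding eqpoll_iff using ord_isoD(5,6)[OF h] by blast
  then have "eqpoll k (otp ?y)" using 1 eqpoll_sym eqpoll_trans by blast
  then show False using k(2)[OF mem] by blast
qed

lemma cf_initial:
  assumes d: "Ord (d::'a::zf)" and b: "b \<in> elts (cf d)"
  shows "\<not> eqpoll (cf d) b"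
proof
  assume "eqpoll (cf d) b"
  then obtain f where f: "bij_betw (fapp f) (elts b) (elts (cf d))" using eqpoll_sym eqpollE by metis
  obtain h where h: "\<forall>i\<in>elts (cf d). h \<cdot> i \<in> elts d" "\<forall>b\<in>elts d. \<exists>i\<in>elts (cf d). elts b \<subseteq> elts (h \<cdot> i)"
    by (rule cf_enum[OF d]) blast
  have fa: "f \<cdot> i \<in> elts (cf d)" if "i \<in> elts b" for i using f that by (rule bij_betw_apply)
  have "elts (cf d) \<subseteq> elts b"
  proof (rule cf_le_map[OF Ord_mem[OF cf_props(1)[OF d] b] d])
    show "dft (\<lambda>v. h \<cdot> (f \<cdot> v 0))" by (intro dfn_intros)
    show "h \<cdot> (f \<cdot> i) \<in> elts d" if "i \<in> elts b" for i using h(1) fa[OF that] by blast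
    fix c assume "c \<in> elts d"
    then obtain i where i: "i \<in> elts (cf d)" "elts c \<subseteq> elts (h \<cdot> i)" using h(2) by blast
    have "i \<in> fapp f ` elts b" using bij_betw_imp_surj_on[OF f] i(1) by simp
    then obtain j where "j \<in> elts b" "i = f \<cdot> j" by (rule imageE)
    then show "\<exists>i\<in>elts b. elts c \<subseteq> elts (h \<cdot> (f \<cdot> i))" using i(2) by blast
  qed
  then show False using b mem_irrefl by blast
qed

lemma cf_Reg:
  assumes "Limit (d::'a::zf)"
  shows "Reg (cf d)"
  unfolding Reg_def aleph_def
  using omega_least[OF cf_Limit[OF assms]] cf_props(1) cf_initial cf_cf Limit_Ord[OF assms] by blast

lemma cf_omega: "cf omega = (omega::'a::zf)"
  using omega_least[OF cf_Limit[OF omega_Limit]] cf_props(3)[OF Ord_omega] by (intro extensionality) blast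

lemma aleph_omega: "aleph (omega::'a::zf)"
  using cf_Reg[OF omega_Limit] unfolding Reg_def cf_omega by blast

section \<open>Alephs and cardinalities of well-orderable sets\<close>

lemma aleph_Ord: "aleph k \<Longrightarrow> Ord (k::'a::zf)"
  unfolding aleph_def by blast

lemma aleph_no_inj:
  "aleph k \<Longrightarrow> b \<in> elts (k::'a::zf) \<Longrightarrow> dft (\<lambda>v. F (v 0)) \<Longrightarrow> (\<And>x. x \<in> elts k \<Longrightarrow> F x \<in> elts b) \<Longrightarrow> \<not> inj_on F (elts k)"
  by (rule no_inj_lower) (auto simp: aleph_def)

lemma dfn_aleph [dfn_intros]: "dft s \<Longrightarrow> dfn (\<lambda>v. aleph (s v :: 'a::zf))"
  unfolding aleph_def by (intro dfn_intros dft_shift)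

lemma dfn_Reg [dfn_intros]: "dft s \<Longrightarrow> dfn (\<lambda>v. Reg (s v :: 'a::zf))"
  unfolding Reg_def by (intro dfn_intros)

lemma dft_vcard [dfn_intros]: "dft s \<Longrightarrow> dft (\<lambda>v. vcard (s v :: 'a::zf))"
  by (rule dft_sub1[of vcard]) (unfold vcard_def, intro dfn_intros)

lemma vcard_props:
  assumes "Ord (a::'a::zf)" "eqpoll X a"
  shows "Ord (vcard X)" "eqpoll X (vcard X)" "elts (vcard X) \<subseteq> elts a"
    "b \<in> elts (vcard X) \<Longrightarrow> \<not> eqpoll (vcard X) b"
proof -
  have d: "dfn (\<lambda>v. eqpoll X (v 0))" by (intro dfn_intros)
  show 1: "Ord (vcard X)" "eqpoll X (vcard X)" "elts (vcard X) \<subseteq> elts a"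
    unfolding vcard_def using least_ord_ex[OF d assms] least_ord_le[OF d assms] by blast+
  have "\<forall>b\<in>elts (vcard X). \<not> eqpoll X b" unfolding vcard_def using least_ord_ex[OF d assms] by blast
  then show "b \<in> elts (vcard X) \<Longrightarrow> \<not> eqpoll (vcard X) b" using eqpoll_trans[OF 1(2)] by blast
qed

lemma inj_eqpoll_Ord:
  assumes F: "dft (\<lambda>v. F (v 0))" "inj_on F (elts (X::'a::zf))" "\<And>x. x \<in> elts X \<Longrightarrow> Ord (F x)"
  obtains a where "Ord a" "eqpoll X a"
proof -
  let ?y = "mkset (F ` elts X)"
  have y: "elts ?y = F ` elts X" by (rule elts_mkset[OF small_image[OF F(1)]])
  have "Ord z" if "z \<in> elts ?y" for z using F(3) that unfolding y by (elim imageE) simp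
  then obtain h where O: "Ord (otp ?y)" and h: "ord_iso h (otp ?y) ?y" using otp_exists[of ?y] by blast
  have "eqpoll X ?y" using F(2) y by (intro eqpollI[OF F(1)]) (simp add: bij_betw_def)
  moreover have "eqpoll (otp ?y) ?y" unfolding eqpoll_iff using ord_isoD(5,6)[OF h] by blast
  ultimately show thesis using that[OF O] eqpoll_sym eqpoll_trans by blast
qed

lemma vcard_le_inj:
  assumes b: "Ord (b::'a::zf)" and F: "dft (\<lambda>v. F (v 0))" "inj_on F (elts X)" "\<And>x. x \<in> elts X \<Longrightarrow> F x \<in> elts b"
  shows "elts (vcard X) \<subseteq> elts b"
proof -
  let ?y = "mkset (F ` elts X)"
  have y: "elts ?y = F ` elts X" by (rule elts_mkset[OF small_image[OF F(1)]])
  have yb: "elts ?y \<subseteq> elts b" unfolding y using F(3) by auto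
  have "Ord z" if "z \<in> elts ?y" for z using Ord_mem[OF b] yb that by blast
  then obtain h where O: "Ord (otp ?y)" and h: "ord_iso h (otp ?y) ?y" using otp_exists[of ?y] by blast
  have "eqpoll X ?y" using F(2) y by (intro eqpollI[OF F(1)]) (simp add: bij_betw_def)
  moreover have "eqpoll (otp ?y) ?y" unfolding eqpoll_iff using ord_isoD(5,6)[OF h] by blast
  ultimately have "eqpoll X (otp ?y)" using eqpoll_sym eqpoll_trans by blast
  then show ?thesis using vcard_props(3)[OF O] otp_subset[OF b yb] by blast
qed

lemma vcard_subset:
  assumes "Ord (b::'a::zf)" "elts x \<subseteq> elts b"
  shows "Ord (vcard x)" "eqpoll x (vcard x)" "elts (vcard x) \<subseteq> elts b" "b' \<in> elts (vcard x) \<Longrightarrow> \<not> eqpoll (vcard x) b'"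
proof -
  have d: "dft (\<lambda>v. v 0)" by (intro dfn_intros)
  have o: "Ord y" if "y \<in> elts x" for y using assms(2) Ord_mem[OF assms(1)] that by blast
  obtain a where a: "Ord a" "eqpoll x a" by (rule inj_eqpoll_Ord[OF d _ o]) auto
  show "Ord (vcard x)" "eqpoll x (vcard x)" "b' \<in> elts (vcard x) \<Longrightarrow> \<not> eqpoll (vcard x) b'"
    using vcard_props[OF a] by blast+
  show "elts (vcard x) \<subseteq> elts b" by (rule vcard_le_inj[OF assms(1) d]) (use assms(2) in auto)
qed

lemma initial_Limit:
  assumes "aleph (k::'a::zf)"
  shows "Limit k"
proof -
  have O: "Ord k" and om: "elts omega \<subseteq> elts k" using assms unfolding aleph_def by blast+
  have "vsucc a \<in> elts k" if a: "a \<in> elts k" for a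
  proof (rule ccontr)
    assume n: "vsucc a \<notin> elts k"
    have aO: "Ord a" using Ord_mem[OF O a] .
    have ka: "elts k = insert a (elts a)"
      using n a Ord_not_mem[OF Ord_vsucc[OF aO] O] Ord_vsucc_subset[OF O a] by auto
    have "a \<notin> elts omega"
    proof
      assume "a \<in> elts omega"
      then have "vsucc a \<in> elts omega" using omega_Limit unfolding Limit_def by blast
      then show False using n om by blast
    qed
    then have oma: "elts omega \<subseteq> elts a" using Ord_not_mem[OF aO Ord_omega] by blast
    \<comment> \<open>Hilbert's hotel: if \<open>k\<close> were the successor of \<open>a\<close>,
      moving \<omega> up by one place makes room for \<open>a\<close> at 0 and injects
      \<open>k\<close> into \<open>a\<close>.\<close>
    let ?F = "\<lambda>x. if x = a then vempty else if x \<in> elts omega then vsucc x else x"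
    have succ_inj: "x = y" if "vsucc x = vsucc y" for x y :: 'a
    proof -
      have "x \<in> elts (vsucc y)" "y \<in> elts (vsucc x)" unfolding that[symmetric] by simp (simp add: that)
      then show ?thesis using mem_asym[of x y] by auto
    qed
    have v0: "vsucc x \<noteq> vempty" for x :: 'a using eq_vempty_iff[of "vsucc x"] by simp
    have S: "vsucc x \<in> elts omega" if "x \<in> elts omega" for x :: 'a using that omega_Limit unfolding Limit_def by blast
    have Z: "vempty \<in> elts (omega::'a)" by (rule vempty_in_Limit[OF omega_Limit])
    have "\<not> inj_on ?F (elts k)"
    proof (rule aleph_no_inj[OF assms a])
      show "dft (\<lambda>v. if v 0 = a then vempty else if v 0 \<in> elts omega then vsucc (v 0) else v 0)"
        by (intro dfn_intros)
      show "?F x \<in> elts a" if "x \<in> elts k" for x using that ka oma S Z by auto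
    qed
    moreover have "inj_on ?F (elts k)"
    proof (rule inj_onI)
      fix x y assume "?F x = ?F y"
      then show "x = y"
        by (cases "x = a"; cases "y = a"; cases "x \<in> elts omega"; cases "y \<in> elts omega")
          (auto simp: v0 v0[symmetric] S Z dest: succ_inj)
    qed
    ultimately show False by blast
  qed
  moreover have "k \<noteq> vempty" using om vempty_in_Limit[OF omega_Limit] by auto
  ultimately show ?thesis unfolding Limit_def using O by blast
qed

section \<open>Squares of infinite ordinals\<close>

text \<open>Three keys cover both uses: maximum, first and second coordinate for Goedel's ordering
  of pairs, and later rank, code and a constant for the subsets of \<mu>.\<close>

definition lex :: "('a::zf \<Rightarrow> 'a) \<Rightarrow> ('a \<Rightarrow> 'a) \<Rightarrow> ('a \<Rightarrow> 'a) \<Rightarrow> 'a \<Rightarrow> 'a \<Rightarrow> bool" where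
  "lex F G H x y \<longleftrightarrow> F x \<in> elts (F y) \<or> F x = F y \<and> (G x \<in> elts (G y) \<or> G x = G y \<and> H x \<in> elts (H y))"

lemma image_minimal:
  assumes "dft (\<lambda>v. F (v 0))" "elts (Y::'a::zf) \<noteq> {}"
  shows "\<exists>m\<in>elts Y. \<forall>y\<in>elts Y. F y \<notin> elts (F m)"
proof -
  let ?Z = "mkset (F ` elts Y)"
  have Z: "elts ?Z = F ` elts Y" by (rule elts_mkset[OF small_image[OF assms(1)]])
  then have "elts ?Z \<noteq> {}" using assms(2) by simp
  then obtain z where z: "z \<in> elts ?Z" "elts z \<inter> elts ?Z = {}" using foundation by blast
  obtain m where m: "z = F m" "m \<in> elts Y" using z(1) unfolding Z by (rule imageE)
  have "F y \<notin> elts (F m)" if "y \<in> elts Y" for y using z(2) imageI[OF that, of F] unfolding Z m(1) by blast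
  then show ?thesis using m(2) by blast
qed

lemma lex_wf_order:
  assumes dF: "dft (\<lambda>v. F (v 0))" and dG: "dft (\<lambda>v. G (v 0))" and dH: "dft (\<lambda>v. H (v 0))"
    and O: "\<And>x. x \<in> elts (X::'a::zf) \<Longrightarrow> Ord (F x) \<and> Ord (G x) \<and> Ord (H x)"
  shows "wf_order (lex F G H) X"
proof unfold_locales
  have [dfn_intros]: "dft s \<Longrightarrow> dft (\<lambda>v. F (s v))" for s by (rule dft_sub1[OF dF])
  have [dfn_intros]: "dft s \<Longrightarrow> dft (\<lambda>v. G (s v))" for s by (rule dft_sub1[OF dG])
  have [dfn_intros]: "dft s \<Longrightarrow> dft (\<lambda>v. H (s v))" for s by (rule dft_sub1[OF dH])
  show "dfn (\<lambda>v. lex F G H (v 0) (v 1))" unfolding lex_def by (intro dfn_intros)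
  show "lex F G H x z" if z: "z \<in> elts X" and xy: "lex F G H x y" and yz: "lex F G H y z" for x y z
  proof -
    have "a \<in> elts c" if "a \<in> elts b" "b \<in> elts c" "Ord c" for a b c :: 'a using that Ord_trans by blast
    then show ?thesis using xy yz O[OF z] unfolding lex_def by metis
  qed
  show "\<exists>m\<in>elts Y. \<forall>y\<in>elts Y. \<not> lex F G H y m" if Y: "elts Y \<subseteq> elts X" "elts Y \<noteq> {}" for Y
  proof -
    obtain p where p: "p \<in> elts Y" "\<forall>y\<in>elts Y. F y \<notin> elts (F p)" using image_minimal[OF dF Y(2)] by blast
    have "small {y \<in> elts Y. F y = F p}" by (rule small_sep) (intro dfn_intros)
    then obtain Y1 where Y1: "elts Y1 = {y \<in> elts Y. F y = F p}" unfolding small_def by blast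
    then have "elts Y1 \<noteq> {}" using p(1) by auto
    then obtain q where q: "q \<in> elts Y1" "\<forall>y\<in>elts Y1. G y \<notin> elts (G q)" using image_minimal[OF dG] by blast
    have "small {y \<in> elts Y1. G y = G q}" by (rule small_sep) (intro dfn_intros)
    then obtain Y2 where Y2: "elts Y2 = {y \<in> elts Y1. G y = G q}" unfolding small_def by blast
    then have "elts Y2 \<noteq> {}" using q(1) by auto
    then obtain m where m: "m \<in> elts Y2" "\<forall>y\<in>elts Y2. H y \<notin> elts (H m)" using image_minimal[OF dH] by blast
    have m': "m \<in> elts Y" "F m = F p" "G m = G q" using m(1) unfolding Y2 Y1 by simp_all
    have "\<not> lex F G H y m" if y: "y \<in> elts Y" for y
    proof
      assume l: "lex F G H y m"
      have "F y \<notin> elts (F m)" using p(2) y m'(2) by simp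
      then have 1: "F y = F m" "G y \<in> elts (G m) \<or> G y = G m \<and> H y \<in> elts (H m)" using l unfolding lex_def by blast+
      have y1: "y \<in> elts Y1" unfolding Y1 using y 1(1) m'(2) by simp
      then have "G y \<notin> elts (G m)" using q(2) m'(3) by simp
      then have 2: "G y = G m" "H y \<in> elts (H m)" using 1(2) by blast+
      have "y \<in> elts Y2" unfolding Y2 using y1 2(1) m'(3) by simp
      then show False using m(2) 2(2) by blast
    qed
    then show ?thesis using m'(1) by blast
  qed
qed

lemma lex_linear:
  assumes "Ord (F x) \<and> Ord (G x) \<and> Ord (H (x::'a::zf))" "Ord (F y) \<and> Ord (G y) \<and> Ord (H y)"
    and "F x = F y \<Longrightarrow> G x = G y \<Longrightarrow> H x = H y \<Longrightarrow> x = y" "x \<noteq> y"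
  shows "lex F G H x y \<or> lex F G H y x"
  using assms Ord_linear[of "F x" "F y"] Ord_linear[of "G x" "G y"] Ord_linear[of "H x" "H y"]
  unfolding lex_def by metis

lemma vtimes_proj:
  assumes "p \<in> elts (vtimes A (B::'a::zf))"
  shows "vfst p \<in> elts A" "vsnd p \<in> elts B" "p = opair (vfst p) (vsnd p)"
proof -
  obtain x y where "p = opair x y" "x \<in> elts A" "y \<in> elts B" using in_vtimesE[OF assms] .
  then show "vfst p \<in> elts A" "vsnd p \<in> elts B" "p = opair (vfst p) (vsnd p)" by simp_all
qed

definition square_inj :: "'a::zf \<Rightarrow> 'a \<Rightarrow> bool" where
  "square_inj q a \<longleftrightarrow> (\<forall>x\<in>elts a. \<forall>y\<in>elts a. q \<cdot> opair x y \<in> elts a \<and>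
     (\<forall>x'\<in>elts a. \<forall>y'\<in>elts a. q \<cdot> opair x y = q \<cdot> opair x' y' \<longrightarrow> x = x' \<and> y = y'))"

lemma dfn_square_inj [dfn_intros]: "dft s \<Longrightarrow> dft t \<Longrightarrow> dfn (\<lambda>v. square_inj (s v) (t v :: 'a::zf))"
  by (rule dfn_sub2[of square_inj]) (unfold square_inj_def, intro dfn_intros)

lemma Ord_vun: "Ord a \<Longrightarrow> Ord b \<Longrightarrow> Ord (vun a (b::'a::zf))"
  by (rule OrdI) (auto intro: Ord_mem Ord_trans)

lemma vun_mem: "Ord c \<Longrightarrow> a \<in> elts c \<Longrightarrow> b \<in> elts c \<Longrightarrow> vun a b \<in> elts (c::'a::zf)"
proof -
  assume c: "Ord c" "a \<in> elts c" "b \<in> elts c"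
  then have "elts a \<subseteq> elts b \<or> elts b \<subseteq> elts a" using Ord_mem Ord_linear[of a b] Ord_mem_subset by blast
  then have "vun a b = a \<or> vun a b = b" by (metis elts_inject elts_vun sup.absorb1 sup.absorb2)
  then show ?thesis using c by auto
qed

text \<open>The pigeonhole principle for cf \<omega> = \<omega>, applied to the first coordinate and
  then to the second, leaves two different arguments with the same pair.\<close>

lemma square_inj_finite:
  assumes M: "M \<in> elts (omega::'a::zf)" and dG: "dft (\<lambda>v. G (v 0))"
    and G: "\<And>i. i \<in> elts omega \<Longrightarrow> G i \<in> elts (vtimes M M)"
  shows "\<not> inj_on G (elts omega)"
proof
  assume inj: "inj_on G (elts omega)"
  have [dfn_intros]: "dft s \<Longrightarrow> dft (\<lambda>v. G (s v))" for s by (rule dft_sub1[OF dG])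
  have M': "M \<in> elts (cf omega)" using M by (simp add: cf_omega)
  have fs: "vfst (G i) \<in> elts M" "vsnd (G i) \<in> elts M" "G i = opair (vfst (G i)) (vsnd (G i))"
    if "i \<in> elts omega" for i using vtimes_proj[OF G[OF that]] .
  have "\<exists>i\<in>elts M. \<forall>a\<in>elts omega. \<exists>j\<in>elts omega. True \<and> vfst (G j) = i \<and> elts a \<subseteq> elts j"
  proof (rule unbounded_fibre[OF Ord_omega M', where P = "\<lambda>_. True"])
    show "dft (\<lambda>v. vfst (G (v 0)))" "dfn (\<lambda>v. True)" by (intro dfn_intros)+
    show "vfst (G j) \<in> elts M" if "j \<in> elts omega" for j by (rule fs(1)[OF that])
    show "\<exists>j\<in>elts omega. True \<and> elts a \<subseteq> elts j" if "a \<in> elts omega" for a using that by (intro bexI[of _ a]) simp_all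
  qed
  then obtain i where i: "\<forall>a\<in>elts omega. \<exists>j\<in>elts omega. vfst (G j) = i \<and> elts a \<subseteq> elts j"
    by (elim bexE) simp
  have "\<exists>i'\<in>elts M. \<forall>a\<in>elts omega. \<exists>j\<in>elts omega. vfst (G j) = i \<and> vsnd (G j) = i' \<and> elts a \<subseteq> elts j"
  proof (rule unbounded_fibre[OF Ord_omega M', where P = "\<lambda>j. vfst (G j) = i"])
    show "dft (\<lambda>v. vsnd (G (v 0)))" "dfn (\<lambda>v. vfst (G (v 0)) = i)" by (intro dfn_intros)+
    show "vsnd (G j) \<in> elts M" if "j \<in> elts omega" for j by (rule fs(2)[OF that])
    show "\<exists>j\<in>elts omega. vfst (G j) = i \<and> elts a \<subseteq> elts j" if "a \<in> elts omega" for a using i that by blast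
  qed
  then obtain i' where i': "\<forall>a\<in>elts omega. \<exists>j\<in>elts omega. vfst (G j) = i \<and> vsnd (G j) = i' \<and> elts a \<subseteq> elts j" by blast
  then obtain j where j: "j \<in> elts omega" "vfst (G j) = i" "vsnd (G j) = i'" using M by blast
  have "vsucc j \<in> elts omega" using omega_Limit j(1) unfolding Limit_def by blast
  then obtain k where k: "k \<in> elts omega" "vfst (G k) = i" "vsnd (G k) = i'" "elts (vsucc j) \<subseteq> elts k" using i' by blast
  have "G j = G k" using fs(3)[OF j(1)] fs(3)[OF k(1)] j k by simp
  then have "j = k" using inj j(1) k(1) by (simp add: inj_on_eq_iff)
  moreover have "j \<in> elts k" using k(4) by auto
  ultimately show False using mem_irrefl[of j] by simp
qed

text \<open>Goedel's argument: order pairs by maximum, then lexicographically. If some pair had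
  \<open>a\<close> or more predecessors, \<open>a\<close> would inject into a square
  \<open>M\<close> x \<open>M\<close> with \<open>M\<close> below \<open>a\<close>; this contradicts
  initiality, by the hypothesis on smaller ordinals for infinite \<open>M\<close> and by
  \<open>square_inj_finite\<close> for finite \<open>M\<close>.\<close>

lemma square_aleph:
  assumes a: "aleph (a::'a::zf)" and IH: "\<And>b. b \<in> elts a \<Longrightarrow> elts omega \<subseteq> elts b \<Longrightarrow> \<exists>q. square_inj q b"
  shows "\<exists>q. square_inj q a"
proof -
  note O = aleph_Ord[OF a]
  let ?m = "\<lambda>p. vun (vfst p) (vsnd p)"
  let ?X = "vtimes a a"
  let ?lt = "lex ?m vfst vsnd"
  have d: "dft (\<lambda>v. ?m (v 0))" "dft (\<lambda>v. vfst (v 0))" "dft (\<lambda>v. vsnd (v 0))" by (intro dfn_intros)+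
  have X: "vfst p \<in> elts a" "vsnd p \<in> elts a" "p = opair (vfst p) (vsnd p)" if "p \<in> elts ?X" for p
    using vtimes_proj[OF that] .
  have Xo: "Ord (?m p) \<and> Ord (vfst p) \<and> Ord (vsnd p)" if "p \<in> elts ?X" for p
    using X[OF that] Ord_mem[OF O] Ord_vun by blast
  interpret wf_order ?lt ?X by (rule lex_wf_order[OF d Xo])
  have lin: "?lt x y \<or> ?lt y x" if "x \<in> elts ?X" "y \<in> elts ?X" "x \<noteq> y" for x y
    using X(3)[OF that(1)] X(3)[OF that(2)] by (intro lex_linear Xo that) metis
  obtain r c where r: "Ord c" "bij_betw (fapp r) (elts ?X) (elts c)"
    "\<forall>x\<in>elts ?X. elts (r \<cdot> x) = {r \<cdot> y | y. y \<in> elts ?X \<and> ?lt y x}"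
    by (rule linear_rank[OF lin]) blast
  have dr: "dft (\<lambda>v. r \<cdot> v 0)" by (intro dfn_intros)
  have rinj: "x = y" if "x \<in> elts ?X" "y \<in> elts ?X" "r \<cdot> x = r \<cdot> y" for x y
    using r(2) that unfolding bij_betw_def inj_on_def by blast
  have rO: "Ord (r \<cdot> x)" if "x \<in> elts ?X" for x using Ord_mem[OF r(1) bij_betw_apply[OF r(2) that]] .
  have "r \<cdot> p \<in> elts a" if p: "p \<in> elts ?X" for p
  proof (rule ccontr)
    assume "r \<cdot> p \<notin> elts a"
    then have sub: "elts a \<subseteq> elts (r \<cdot> p)" using Ord_not_mem[OF rO[OF p] O] by blast
    \<comment> \<open>All predecessors of \<open>p\<close> have both coordinates at most the maximum
      of \<open>p\<close>. Its successor is still below \<open>a\<close> because an aleph is a limit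
      ordinal.\<close>
    let ?M = "vsucc (?m p)"
    have Ma: "?M \<in> elts a" using vun_mem[OF O X(1)[OF p] X(2)[OF p]] initial_Limit[OF a] unfolding Limit_def by blast
    have MO: "Ord ?M" using Ord_mem[OF O Ma] .
    have seg: "y \<in> elts (vtimes ?M ?M)" if y: "y \<in> elts ?X" "?lt y p" for y
    proof -
      have "elts (?m y) \<subseteq> elts (?m p)" using y(2)[unfolded lex_def]
      proof (elim disjE conjE)
        assume "?m y \<in> elts (?m p)"
        then show ?thesis using Ord_mem_subset[of "?m p" "?m y"] Xo[OF p] by blast
      qed (simp_all only: subset_refl)
      then have "elts (vfst y) \<subseteq> elts (?m p)" "elts (vsnd y) \<subseteq> elts (?m p)" by auto
      then have "vfst y \<in> elts ?M" "vsnd y \<in> elts ?M"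
        using Ord_subset_iff[of "vfst y" "?m p"] Ord_subset_iff[of "vsnd y" "?m p"] Xo[OF p] Xo[OF y(1)] by auto
      then show ?thesis using X(3)[OF y(1)] opair_in_vtimes[of "vfst y" "vsnd y" ?M ?M] by metis
    qed
    obtain G where G: "dft (\<lambda>v. G (v 0))" "\<And>x. x \<in> elts ?X \<Longrightarrow> G (r \<cdot> x) = x"
      using bij_inverse[OF dr r(2)] by metis
    have [dfn_intros]: "dft s \<Longrightarrow> dft (\<lambda>v. G (s v))" for s by (rule dft_sub1[OF G(1)])
    have Ga: "G i \<in> elts (vtimes ?M ?M) \<and> r \<cdot> G i = i" if i: "i \<in> elts a" for i
    proof -
      obtain y where y: "i = r \<cdot> y" "y \<in> elts ?X" "?lt y p" using sub i bspec[OF r(3) p] by blast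
      then show ?thesis using seg[OF y(2,3)] G(2)[OF y(2)] by simp
    qed
    have Ginj: "i = j" if "i \<in> elts a" "j \<in> elts a" "G i = G j" for i j
      using Ga[OF that(1)] Ga[OF that(2)] that(3) by metis
    have om: "elts omega \<subseteq> elts a" using a unfolding aleph_def by blast
    show False
    proof (cases "elts omega \<subseteq> elts ?M")
      case True
      then obtain q where q: "square_inj q ?M" using IH[OF Ma] by blast
      have qM: "q \<cdot> x \<in> elts ?M" if x: "x \<in> elts (vtimes ?M ?M)" for x
      proof -
        obtain x1 x2 where x': "x = opair x1 x2" "x1 \<in> elts ?M" "x2 \<in> elts ?M" using in_vtimesE[OF x] .
        then show ?thesis using q unfolding square_inj_def by blast
      qed
      have qi: "x = y" if x: "x \<in> elts (vtimes ?M ?M)" and y: "y \<in> elts (vtimes ?M ?M)" and e: "q \<cdot> x = q \<cdot> y" for x y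
      proof -
        obtain x1 x2 where x': "x = opair x1 x2" "x1 \<in> elts ?M" "x2 \<in> elts ?M" using in_vtimesE[OF x] .
        obtain y1 y2 where y': "y = opair y1 y2" "y1 \<in> elts ?M" "y2 \<in> elts ?M" using in_vtimesE[OF y] .
        show ?thesis using q e x' y' unfolding square_inj_def by blast
      qed
      have "\<not> inj_on (\<lambda>i. q \<cdot> G i) (elts a)"
      proof (rule aleph_no_inj[OF a Ma])
        show "dft (\<lambda>v. q \<cdot> G (v 0))" by (intro dfn_intros)
        show "q \<cdot> G i \<in> elts ?M" if "i \<in> elts a" for i using qM Ga[OF that] by blast
      qed
      moreover have "inj_on (\<lambda>i. q \<cdot> G i) (elts a)"
        using qi Ga Ginj by (intro inj_onI) blast
      ultimately show False by blast
    next
      case False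
      then have "?M \<in> elts omega" using Ord_not_subset[OF Ord_omega MO] by blast
      then have "\<not> inj_on G (elts omega)" by (rule square_inj_finite[OF _ G(1)]) (use Ga om in blast)
      then show False using Ginj om unfolding inj_on_def by blast
    qed
  qed
  then have rin: "r \<cdot> opair x y \<in> elts a" if "x \<in> elts a" "y \<in> elts a" for x y using that by simp
  have ri: "x = x' \<and> y = y'"
    if "x \<in> elts a" "y \<in> elts a" "x' \<in> elts a" "y' \<in> elts a" "r \<cdot> opair x y = r \<cdot> opair x' y'" for x y x' y'
    using rinj[of "opair x y" "opair x' y'"] that by simp
  have "square_inj r a" unfolding square_inj_def
    by (intro ballI conjI[OF rin] impI) (assumption | rule ri)+
  then show ?thesis by blast
qed

text \<open>An infinite ordinal that is not initial inherits the pairing of a smaller equipollent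
  one by conjugation with the bijection \<open>f\<close>.\<close>

lemma square_ex:
  assumes "Ord (a::'a::zf)" "elts omega \<subseteq> elts a"
  shows "\<exists>q. square_inj q a"
proof -
  have "elts omega \<subseteq> elts a \<longrightarrow> (\<exists>q. square_inj q a)"
  proof (rule Ord_induct[where P = "\<lambda>a. elts omega \<subseteq> elts a \<longrightarrow> (\<exists>q. square_inj q a)", OF _ assms(1)])
    show "dfn (\<lambda>v. elts omega \<subseteq> elts (v 0) \<longrightarrow> (\<exists>q. square_inj q (v 0)))" by (intro dfn_intros)
    fix a :: 'a
    assume O: "Ord a" and IH: "\<And>b. b \<in> elts a \<Longrightarrow> elts omega \<subseteq> elts b \<longrightarrow> (\<exists>q. square_inj q b)"
    show "elts omega \<subseteq> elts a \<longrightarrow> (\<exists>q. square_inj q a)"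
    proof
      assume om: "elts omega \<subseteq> elts a"
      show "\<exists>q. square_inj q a"
      proof (cases "\<exists>b\<in>elts a. eqpoll a b")
        case False
        then have "aleph a" unfolding aleph_def using O om by blast
        then show ?thesis using square_aleph IH by blast
      next
        case True
        then obtain b f where b: "b \<in> elts a" and f: "bij_betw (fapp f) (elts a) (elts b)" using eqpollE by metis
        have bO: "Ord b" using Ord_mem[OF O b] .
        have fb: "f \<cdot> x \<in> elts b" if "x \<in> elts a" for x using f that by (rule bij_betw_apply)
        have fi: "x = y" if "x \<in> elts a" "y \<in> elts a" "f \<cdot> x = f \<cdot> y" for x y
          using f that unfolding bij_betw_def inj_on_def by blast
        have df: "dft (\<lambda>v. f \<cdot> v 0)" by (intro dfn_intros)
        have "elts omega \<subseteq> elts b"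
        proof (rule ccontr)
          assume "\<not> ?thesis"
          then have "b \<in> elts omega" using Ord_not_subset[OF Ord_omega bO] by blast
          then have "\<not> inj_on (fapp f) (elts omega)"
            using aleph_no_inj[OF aleph_omega _ df] fb om by blast
          then show False using fi om unfolding inj_on_def by blast
        qed
        then obtain q where q: "square_inj q b" using IH[OF b] by blast
        obtain G where G: "dft (\<lambda>v. G (v 0))" "bij_betw G (elts b) (elts a)" "\<And>y. y \<in> elts b \<Longrightarrow> f \<cdot> G y = y"
          using bij_inverse[OF df f] by metis
        have [dfn_intros]: "dft s \<Longrightarrow> dft (\<lambda>v. G (s v))" for s by (rule dft_sub1[OF G(1)])
        let ?Q = "\<lambda>p. G (q \<cdot> opair (f \<cdot> vfst p) (f \<cdot> vsnd p))"
        let ?q = "lam (vtimes a a) ?Q"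
        have dQ: "dft (\<lambda>v. ?Q (v 0))" by (intro dfn_intros)
        have e: "?q \<cdot> opair x y = G (q \<cdot> opair (f \<cdot> x) (f \<cdot> y))" if "x \<in> elts a" "y \<in> elts a" for x y
          using lam_app[OF dQ, of "opair x y" "vtimes a a"] that by simp
        have qb: "q \<cdot> opair x y \<in> elts b" if "x \<in> elts b" "y \<in> elts b" for x y using q that unfolding square_inj_def by blast
        have "square_inj ?q a" unfolding square_inj_def
        proof (intro ballI conjI impI)
          fix x y assume xy: "x \<in> elts a" "y \<in> elts a"
          show "?q \<cdot> opair x y \<in> elts a" unfolding e[OF xy]
            by (rule bij_betw_apply[OF G(2) qb[OF fb[OF xy(1)] fb[OF xy(2)]]])
          fix x' y' assume xy': "x' \<in> elts a" "y' \<in> elts a" and eq: "?q \<cdot> opair x y = ?q \<cdot> opair x' y'"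
          have "q \<cdot> opair (f \<cdot> x) (f \<cdot> y) = q \<cdot> opair (f \<cdot> x') (f \<cdot> y')"
            using arg_cong[OF eq[unfolded e[OF xy] e[OF xy']], of "fapp f"]
            by (simp only: G(3)[OF qb[OF fb[OF xy(1)] fb[OF xy(2)]]] G(3)[OF qb[OF fb[OF xy'(1)] fb[OF xy'(2)]]])
          then have *: "f \<cdot> x = f \<cdot> x' \<and> f \<cdot> y = f \<cdot> y'"
            using q fb[OF xy(1)] fb[OF xy(2)] fb[OF xy'(1)] fb[OF xy'(2)] unfolding square_inj_def by blast
          then show "x = x'" "y = y'" using fi xy xy' by blast+
        qed
        then show ?thesis by blast
      qed
    qed
  qed
  then show ?thesis using assms(2) by blast
qed

lemma square_injD:
  assumes "square_inj q (a::'a::zf)" "x \<in> elts a" "y \<in> elts a"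
  shows "q \<cdot> opair x y \<in> elts a"
    "x' \<in> elts a \<Longrightarrow> y' \<in> elts a \<Longrightarrow> q \<cdot> opair x y = q \<cdot> opair x' y' \<longleftrightarrow> x = x' \<and> y = y'"
  using assms unfolding square_inj_def by blast+

section \<open>Hartogs numbers and the aleph hierarchy\<close>

lemma surjects_iff:
  "surjects A B \<longleftrightarrow> (\<exists>f. maps f A B \<and> (\<forall>y\<in>elts B. \<exists>x\<in>elts A. f \<cdot> x = (y::'a::zf)))"
proof -
  have "app f ` elts A = elts B \<longleftrightarrow> (\<forall>y\<in>elts B. \<exists>x\<in>elts A. f \<cdot> x = y)" if f: "maps f A B" for f
  proof -
    have F: "is_fun f A" "\<forall>x\<in>elts A. f \<cdot> x \<in> elts B" using f by (simp_all add: maps_iff)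
    have "app f ` elts A = fapp f ` elts A" by (rule image_cong[OF refl]) (rule app_eq[OF F(1)])
    moreover have "\<exists>x\<in>elts A. f \<cdot> x = y" if "fapp f ` elts A = elts B" "y \<in> elts B" for y
      using that(2) unfolding that(1)[symmetric] by (rule imageE) blast
    moreover have "fapp f ` elts A = elts B" if "\<forall>y\<in>elts B. \<exists>x\<in>elts A. f \<cdot> x = y"
      using that F(2) by (intro subset_antisym subsetI) (auto simp: image_iff)
    ultimately show ?thesis by blast
  qed
  then show ?thesis unfolding surjects_def by blast
qed

lemma dfn_surjects [dfn_intros]: "dft s \<Longrightarrow> dft t \<Longrightarrow> dfn (\<lambda>v. surjects (s v) (t v :: 'a::zf))"
  by (rule dfn_sub2[of surjects]) (unfold surjects_iff, intro dfn_intros)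

lemma surjectsI:
  assumes "dft (\<lambda>v. F (v 0))" "\<And>x. x \<in> elts A \<Longrightarrow> F x \<in> elts B"
    "\<And>y. y \<in> elts B \<Longrightarrow> \<exists>x\<in>elts A. F x = (y::'a::zf)"
  shows "surjects A B"
  unfolding surjects_iff
proof (intro exI conjI ballI)
  show "maps (lam A F) A B" by (rule maps_lam[OF assms(1,2)])
  fix y assume "y \<in> elts B"
  then obtain x where "x \<in> elts A" "F x = y" using assms(3) by blast
  then show "\<exists>x\<in>elts A. lam A F \<cdot> x = y" using lam_app[OF assms(1)] by blast
qed

definition orders_as :: "'a::zf \<Rightarrow> 'a \<Rightarrow> 'a \<Rightarrow> 'a \<Rightarrow> bool" where
  "orders_as A r f a \<longleftrightarrow> Ord a \<and> maps f A a \<and> (\<forall>y\<in>elts a. \<exists>x\<in>elts A. f \<cdot> x = y) \<and>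
     (\<forall>x\<in>elts A. \<forall>y\<in>elts A. opair x y \<in> elts r \<longleftrightarrow> f \<cdot> x \<in> elts (f \<cdot> y))"

text \<open>By induction on i, \<open>f \<cdot> x = i\<close> forces \<open>g \<cdot> x = i\<close>:
  either value is the set of values at the predecessors of \<open>x\<close> in the relation
  \<open>r\<close>.\<close>

lemma orders_as_le:
  assumes f: "orders_as A r f (a::'a::zf)" and g: "orders_as A r g b"
  shows "elts a \<subseteq> elts b"
proof
  fix i assume i: "i \<in> elts a"
  have a: "Ord a" and b: "Ord b" using f g by (simp_all add: orders_as_def)
  have fa: "f \<cdot> x \<in> elts a" and gb: "g \<cdot> x \<in> elts b" if "x \<in> elts A" for x
    using f g that by (simp_all add: orders_as_def maps_iff)
  have iff: "f \<cdot> x \<in> elts (f \<cdot> y) \<longleftrightarrow> g \<cdot> x \<in> elts (g \<cdot> y)" if "x \<in> elts A" "y \<in> elts A" for x y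
    using f g that by (simp add: orders_as_def)
  have onto: "\<exists>x\<in>elts A. f \<cdot> x = y" if "y \<in> elts a" for y using f that by (simp add: orders_as_def)
  have onto': "\<exists>x\<in>elts A. g \<cdot> x = y" if "y \<in> elts b" for y using g that by (simp add: orders_as_def)
  have "\<forall>x\<in>elts A. f \<cdot> x = i \<longrightarrow> g \<cdot> x = i"
  proof (rule Ord_induct[where P = "\<lambda>i. \<forall>x\<in>elts A. f \<cdot> x = i \<longrightarrow> g \<cdot> x = i"])
    show "dfn (\<lambda>v. \<forall>x\<in>elts A. f \<cdot> x = v 0 \<longrightarrow> g \<cdot> x = v 0)" by (intro dfn_intros)
    show "Ord i" using Ord_mem[OF a i] .
    fix i assume IH: "\<And>j. j \<in> elts i \<Longrightarrow> \<forall>x\<in>elts A. f \<cdot> x = j \<longrightarrow> g \<cdot> x = j"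
    show "\<forall>x\<in>elts A. f \<cdot> x = i \<longrightarrow> g \<cdot> x = i"
    proof (intro ballI impI)
      fix x assume x: "x \<in> elts A" and fx: "f \<cdot> x = i"
      have "z \<in> elts (g \<cdot> x) \<longleftrightarrow> z \<in> elts i" for z
      proof
        assume z: "z \<in> elts i"
        then have "z \<in> elts a" using Ord_trans[OF a _ fa[OF x]] fx by simp
        then obtain y where y: "y \<in> elts A" "f \<cdot> y = z" using onto by blast
        have "g \<cdot> y = z" using IH[OF z] y by blast
        moreover have "f \<cdot> y \<in> elts (f \<cdot> x)" using y(2) fx z by simp
        ultimately show "z \<in> elts (g \<cdot> x)" using iff[OF y(1) x] by simp
      next
        assume z: "z \<in> elts (g \<cdot> x)"
        then have "z \<in> elts b" using Ord_trans[OF b _ gb[OF x]] by simp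
        then obtain y where y: "y \<in> elts A" "g \<cdot> y = z" using onto' by blast
        then have m: "f \<cdot> y \<in> elts i" using iff[OF y(1) x] z fx by simp
        then have "g \<cdot> y = f \<cdot> y" using IH[OF m] y(1) by blast
        then show "z \<in> elts i" using m y(2) by simp
      qed
      then show "g \<cdot> x = i" by (intro extensionality set_eqI)
    qed
  qed
  moreover obtain x where "x \<in> elts A" "f \<cdot> x = i" using onto[OF i] by blast
  ultimately have "g \<cdot> x = i" by blast
  then show "i \<in> elts b" using gb[OF \<open>x \<in> elts A\<close>] by simp
qed

lemma orders_as_unique: "orders_as A r f a \<Longrightarrow> orders_as A r g b \<Longrightarrow> a = (b::'a::zf)"
  using orders_as_le[of A r f a g b] orders_as_le[of A r g b f a] by (intro extensionality) blast

text \<open>An ordinal onto which \<open>A\<close> maps is determined by the relation that the map induces on \<open>A\<close>.\<close>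

lemma small_surjects: "small {a::'a::zf. Ord a \<and> surjects A a}"
proof -
  let ?F = "\<lambda>r. THE a. \<exists>f. orders_as A r f a"
  have "dfn (\<lambda>v. \<exists>f. orders_as A (v (Suc 0)) f (v 0))" unfolding orders_as_def by (intro dfn_intros)
  then have dF: "dft (\<lambda>v. ?F (v 0))" by (intro dft_The) (simp, elim exE, rule orders_as_unique)
  show ?thesis
  proof (rule small_subset[OF small_image[OF dF, of "vpow (vtimes A A)"]])
    show "dfn (\<lambda>v. v 0 \<in> {a. Ord a \<and> surjects A a})" unfolding mem_Collect_eq by (intro dfn_intros)
    show "{a. Ord a \<and> surjects A a} \<subseteq> ?F ` elts (vpow (vtimes A A))"
    proof
      fix a assume "a \<in> {a. Ord a \<and> surjects A a}"
      then obtain f where f: "Ord a" "maps f A a" "\<forall>y\<in>elts a. \<exists>x\<in>elts A. f \<cdot> x = y"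
        by (auto simp: surjects_iff)
      let ?r = "mkset {p \<in> elts (vtimes A A). f \<cdot> vfst p \<in> elts (f \<cdot> vsnd p)}"
      have r: "elts ?r = {p \<in> elts (vtimes A A). f \<cdot> vfst p \<in> elts (f \<cdot> vsnd p)}"
        by (rule elts_mkset, rule small_sep) (intro dfn_intros)
      have o: "orders_as A ?r f a" unfolding orders_as_def r using f by simp
      have "a = ?F ?r"
        by (rule sym, rule the_equality, rule exI, rule o, elim exE, rule orders_as_unique[OF _ o])
      moreover have "?r \<in> elts (vpow (vtimes A A))" using r by auto
      ultimately show "a \<in> ?F ` elts (vpow (vtimes A A))" by (rule image_eqI)
    qed
  qed
qed

lemma theta_upper:
  assumes "Ord (a::'a::zf)" "surjects A a"
  shows "elts a \<subseteq> elts (theta A)"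
proof -
  let ?S = "mkset {a. Ord a \<and> surjects A a}"
  have S: "elts ?S = {a. Ord a \<and> surjects A a}" by (rule elts_mkset[OF small_surjects])
  have eq: "\<Union> {elts a | a. Ord a \<and> (surjects A a \<or> a \<in> elts omega)} = elts (vsup (vun ?S omega))"
    unfolding elts_vsup elts_vun S using Ord_mem[OF Ord_omega] by blast
  have "elts (theta A) = elts (vsup (vun ?S omega))" unfolding theta_def eq by simp
  then show ?thesis unfolding elts_vsup elts_vun S using assms by blast
qed

lemma surjects_trans:
  assumes "surjects A B" "surjects B (C::'a::zf)"
  shows "surjects A C"
proof -
  obtain f where f: "maps f A B" "\<forall>y\<in>elts B. \<exists>x\<in>elts A. f \<cdot> x = y" using assms(1) by (auto simp: surjects_iff)
  obtain g where g: "maps g B C" "\<forall>y\<in>elts C. \<exists>x\<in>elts B. g \<cdot> x = y" using assms(2) by (auto simp: surjects_iff)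
  show ?thesis
  proof (rule surjectsI)
    show "dft (\<lambda>v. g \<cdot> (f \<cdot> v 0))" by (intro dfn_intros)
    show "g \<cdot> (f \<cdot> x) \<in> elts C" if "x \<in> elts A" for x using maps_app[OF g(1) maps_app[OF f(1) that]] .
    fix y assume "y \<in> elts C"
    then obtain z where z: "z \<in> elts B" "g \<cdot> z = y" using g(2) by blast
    then obtain x where "x \<in> elts A" "f \<cdot> x = z" using f(2) by blast
    then show "\<exists>x\<in>elts A. g \<cdot> (f \<cdot> x) = y" using z(2) by blast
  qed
qed

lemma eqpoll_surjects: "eqpoll A B \<Longrightarrow> surjects A (B::'a::zf)"
proof -
  assume "eqpoll A B"
  then obtain f where f: "is_fun f A" "bij_betw (fapp f) (elts A) (elts B)" by (rule eqpollE)
  have "\<exists>x\<in>elts A. f \<cdot> x = y" if y: "y \<in> elts B" for y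
  proof -
    have "y \<in> fapp f ` elts A" using bij_betw_imp_surj_on[OF f(2)] y by simp
    then show ?thesis by (rule imageE) blast
  qed
  then show ?thesis unfolding surjects_iff using f(1) bij_betw_apply[OF f(2)] by (auto simp: maps_iff)
qed

text \<open>Hartogs' theorem by way of surjections. The ordinals onto which \<open>?c\<close> maps
  form a set, so there is a least one onto which it does not map, and this ordinal is
  initial.\<close>

lemma aleph_above:
  assumes a: "Ord (a::'a::zf)"
  shows "\<exists>b. aleph b \<and> a \<in> elts b"
proof -
  let ?c = "vun a omega"
  have c: "Ord ?c" using Ord_vun[OF a Ord_omega] .
  have zc: "vempty \<in> elts ?c" using vempty_in_Limit[OF omega_Limit] unfolding elts_vun by blast
  let ?S = "mkset {b. Ord b \<and> surjects ?c b}"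
  have S: "elts ?S = {b. Ord b \<and> surjects ?c b}" by (rule elts_mkset[OF small_surjects])
  have sO: "Ord (vsup ?S)" unfolding vsup_def[symmetric] by (rule Ord_vsup) (simp add: S)
  \<comment> \<open>Zero is excluded: the nonempty \<open>?c\<close> does not map onto it, so it
    would be picked as the least ordinal that is no image.\<close>
  let ?P = "\<lambda>b. b \<noteq> vempty \<and> \<not> surjects ?c b"
  have dP: "dfn (\<lambda>v. ?P (v 0))" by (intro dfn_intros)
  have b0: "Ord (vsucc (vsup ?S))" by (rule Ord_vsucc[OF sO])
  have "?P (vsucc (vsup ?S))"
  proof
    show "vsucc (vsup ?S) \<noteq> vempty" using eq_vempty_iff[of "vsucc (vsup ?S)"] by simp
    show "\<not> surjects ?c (vsucc (vsup ?S))"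
    proof
      assume "surjects ?c (vsucc (vsup ?S))"
      then have "vsucc (vsup ?S) \<in> elts ?S" unfolding S using b0 by blast
      then have "vsup ?S \<in> elts (vsup ?S)" unfolding elts_vsup by (rule UN_I) simp
      then show False using mem_irrefl by blast
    qed
  qed
  from least_ord_ex[OF dP b0 this] obtain b where b: "Ord b" "b \<noteq> vempty" "\<not> surjects ?c b" "\<forall>d\<in>elts b. \<not> ?P d"
    by blast
  have small_surj: "surjects ?c x" if x: "Ord x" "x \<noteq> vempty" "elts x \<subseteq> elts ?c" for x
  proof (rule surjectsI)
    show "dft (\<lambda>v. if v 0 \<in> elts x then v 0 else vempty)" by (intro dfn_intros)
    have "vempty \<in> elts x" using Ord_linear[OF Ord_vempty x(1)] x(2) by auto
    then show "(if y \<in> elts x then y else vempty) \<in> elts x" for y by simp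
    show "\<exists>z\<in>elts ?c. (if z \<in> elts x then z else vempty) = y" if "y \<in> elts x" for y
      using x(3) that by (intro bexI[of _ y]) auto
  qed
  have cb: "?c \<in> elts b" using small_surj[OF b(1,2)] b(3) Ord_not_subset[OF b(1) c] by blast
  have "\<not> eqpoll b d" if d: "d \<in> elts b" for d
  proof
    assume e: "eqpoll b d"
    have "d \<noteq> vempty"
    proof
      assume "d = vempty"
      then show False using e cb by (auto simp: eqpoll_iff bij_betw_def)
    qed
    then have "surjects ?c d" using b(4) d by blast
    then show False using surjects_trans[OF _ eqpoll_surjects[OF eqpoll_sym[OF e]]] b(3) by blast
  qed
  moreover have "elts omega \<subseteq> elts b" using Ord_mem_subset[OF b(1) cb] by auto
  ultimately have "aleph b" unfolding aleph_def using b(1) by blast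
  moreover have "a \<in> elts b" using Ord_subset_mem[OF b(1) a _ cb] by auto
  ultimately show ?thesis by blast
qed

section \<open>The enumeration of the alephs\<close>

definition alephs_below :: "'a::zf \<Rightarrow> 'a" where
  "alephs_below k = mkset {j \<in> elts k. aleph j}"

lemma elts_alephs_below: "elts (alephs_below k) = {j \<in> elts k. aleph (j::'a::zf)}"
  unfolding alephs_below_def by (rule elts_mkset, rule small_sep) (intro dfn_intros)

lemma dft_alephs_below [dfn_intros]: "dft s \<Longrightarrow> dft (\<lambda>v. alephs_below (s v :: 'a::zf))"
  by (rule dft_sub1[of alephs_below]) (unfold alephs_below_def, intro dfn_intros)

lemma alephs_below_iso:
  assumes h: "ord_iso h a (alephs_below k)" and a: "Ord a" and k: "Ord (k::'a::zf)" and i: "i \<in> elts a"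
  shows "otp (alephs_below (h \<cdot> i)) = i"
proof (rule otp_eqI)
  have iO: "Ord i" using Ord_mem[OF a i] .
  show "Ord i" by (rule iO)
  have ia: "j \<in> elts a" if "j \<in> elts i" for j using Ord_trans[OF a that i] .
  have dh: "dft (\<lambda>v. h \<cdot> v 0)" by (intro dfn_intros)
  have hi: "h \<cdot> i \<in> elts k" "aleph (h \<cdot> i)" using ord_isoD(1)[OF h i] by (simp_all add: elts_alephs_below)
  show "ord_iso (lam i (fapp h)) i (alephs_below (h \<cdot> i))"
  proof (rule ord_iso_lam[OF dh])
    show "j \<in> elts l \<longleftrightarrow> h \<cdot> j \<in> elts (h \<cdot> l)" if "j \<in> elts i" "l \<in> elts i" for j l
      using ord_isoD(3)[OF h ia[OF that(1)] ia[OF that(2)]] by simp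
    show "bij_betw (fapp h) (elts i) (elts (alephs_below (h \<cdot> i)))"
      unfolding bij_betw_def
    proof
      show "inj_on (fapp h) (elts i)" using ord_isoD(4)[OF h ia ia] by (simp add: inj_on_def)
      show "fapp h ` elts i = elts (alephs_below (h \<cdot> i))"
      proof (intro set_eqI iffI)
        fix y assume "y \<in> fapp h ` elts i"
        then obtain j where j: "y = h \<cdot> j" "j \<in> elts i" by (rule imageE)
        then have "y \<in> elts (h \<cdot> i)" "aleph y" using ord_isoD(3)[OF h ia i] ord_isoD(1)[OF h ia]
          by (simp_all add: elts_alephs_below)
        then show "y \<in> elts (alephs_below (h \<cdot> i))" by (simp add: elts_alephs_below)
      next
        fix y assume y: "y \<in> elts (alephs_below (h \<cdot> i))"
        then have "y \<in> elts (alephs_below k)" using Ord_trans[OF k _ hi(1)] by (simp add: elts_alephs_below)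
        then obtain j where j: "j \<in> elts a" "h \<cdot> j = y" using ord_isoD(2)[OF h] by blast
        then have "j \<in> elts i" using y ord_isoD(3)[OF h j(1) i] by (simp add: elts_alephs_below)
        then show "y \<in> fapp h ` elts i" using j(2) by (intro image_eqI[of _ _ j]) simp_all
      qed
    qed
  qed
qed

lemma alephs_below_enum:
  assumes k: "Ord (k::'a::zf)"
  obtains h where "Ord (otp (alephs_below k))" "ord_iso h (otp (alephs_below k)) (alephs_below k)"
  by (rule otp_exists[of "alephs_below k"]) (use Ord_mem[OF k] in \<open>simp add: elts_alephs_below\<close>, blast)

lemma aleph_index_mono:
  assumes k: "Ord (k::'a::zf)" and j: "j \<in> elts k" "aleph j"
  shows "otp (alephs_below j) \<in> elts (otp (alephs_below k))"
proof -
  obtain h where O: "Ord (otp (alephs_below k))" and h: "ord_iso h (otp (alephs_below k)) (alephs_below k)"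
    by (rule alephs_below_enum[OF k])
  obtain i where i: "i \<in> elts (otp (alephs_below k))" "h \<cdot> i = j"
    using ord_isoD(2)[OF h, of j] j by (auto simp: elts_alephs_below)
  then show ?thesis using alephs_below_iso[OF h O k i(1)] by simp
qed

lemma aleph_index_unique:
  assumes "aleph (j::'a::zf)" "aleph k" "otp (alephs_below j) = otp (alephs_below k)"
  shows "j = k"
  using Ord_linear[OF aleph_Ord[OF assms(1)] aleph_Ord[OF assms(2)]] assms(3)
    aleph_index_mono[OF aleph_Ord[OF assms(2)] _ assms(1)] aleph_index_mono[OF aleph_Ord[OF assms(1)] _ assms(2)]
    mem_irrefl[of "otp (alephs_below k)"] by auto

text \<open>If \<open>g\<close> were no index, all indices would lie below \<open>g\<close>, since
  the indices are closed downwards. Then the alephs form a set by replacement, and an aleph above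
  its supremum is a contradiction.\<close>

lemma aleph_index_ex:
  assumes g: "Ord (g::'a::zf)"
  shows "\<exists>k. aleph k \<and> otp (alephs_below k) = g"
proof (rule ccontr)
  assume n: "\<not> ?thesis"
  have idx: "otp (alephs_below k) \<in> elts g" if k: "aleph k" for k
  proof -
    have kO: "Ord k" using aleph_Ord[OF k] .
    obtain h where O: "Ord (otp (alephs_below k))" and h: "ord_iso h (otp (alephs_below k)) (alephs_below k)"
      by (rule alephs_below_enum[OF kO])
    have "g \<notin> elts (otp (alephs_below k))"
    proof
      assume i: "g \<in> elts (otp (alephs_below k))"
      have "aleph (h \<cdot> g)" using ord_isoD(1)[OF h i] by (simp add: elts_alephs_below)
      then show False using alephs_below_iso[OF h O kO i] n by blast
    qed
    then show ?thesis using Ord_linear[OF O g] n k by blast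
  qed
  let ?F = "\<lambda>i. THE k. aleph k \<and> otp (alephs_below k) = i"
  have "dfn (\<lambda>v. aleph (v 0) \<and> otp (alephs_below (v 0)) = v (Suc 0))" by (intro dfn_intros)
  then have dF: "dft (\<lambda>v. ?F (v 0))" by (intro dft_The) (simp, elim conjE, rule aleph_index_unique, simp_all)
  have F: "?F (otp (alephs_below k)) = k" if "aleph k" for k
    by (rule the_equality, rule conjI[OF that refl], elim conjE, rule aleph_index_unique[OF _ that])
  have sub: "{k. aleph k} \<subseteq> ?F ` elts g"
  proof
    fix k :: 'a assume "k \<in> {k. aleph k}"
    then show "k \<in> ?F ` elts g" using F[of k] idx[of k] by (intro image_eqI[of _ _ "otp (alephs_below k)"]) simp_all
  qed
  have "small {k. aleph (k::'a)}"
    by (rule small_subset[OF small_image[OF dF] _ sub], unfold mem_Collect_eq, intro dfn_intros)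
  then obtain K where K: "elts K = {k. aleph (k::'a)}" unfolding small_def by blast
  have "Ord (vsup K)" by (rule Ord_vsup) (simp add: K aleph_Ord)
  then obtain b where b: "aleph b" "vsup K \<in> elts b" using aleph_above by blast
  then have "vsup K \<in> elts (vsup K)" unfolding elts_vsup K by blast
  then show False using mem_irrefl by blast
qed

lemma Aleph_index:
  assumes "Ord (g::'a::zf)"
  shows "otp (alephs_below (Aleph g)) = g"
proof -
  obtain k where k: "aleph k \<and> otp (alephs_below k) = g" using aleph_index_ex[OF assms] by blast
  have "Aleph g = k" unfolding Aleph_def alephs_below_def[symmetric]
    using k aleph_index_unique[of _ k] by (intro the_equality) auto
  then show ?thesis using k by simp
qed

section \<open>Bounded subsets of a singular cardinal\<close>

lemma cantor:
  assumes dF: "dft (\<lambda>v. F (v 0))" and F: "\<And>x. elts x \<subseteq> elts a \<Longrightarrow> F x \<in> elts (a::'a::zf)"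
  shows "\<not> inj_on F (elts (vpow a))"
proof
  assume inj: "inj_on F (elts (vpow a))"
  have [dfn_intros]: "dft s \<Longrightarrow> dft (\<lambda>v. F (s v))" for s by (rule dft_sub1[OF dF])
  have "small {z \<in> elts a. \<exists>x. elts x \<subseteq> elts a \<and> F x = z \<and> z \<notin> elts x}"
    by (rule small_sep) (intro dfn_intros)
  then obtain D where D: "elts D = {z \<in> elts a. \<exists>x. elts x \<subseteq> elts a \<and> F x = z \<and> z \<notin> elts x}"
    unfolding small_def by blast
  have Da: "elts D \<subseteq> elts a" unfolding D by blast
  have "F D \<in> elts D \<longleftrightarrow> F D \<notin> elts D"
  proof
    assume "F D \<in> elts D"
    then obtain x where x: "elts x \<subseteq> elts a" "F x = F D" "F D \<notin> elts x" unfolding D by blast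
    then have "x = D" using inj Da by (simp add: inj_on_eq_iff)
    then show "F D \<notin> elts D" using x(3) by simp
  next
    assume "F D \<notin> elts D"
    then have "F D \<in> elts a \<and> (\<exists>x. elts x \<subseteq> elts a \<and> F x = F D \<and> F D \<notin> elts x)" using F[OF Da] Da by blast
    then show "F D \<in> elts D" by (subst D) (rule CollectI)
  qed
  then show False by blast
qed

locale strong_singular =
  fixes \<mu> \<kappa> :: "'a::zf_dc"
  assumes aleph_mu: "aleph \<mu>" and cf_mu: "cf \<mu> = \<kappa>" and kappa_mu: "\<kappa> \<in> elts \<mu>"
    and omega_kappa: "omega \<in> elts \<kappa>"
    and bounded_eqpoll: "eqpoll (mkset (\<Union>\<alpha>\<in>elts \<mu>. elts (vpow \<alpha>))) \<mu>"
begin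

lemma Ord_mu: "Ord \<mu>" by (rule aleph_Ord[OF aleph_mu])

lemma Limit_mu: "Limit \<mu>" by (rule initial_Limit[OF aleph_mu])

lemma Limit_kappa: "Limit \<kappa>" using cf_Limit[OF Limit_mu] cf_mu by simp

lemma Ord_kappa: "Ord \<kappa>" by (rule Limit_Ord[OF Limit_kappa])

lemma cf_kappa: "cf \<kappa> = \<kappa>" using cf_cf[OF Ord_mu] cf_mu by simp

lemma kappa_subset_mu: "elts \<kappa> \<subseteq> elts \<mu>" by (rule Ord_mem_subset[OF Ord_mu kappa_mu])

lemma omega_mu: "omega \<in> elts \<mu>" using kappa_subset_mu omega_kappa by blast

lemma omega_subset_mu: "elts omega \<subseteq> elts \<mu>" by (rule Ord_mem_subset[OF Ord_mu omega_mu])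

definition bnd :: 'a where
  "bnd = mkset (\<Union>\<alpha>\<in>elts \<mu>. elts (vpow \<alpha>))"

lemma elts_bnd: "elts bnd = {x. \<exists>\<alpha>\<in>elts \<mu>. elts x \<subseteq> elts \<alpha>}"
proof -
  have "dft (\<lambda>v. vpow (v 0 :: 'a))" by (intro dfn_intros)
  then have "elts bnd = (\<Union>\<alpha>\<in>elts \<mu>. elts (vpow \<alpha>))" unfolding bnd_def by (intro elts_mkset small_UN)
  then show ?thesis by auto
qed

text \<open>\<open>SOME\<close> fixes a single element of the model, which may then occur in
  formulas as a parameter. So this is no choice principle inside the model. The later definitions by
  \<open>SOME\<close> are of the same kind.\<close>

definition code :: 'a where
  "code = (SOME f. is_fun f bnd \<and> bij_betw (fapp f) (elts bnd) (elts \<mu>))"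

lemma code_bij: "bij_betw (fapp code) (elts bnd) (elts \<mu>)"
proof -
  have "\<exists>f. is_fun f bnd \<and> bij_betw (fapp f) (elts bnd) (elts \<mu>)"
    using bounded_eqpoll unfolding bnd_def eqpoll_iff .
  from someI_ex[OF this] show ?thesis unfolding code_def by blast
qed

lemma code_mu: "\<alpha> \<in> elts \<mu> \<Longrightarrow> elts x \<subseteq> elts \<alpha> \<Longrightarrow> code \<cdot> x \<in> elts \<mu>"
  by (rule bij_betw_apply[OF code_bij]) (auto simp: elts_bnd)

lemma code_inj:
  assumes "\<alpha> \<in> elts \<mu>" "elts x \<subseteq> elts \<alpha>" "\<beta> \<in> elts \<mu>" "elts y \<subseteq> elts \<beta>" "code \<cdot> x = code \<cdot> y"
  shows "x = y"
proof -
  have "x \<in> elts bnd" "y \<in> elts bnd" using assms(1-4) by (auto simp: elts_bnd)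
  then show ?thesis by (rule inj_onD[OF bij_betw_imp_inj_on[OF code_bij] assms(5)])
qed

definition cof :: 'a where
  "cof = (SOME h. (\<forall>i\<in>elts \<kappa>. h \<cdot> i \<in> elts \<mu>) \<and> (\<forall>b\<in>elts \<mu>. \<exists>i\<in>elts \<kappa>. elts b \<subseteq> elts (h \<cdot> i)) \<and>
     (\<forall>i\<in>elts \<kappa>. \<forall>j\<in>elts \<kappa>. h \<cdot> i \<in> elts (h \<cdot> j) \<longleftrightarrow> i \<in> elts j))"

lemma cof_props: "\<forall>i\<in>elts \<kappa>. cof \<cdot> i \<in> elts \<mu>" "\<forall>b\<in>elts \<mu>. \<exists>i\<in>elts \<kappa>. elts b \<subseteq> elts (cof \<cdot> i)"
    "\<forall>i\<in>elts \<kappa>. \<forall>j\<in>elts \<kappa>. cof \<cdot> i \<in> elts (cof \<cdot> j) \<longleftrightarrow> i \<in> elts j"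
proof -
  have "\<exists>h. (\<forall>i\<in>elts \<kappa>. h \<cdot> i \<in> elts \<mu>) \<and> (\<forall>b\<in>elts \<mu>. \<exists>i\<in>elts \<kappa>. elts b \<subseteq> elts (h \<cdot> i)) \<and>
     (\<forall>i\<in>elts \<kappa>. \<forall>j\<in>elts \<kappa>. h \<cdot> i \<in> elts (h \<cdot> j) \<longleftrightarrow> i \<in> elts j)"
    by (rule cf_enum[OF Ord_mu], unfold cf_mu) blast
  from someI_ex[OF this]
  show "\<forall>i\<in>elts \<kappa>. cof \<cdot> i \<in> elts \<mu>" "\<forall>b\<in>elts \<mu>. \<exists>i\<in>elts \<kappa>. elts b \<subseteq> elts (cof \<cdot> i)"
    "\<forall>i\<in>elts \<kappa>. \<forall>j\<in>elts \<kappa>. cof \<cdot> i \<in> elts (cof \<cdot> j) \<longleftrightarrow> i \<in> elts j"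
    unfolding cof_def by blast+
qed

text \<open>Koenig's diagonal: \<open>?g\<close> differs at \<open>i\<close> from every
  \<open>f\<close> with code below \<open>cof \<cdot> i\<close>. A free value exists, as otherwise
  sending \<open>x\<close> to the least such code of an \<open>f\<close> with
  \<open>f \<cdot> i = x\<close> would inject \<mu> into \<open>cof \<cdot> i\<close>.\<close>

lemma koenig:
  assumes dF: "dft (\<lambda>v. F (v 0))" and F: "\<And>f. maps f \<kappa> \<mu> \<Longrightarrow> F f \<in> elts \<mu>"
  shows "\<not> inj_on F (elts (vfuns \<kappa> \<mu>))"
proof
  assume "inj_on F (elts (vfuns \<kappa> \<mu>))"
  then have inj: "f = g" if "maps f \<kappa> \<mu>" "maps g \<kappa> \<mu>" "F f = F g" for f g
    using that unfolding elts_vfuns by (simp add: inj_on_eq_iff)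
  have [dfn_intros]: "dft s \<Longrightarrow> dft (\<lambda>v. F (s v))" for s by (rule dft_sub1[OF dF])
  let ?P = "\<lambda>i x. x \<in> elts \<mu> \<and> (\<forall>f. maps f \<kappa> \<mu> \<and> F f \<in> elts (cof \<cdot> i) \<longrightarrow> f \<cdot> i \<noteq> x)"
  have dP: "dfn (\<lambda>v. ?P i (v 0))" for i by (intro dfn_intros)
  have ex: "\<exists>x. ?P i x" if i: "i \<in> elts \<kappa>" for i
  proof (rule ccontr)
    assume n: "\<not> (\<exists>x. ?P i x)"
    let ?Q = "\<lambda>x c. c \<in> elts (cof \<cdot> i) \<and> (\<exists>f. maps f \<kappa> \<mu> \<and> F f = c \<and> f \<cdot> i = x)"
    have dQ: "dfn (\<lambda>v. ?Q x (v 0))" for x by (intro dfn_intros)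
    have ci: "cof \<cdot> i \<in> elts \<mu>" using cof_props(1) i by blast
    have Q: "?Q x (least_ord (?Q x))" if x: "x \<in> elts \<mu>" for x
    proof -
      obtain f where f: "maps f \<kappa> \<mu>" "F f \<in> elts (cof \<cdot> i)" "f \<cdot> i = x" using n x by blast
      then have "?Q x (F f)" by blast
      from least_ord_ex[OF dQ _ this] show ?thesis using Ord_mem[OF Ord_mu F[OF f(1)]] by blast
    qed
    have "\<not> inj_on (\<lambda>x. least_ord (?Q x)) (elts \<mu>)"
    proof (rule aleph_no_inj[OF aleph_mu ci])
      show "dft (\<lambda>v. least_ord (?Q (v 0)))" by (intro dfn_intros)
      show "least_ord (?Q x) \<in> elts (cof \<cdot> i)" if "x \<in> elts \<mu>" for x by (rule conjunct1[OF Q[OF that]])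
    qed
    moreover have "inj_on (\<lambda>x. least_ord (?Q x)) (elts \<mu>)"
    proof (rule inj_onI)
      fix x y assume x: "x \<in> elts \<mu>" and y: "y \<in> elts \<mu>" and e: "least_ord (?Q x) = least_ord (?Q y)"
      obtain f where f: "maps f \<kappa> \<mu>" "F f = least_ord (?Q x)" "f \<cdot> i = x" using conjunct2[OF Q[OF x]] by (elim exE conjE)
      obtain g where g: "maps g \<kappa> \<mu>" "F g = least_ord (?Q y)" "g \<cdot> i = y" using conjunct2[OF Q[OF y]] by (elim exE conjE)
      have "f = g" by (rule inj[OF f(1) g(1)]) (simp only: f(2) g(2) e)
      then show "x = y" using f(3) g(3) by simp
    qed
    ultimately show False by blast
  qed
  let ?g = "lam \<kappa> (\<lambda>i. least_ord (?P i))"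
  have dg: "dft (\<lambda>v. least_ord (?P (v 0)))" by (intro dfn_intros)
  have g: "?P i (?g \<cdot> i)" if i: "i \<in> elts \<kappa>" for i
  proof -
    obtain x where x: "?P i x" using ex[OF i] by blast
    have "Ord x" by (rule Ord_mem[OF Ord_mu conjunct1[OF x]])
    from least_ord_ex[OF dP this x] show ?thesis unfolding lam_app[OF dg i] by blast
  qed
  have m: "maps ?g \<kappa> \<mu>" by (rule maps_iff[THEN iffD2], rule conjI, rule is_fun_lam[OF dg], rule ballI, rule conjunct1[OF g])
  have "vsucc (F ?g) \<in> elts \<mu>" using F[OF m] Limit_mu unfolding Limit_def by blast
  then obtain i where i: "i \<in> elts \<kappa>" "elts (vsucc (F ?g)) \<subseteq> elts (cof \<cdot> i)" using cof_props(2) by blast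
  then have "F ?g \<in> elts (cof \<cdot> i)" by auto
  then show False using g[OF i(1)] m by blast
qed

lemma kappa_in_vun: "\<alpha> \<in> elts \<mu> \<Longrightarrow> vun \<alpha> \<kappa> \<in> elts \<mu>"
  by (rule vun_mem[OF Ord_mu _ kappa_mu])

text \<open>Otherwise a function from \<kappa> to \<mu> could be coded, through \<open>S\<close> and
  a pairing, by one subset of the larger of \<alpha> and \<kappa>. This is a bounded subset of
  \<mu>, and \<mu> codes suffice for those, against \<open>koenig\<close>.\<close>

lemma no_inj_pow:
  assumes a: "\<alpha> \<in> elts \<mu>" and dS: "dft (\<lambda>v. S (v 0))" and S: "\<And>x. x \<in> elts \<mu> \<Longrightarrow> elts (S x) \<subseteq> elts \<alpha>"
  shows "\<not> inj_on S (elts \<mu>)"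
proof
  assume inj: "inj_on S (elts \<mu>)"
  have [dfn_intros]: "dft s \<Longrightarrow> dft (\<lambda>v. S (s v))" for s by (rule dft_sub1[OF dS])
  let ?b = "vun \<alpha> \<kappa>"
  have b: "?b \<in> elts \<mu>" by (rule kappa_in_vun[OF a])
  have bO: "Ord ?b" by (rule Ord_mem[OF Ord_mu b])
  have "elts omega \<subseteq> elts ?b" using Ord_mem_subset[OF Ord_kappa omega_kappa] by auto
  then obtain q where q: "square_inj q ?b" using square_ex[OF bO] by blast
  let ?R = "\<lambda>f. mkset {z. \<exists>i\<in>elts \<kappa>. \<exists>x\<in>elts (S (f \<cdot> i)). z = q \<cdot> opair i x}"
  have qb: "q \<cdot> opair i x \<in> elts ?b" if "maps f \<kappa> \<mu>" "i \<in> elts \<kappa>" "x \<in> elts (S (f \<cdot> i))" for f i x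
    using square_injD(1)[OF q, of i x] S[OF maps_app[OF that(1,2)]] that by auto
  have R: "elts (?R f) = {z. \<exists>i\<in>elts \<kappa>. \<exists>x\<in>elts (S (f \<cdot> i)). z = q \<cdot> opair i x}" if f: "maps f \<kappa> \<mu>" for f
  proof (rule elts_mkset, rule small_Collect[of _ ?b])
    show "dfn (\<lambda>v. \<exists>i\<in>elts \<kappa>. \<exists>x\<in>elts (S (f \<cdot> i)). v 0 = q \<cdot> opair i x)" by (intro dfn_intros)
    show "z \<in> elts ?b" if "\<exists>i\<in>elts \<kappa>. \<exists>x\<in>elts (S (f \<cdot> i)). z = q \<cdot> opair i x" for z
      using that qb[OF f] by (elim bexE) (simp only:)
  qed
  have Rb: "elts (?R f) \<subseteq> elts ?b" if f: "maps f \<kappa> \<mu>" for f unfolding R[OF f] using qb[OF f] by auto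
  have half: "elts (S (f \<cdot> i)) \<subseteq> elts (S (g \<cdot> i))"
    if f: "maps f \<kappa> \<mu>" and g: "maps g \<kappa> \<mu>" and e: "?R f = ?R g" and i: "i \<in> elts \<kappa>" for f g i
  proof
    fix x assume x: "x \<in> elts (S (f \<cdot> i))"
    then have "q \<cdot> opair i x \<in> elts (?R g)" unfolding e[symmetric] R[OF f] using i by blast
    then obtain j y where j: "j \<in> elts \<kappa>" "y \<in> elts (S (g \<cdot> j))" "q \<cdot> opair i x = q \<cdot> opair j y"
      unfolding R[OF g] by blast
    have "x \<in> elts ?b" "y \<in> elts ?b" using S[OF maps_app[OF f i]] S[OF maps_app[OF g j(1)]] x j(2) by auto
    then have "i = j \<and> x = y" using square_injD(2)[OF q, of i x j y] i j(1,3) by simp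
    then show "x \<in> elts (S (g \<cdot> i))" using j(2) by simp
  qed
  have "\<not> inj_on (\<lambda>f. code \<cdot> ?R f) (elts (vfuns \<kappa> \<mu>))"
  proof (rule koenig)
    show "dft (\<lambda>v. code \<cdot> ?R (v 0))" by (intro dfn_intros)
    show "code \<cdot> ?R f \<in> elts \<mu>" if "maps f \<kappa> \<mu>" for f by (rule code_mu[OF b Rb[OF that]])
  qed
  moreover have "inj_on (\<lambda>f. code \<cdot> ?R f) (elts (vfuns \<kappa> \<mu>))"
  proof (rule inj_onI)
    fix f g assume fg: "f \<in> elts (vfuns \<kappa> \<mu>)" "g \<in> elts (vfuns \<kappa> \<mu>)" and c: "code \<cdot> ?R f = code \<cdot> ?R g"
    have f: "maps f \<kappa> \<mu>" and g: "maps g \<kappa> \<mu>" using fg by (simp_all add: elts_vfuns)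
    have e: "?R f = ?R g" by (rule code_inj[OF b Rb[OF f] b Rb[OF g] c])
    show "f = g"
    proof (rule is_fun_ext)
      show "is_fun f \<kappa>" "is_fun g \<kappa>" using f g by (simp_all add: maps_iff)
      fix i assume i: "i \<in> elts \<kappa>"
      have "S (f \<cdot> i) = S (g \<cdot> i)"
        using half[OF f g e i] half[OF g f e[symmetric] i] by (intro extensionality subset_antisym)
      then show "f \<cdot> i = g \<cdot> i" using inj maps_app[OF f i] maps_app[OF g i] by (simp add: inj_on_eq_iff)
    qed
  qed
  ultimately show False by blast
qed

text \<open>\<mu> is a strong limit: \<open>code\<close> injects the power set of \<alpha> into
  \<mu>, and cardinality exactly \<mu> is ruled out by \<open>no_inj_pow\<close>.\<close>

lemma vpow_card:
  assumes a: "\<alpha> \<in> elts \<mu>"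
  shows "vcard (vpow \<alpha>) \<in> elts \<mu>" "Ord (vcard (vpow \<alpha>))" "eqpoll (vpow \<alpha>) (vcard (vpow \<alpha>))"
    "b \<in> elts (vcard (vpow \<alpha>)) \<Longrightarrow> \<not> eqpoll (vcard (vpow \<alpha>)) b"
proof -
  have dc: "dft (\<lambda>v. code \<cdot> v 0)" by (intro dfn_intros)
  have m: "code \<cdot> x \<in> elts \<mu>" if "x \<in> elts (vpow \<alpha>)" for x using code_mu[OF a] that by simp
  have inj: "inj_on (fapp code) (elts (vpow \<alpha>))"
    using code_inj[OF a _ a] by (intro inj_onI) simp
  obtain k where k: "Ord k" "eqpoll (vpow \<alpha>) k"
    using inj_eqpoll_Ord[OF dc inj Ord_mem[OF Ord_mu m]] .
  show V: "Ord (vcard (vpow \<alpha>))" "eqpoll (vpow \<alpha>) (vcard (vpow \<alpha>))"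
    "b \<in> elts (vcard (vpow \<alpha>)) \<Longrightarrow> \<not> eqpoll (vcard (vpow \<alpha>)) b"
    using vcard_props[OF k] by blast+
  have sub: "elts (vcard (vpow \<alpha>)) \<subseteq> elts \<mu>" by (rule vcard_le_inj[OF Ord_mu dc inj m])
  have "vcard (vpow \<alpha>) \<noteq> \<mu>"
  proof
    assume "vcard (vpow \<alpha>) = \<mu>"
    then obtain s where s: "bij_betw (fapp s) (elts \<mu>) (elts (vpow \<alpha>))" using V(2) eqpoll_sym eqpollE by metis
    have "dft (\<lambda>v. s \<cdot> v 0)" by (intro dfn_intros)
    then have "\<not> inj_on (fapp s) (elts \<mu>)" by (rule no_inj_pow[OF a]) (use bij_betw_apply[OF s] in simp)
    then show False using s unfolding bij_betw_def by blast
  qed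
  then show "vcard (vpow \<alpha>) \<in> elts \<mu>" using Ord_subset_iff[OF V(1) Ord_mu] sub by blast
qed

text \<open>By Cantor's theorem the cardinality of the power set of \<open>?a\<close> is such an
  aleph. Later this shows that the index of \<mu> is a limit ordinal.\<close>

lemma aleph_between:
  assumes a: "\<alpha> \<in> elts \<mu>"
  shows "\<exists>k\<in>elts \<mu>. aleph k \<and> \<alpha> \<in> elts k"
proof -
  let ?a = "vun \<alpha> omega"
  have am: "?a \<in> elts \<mu>" by (rule vun_mem[OF Ord_mu a omega_mu])
  have aO: "Ord ?a" by (rule Ord_mem[OF Ord_mu am])
  let ?k = "vcard (vpow ?a)"
  note V = vpow_card[OF am]
  obtain f where f: "bij_betw (fapp f) (elts (vpow ?a)) (elts ?k)" using V(3) by (rule eqpollE)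
  have "\<not> elts ?k \<subseteq> elts ?a"
  proof
    assume s: "elts ?k \<subseteq> elts ?a"
    have "dft (\<lambda>v. f \<cdot> v 0)" by (intro dfn_intros)
    then have "\<not> inj_on (fapp f) (elts (vpow ?a))"
      by (rule cantor) (use bij_betw_apply[OF f] s in \<open>simp add: subset_iff\<close>)
    then show False using f unfolding bij_betw_def by blast
  qed
  then have ak: "?a \<in> elts ?k" using Ord_not_subset[OF V(2) aO] by blast
  then have sub: "elts ?a \<subseteq> elts ?k" by (rule Ord_mem_subset[OF V(2)])
  then have "aleph ?k" unfolding aleph_def using V(2,4) by auto
  moreover have "\<alpha> \<in> elts ?k" using Ord_subset_mem[OF V(2) Ord_mem[OF Ord_mu a] _ ak] by auto
  ultimately show ?thesis using V(1) by blast
qed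

definition pcode :: 'a where
  "pcode = (SOME f. is_fun f (vpow \<kappa>) \<and> bij_betw (fapp f) (elts (vpow \<kappa>)) (elts (vcard (vpow \<kappa>))))"

lemma pcode_bij: "bij_betw (fapp pcode) (elts (vpow \<kappa>)) (elts (vcard (vpow \<kappa>)))"
proof -
  have "\<exists>f. is_fun f (vpow \<kappa>) \<and> bij_betw (fapp f) (elts (vpow \<kappa>)) (elts (vcard (vpow \<kappa>)))"
    using vpow_card(3)[OF kappa_mu] unfolding eqpoll_iff .
  from someI_ex[OF this] show ?thesis unfolding pcode_def by blast
qed

text \<open>A family of subsets of \<kappa> becomes a set of ordinals below 2^\<kappa>, hence a
  bounded subset of \<mu>, and so has a code below \<mu>.\<close>

definition ppcode :: "'a \<Rightarrow> 'a" where
  "ppcode W = code \<cdot> mkset {z. \<exists>S\<in>elts W. z = pcode \<cdot> S}"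

lemma dft_ppcode [dfn_intros]: "dft s \<Longrightarrow> dft (\<lambda>v. ppcode (s v))"
  by (rule dft_sub1[of ppcode]) (unfold ppcode_def, intro dfn_intros)

lemma ppcode_props:
  assumes W: "elts W \<subseteq> elts (vpow \<kappa>)"
  shows "ppcode W \<in> elts \<mu>" "elts W' \<subseteq> elts (vpow \<kappa>) \<Longrightarrow> ppcode W = ppcode W' \<Longrightarrow> W = W'"
proof -
  note V = vpow_card[OF kappa_mu]
  have dp: "dft (\<lambda>v. pcode \<cdot> v 0)" by (intro dfn_intros)
  have im: "elts (mkset {z. \<exists>S\<in>elts W. z = pcode \<cdot> S}) = fapp pcode ` elts W" for W
  proof -
    have "{z. \<exists>S\<in>elts W. z = pcode \<cdot> S} = fapp pcode ` elts W" by auto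
    then show ?thesis using elts_mkset[OF small_image[OF dp]] by simp
  qed
  have sub: "elts (mkset {z. \<exists>S\<in>elts W. z = pcode \<cdot> S}) \<subseteq> elts (vcard (vpow \<kappa>))" if "elts W \<subseteq> elts (vpow \<kappa>)" for W
    unfolding im using bij_betw_imp_surj_on[OF pcode_bij] image_mono[OF that, of "fapp pcode"] by simp
  show "ppcode W \<in> elts \<mu>" unfolding ppcode_def by (rule code_mu[OF V(1) sub[OF W]])
  assume W': "elts W' \<subseteq> elts (vpow \<kappa>)" and e: "ppcode W = ppcode W'"
  have eq: "mkset {z. \<exists>S\<in>elts W. z = pcode \<cdot> S} = mkset {z. \<exists>S\<in>elts W'. z = pcode \<cdot> S}"
    by (rule code_inj[OF V(1) sub[OF W] V(1) sub[OF W'] e[unfolded ppcode_def]])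
  have "fapp pcode ` elts W = fapp pcode ` elts W'" using arg_cong[OF eq, of elts] unfolding im .
  then have "elts W = elts W'" using inj_on_image_eq_iff[OF bij_betw_imp_inj_on[OF pcode_bij] W W'] by blast
  then show "W = W'" by (rule extensionality)
qed

end

section \<open>The Galvin-Hajnal rank\<close>

lemma sep_obtain:
  assumes "dfn (\<lambda>v. P (v 0))"
  obtains X where "elts X = {x \<in> elts (a::'a::zf). P x}"
  using small_sep[OF assms, of a] unfolding small_def by blast

lemma Ord_subset_linear: "Ord a \<Longrightarrow> Ord b \<Longrightarrow> elts a \<subseteq> elts b \<or> elts b \<subseteq> elts (a::'a::zf)"
  using Ord_not_subset[of a b] Ord_mem_subset[of a b] by blast

context strong_singular
begin

definition fns :: 'a where
  "fns = vfuns \<kappa> (vsucc \<mu>)"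

lemma fns_iff: "f \<in> elts fns \<longleftrightarrow> maps f \<kappa> (vsucc \<mu>)"
  by (simp add: fns_def elts_vfuns)

lemma fns_Ord: "f \<in> elts fns \<Longrightarrow> i \<in> elts \<kappa> \<Longrightarrow> Ord (f \<cdot> i)"
  using maps_app[of f \<kappa> "vsucc \<mu>" i] Ord_mem[OF Ord_vsucc[OF Ord_mu]] unfolding fns_iff by blast

lemma fns_lam: "dft (\<lambda>v. F (v 0)) \<Longrightarrow> (\<And>i. i \<in> elts \<kappa> \<Longrightarrow> F i \<in> elts (vsucc \<mu>)) \<Longrightarrow> lam \<kappa> F \<in> elts fns"
  unfolding fns_iff by (rule maps_lam)

definition evless :: "'a \<Rightarrow> 'a \<Rightarrow> 'a \<Rightarrow> bool" where
  "evless S g f \<longleftrightarrow> (\<exists>b\<in>elts \<kappa>. \<forall>i\<in>elts S. elts b \<subseteq> elts i \<longrightarrow> g \<cdot> i \<in> elts (f \<cdot> i))"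

definition evsub :: "'a \<Rightarrow> 'a \<Rightarrow> bool" where
  "evsub S S' \<longleftrightarrow> (\<exists>b\<in>elts \<kappa>. \<forall>i\<in>elts S. elts b \<subseteq> elts i \<longrightarrow> i \<in> elts S')"

abbreviation big :: "'a \<Rightarrow> bool" where
  "big S \<equiv> unbounded_in S \<kappa>"

lemma dfn_evless [dfn_intros]: "dft s \<Longrightarrow> dft t \<Longrightarrow> dft u \<Longrightarrow> dfn (\<lambda>v. evless (s v) (t v) (u v))"
  by (rule dfn_sub3[of evless]) (unfold evless_def, intro dfn_intros)

lemma vun_kappa: "a \<in> elts \<kappa> \<Longrightarrow> b \<in> elts \<kappa> \<Longrightarrow> vun a b \<in> elts \<kappa>"
  by (rule vun_mem[OF Ord_kappa])

lemma bigD: "big S \<Longrightarrow> b \<in> elts \<kappa> \<Longrightarrow> \<exists>i\<in>elts S. elts b \<subseteq> elts i"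
  unfolding unbounded_in_def by blast

lemma big_subset: "big S \<Longrightarrow> elts S \<subseteq> elts \<kappa>"
  unfolding unbounded_in_def by blast

lemma big_kappa: "big \<kappa>"
  by (rule unbounded_in_self)

lemma evless_mono: "evless S' g f \<Longrightarrow> evsub S S' \<Longrightarrow> evless S g f"
proof -
  assume "evless S' g f" "evsub S S'"
  then obtain b c where b: "b \<in> elts \<kappa>" "\<forall>i\<in>elts S'. elts b \<subseteq> elts i \<longrightarrow> g \<cdot> i \<in> elts (f \<cdot> i)"
    and c: "c \<in> elts \<kappa>" "\<forall>i\<in>elts S. elts c \<subseteq> elts i \<longrightarrow> i \<in> elts S'"
    unfolding evless_def evsub_def by blast
  then have "\<forall>i\<in>elts S. elts (vun b c) \<subseteq> elts i \<longrightarrow> g \<cdot> i \<in> elts (f \<cdot> i)" by simp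
  then show ?thesis unfolding evless_def using vun_kappa[OF b(1) c(1)] by blast
qed

lemma evsub_subset: "elts S \<subseteq> elts S' \<Longrightarrow> evsub S S'"
  unfolding evsub_def using vempty_in_Limit[OF Limit_kappa] by blast

lemma omega_map_bounded:
  assumes dB: "dft (\<lambda>v. B (v 0))" and B: "\<And>n. n \<in> elts omega \<Longrightarrow> B n \<in> elts \<kappa>"
  shows "\<exists>c\<in>elts \<kappa>. \<forall>n\<in>elts omega. elts (B n) \<subseteq> elts c"
proof (rule ccontr)
  assume n: "\<not> ?thesis"
  have "elts (cf \<kappa>) \<subseteq> elts omega"
  proof (rule cf_le_map[OF Ord_omega Ord_kappa dB B])
    fix c assume c: "c \<in> elts \<kappa>"
    then obtain n where n: "n \<in> elts omega" "\<not> elts (B n) \<subseteq> elts c" using n by blast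
    then have "c \<in> elts (B n)" using Ord_not_subset[of "B n" c] Ord_mem[OF Ord_kappa] B c by blast
    then show "\<exists>n\<in>elts omega. elts c \<subseteq> elts (B n)"
      using Ord_mem_subset[OF Ord_mem[OF Ord_kappa B[OF n(1)]]] n(1) by blast
  qed
  then have "omega \<in> elts (omega :: 'a)" using omega_kappa unfolding cf_kappa by blast
  then show False using mem_irrefl by blast
qed

text \<open>Countably many bounds, each taken least, have a common bound below \<kappa> because its
  cofinality is uncountable. At one \<open>i\<close> of \<open>S\<close> beyond it the values would
  descend forever, against foundation.\<close>

lemma no_descent:
  assumes S: "big S" and f: "\<And>n. n \<in> elts omega \<Longrightarrow> evless S (F (vsucc n)) (F n)" and dF: "dft (\<lambda>v. F (v 0))"
  shows False
proof -
  have [dfn_intros]: "dft s \<Longrightarrow> dft (\<lambda>v. F (s v))" for s by (rule dft_sub1[OF dF])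
  let ?P = "\<lambda>n b. b \<in> elts \<kappa> \<and> (\<forall>i\<in>elts S. elts b \<subseteq> elts i \<longrightarrow> F (vsucc n) \<cdot> i \<in> elts (F n \<cdot> i))"
  have dP: "dfn (\<lambda>v. ?P n (v 0))" for n by (intro dfn_intros)
  have P: "?P n (least_ord (?P n))" if n: "n \<in> elts omega" for n
  proof -
    obtain b where b: "?P n b" using f[OF n] unfolding evless_def by blast
    from least_ord_ex[OF dP Ord_mem[OF Ord_kappa conjunct1[OF b]] b] show ?thesis by (rule conjunct1[OF conjunct2])
  qed
  have "dft (\<lambda>v. least_ord (?P (v 0)))" by (intro dfn_intros)
  then obtain c where c: "c \<in> elts \<kappa>" "\<forall>n\<in>elts omega. elts (least_ord (?P n)) \<subseteq> elts c"
    using omega_map_bounded[of "\<lambda>n. least_ord (?P n)"] conjunct1[OF P] by blast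
  obtain i where i: "i \<in> elts S" "elts c \<subseteq> elts i" using bigD[OF S c(1)] by blast
  have dec: "F (vsucc n) \<cdot> i \<in> elts (F n \<cdot> i)" if n: "n \<in> elts omega" for n
  proof -
    have "elts (least_ord (?P n)) \<subseteq> elts i" using c(2) n i(2) by blast
    then show ?thesis using conjunct2[OF P[OF n]] i(1) by blast
  qed
  have d: "dft (\<lambda>v. F (v 0) \<cdot> i)" by (intro dfn_intros)
  have "elts (omega :: 'a) \<noteq> {}" using vempty_in_Limit[OF omega_Limit] by blast
  from image_minimal[OF d this] obtain m where m: "m \<in> elts omega" "\<forall>n\<in>elts omega. F n \<cdot> i \<notin> elts (F m \<cdot> i)" by blast
  have "vsucc m \<in> elts omega" using omega_Limit m(1) unfolding Limit_def by blast
  then show False using m(2) dec[OF m(1)] by blast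
qed

definition rkdom :: 'a where
  "rkdom = vtimes (mkset {S \<in> elts (vpow \<kappa>). big S}) fns"

text \<open>Pairs with different first components are incomparable, so a single collapse gives the
  ranks for all \<open>S\<close> at once.\<close>

definition rklt :: "'a \<Rightarrow> 'a \<Rightarrow> bool" where
  "rklt p q \<longleftrightarrow> vfst p = vfst q \<and> evless (vfst p) (vsnd p) (vsnd q)"

lemma rkdom_iff: "opair S f \<in> elts rkdom \<longleftrightarrow> big S \<and> f \<in> elts fns"
proof -
  have "elts (mkset {S \<in> elts (vpow \<kappa>). big S}) = {S \<in> elts (vpow \<kappa>). big S}"
    by (rule elts_mkset, rule small_sep) (intro dfn_intros)
  then show ?thesis unfolding rkdom_def opair_in_vtimes using big_subset by auto
qed

lemma rkdomE:
  assumes "p \<in> elts rkdom"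
  obtains S f where "p = opair S f" "big S" "f \<in> elts fns"
proof -
  obtain S f where p: "p = opair S f" using in_vtimesE[OF assms[unfolded rkdom_def]] by blast
  then show thesis using that assms rkdom_iff by blast
qed

lemma evless_trans:
  assumes "big S" "f \<in> elts fns" "evless S h g" "evless S g f"
  shows "evless S h f"
proof -
  obtain b c where b: "b \<in> elts \<kappa>" "\<forall>i\<in>elts S. elts b \<subseteq> elts i \<longrightarrow> h \<cdot> i \<in> elts (g \<cdot> i)"
    and c: "c \<in> elts \<kappa>" "\<forall>i\<in>elts S. elts c \<subseteq> elts i \<longrightarrow> g \<cdot> i \<in> elts (f \<cdot> i)"
    using assms(3,4) unfolding evless_def by blast
  have "h \<cdot> i \<in> elts (f \<cdot> i)" if i: "i \<in> elts S" "elts (vun b c) \<subseteq> elts i" for i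
  proof -
    have "i \<in> elts \<kappa>" using big_subset[OF assms(1)] i(1) by blast
    then show ?thesis using Ord_trans[OF fns_Ord[OF assms(2)], of i "h \<cdot> i" "g \<cdot> i"] b(2) c(2) i by simp
  qed
  then show ?thesis unfolding evless_def using vun_kappa[OF b(1) c(1)] by blast
qed

text \<open>Here dependent choice enters: a nonempty set without minimal element yields a descending
  \<omega>-sequence in the model. Its first component is constant, so \<open>no_descent\<close>
  applies.\<close>

lemma wf_rklt: "wf_order rklt rkdom"
proof unfold_locales
  show "dfn (\<lambda>v. rklt (v 0) (v 1))" unfolding rklt_def by (intro dfn_intros)
  have d [dfn_intros]: "dft s \<Longrightarrow> dft t \<Longrightarrow> dfn (\<lambda>v. rklt (s v) (t v))" for s t
    unfolding rklt_def by (intro dfn_intros)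
  show "rklt x z" if x: "x \<in> elts rkdom" and z: "z \<in> elts rkdom" and l: "rklt x y" "rklt y z" for x y z
  proof -
    obtain S f where z': "z = opair S f" "big S" "f \<in> elts fns" by (rule rkdomE[OF z])
    then show ?thesis using l evless_trans[OF z'(2,3), of "vsnd x" "vsnd y"] unfolding rklt_def by auto
  qed
  show "\<exists>m\<in>elts Y. \<forall>y\<in>elts Y. \<not> rklt y m" if Y: "elts Y \<subseteq> elts rkdom" "elts Y \<noteq> {}" for Y
  proof (rule ccontr)
    assume n: "\<not> ?thesis"
    let ?r = "mkset {p \<in> elts (vtimes Y Y). rklt (vsnd p) (vfst p)}"
    have r: "elts ?r = {p \<in> elts (vtimes Y Y). rklt (vsnd p) (vfst p)}"
      by (rule elts_mkset, rule small_sep) (intro dfn_intros)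
    have "\<forall>x\<in>elts Y. \<exists>y\<in>elts Y. opair x y \<in> elts ?r" unfolding r using n by simp
    then obtain g where g: "maps g omega Y" "\<forall>n\<in>elts omega. opair (app g n) (app g (vsucc n)) \<in> elts ?r"
      using dependent_choice[OF Y(2)] by blast
    have gY: "g \<cdot> n \<in> elts Y" if "n \<in> elts omega" for n using maps_app[OF g(1) that] .
    have sc: "vsucc n \<in> elts omega" if "n \<in> elts omega" for n :: 'a using omega_Limit that unfolding Limit_def by blast
    have g': "rklt (g \<cdot> vsucc n) (g \<cdot> n)" if n: "n \<in> elts omega" for n
    proof -
      have "is_fun g omega" using g(1) by (simp add: maps_iff)
      then have "app g n = g \<cdot> n" "app g (vsucc n) = g \<cdot> vsucc n" using app_eq n sc[OF n] by blast+
      then have "opair (g \<cdot> n) (g \<cdot> vsucc n) \<in> elts ?r" using g(2) n by auto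
      then show ?thesis unfolding r by simp
    qed
    let ?S = "vfst (g \<cdot> vempty)"
    have z: "vempty \<in> elts (omega :: 'a)" by (rule vempty_in_Limit[OF omega_Limit])
    have S: "big ?S"
    proof -
      have m: "g \<cdot> vempty \<in> elts rkdom" using gY[OF z] Y(1) by blast
      obtain S f where "g \<cdot> vempty = opair S f" "big S" "f \<in> elts fns" by (rule rkdomE[OF m])
      then show ?thesis by simp
    qed
    have same: "vfst (g \<cdot> n) = ?S" if n: "n \<in> elts omega" for n
    proof (rule omega_induct[where P = "\<lambda>n. vfst (g \<cdot> n) = ?S", OF _ n refl])
      show "dfn (\<lambda>v. vfst (g \<cdot> v 0) = ?S)" by (intro dfn_intros)
      fix m assume "m \<in> elts omega" "vfst (g \<cdot> m) = ?S"
      then show "vfst (g \<cdot> vsucc m) = ?S" using g'[of m] unfolding rklt_def by simp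
    qed
    show False
    proof (rule no_descent[OF S, of "\<lambda>n. vsnd (g \<cdot> n)"])
      show "dft (\<lambda>v. vsnd (g \<cdot> v 0))" by (intro dfn_intros)
      show "evless ?S (vsnd (g \<cdot> vsucc n)) (vsnd (g \<cdot> n))" if n: "n \<in> elts omega" for n
        using conjunct2[OF g'[OF n, unfolded rklt_def]] unfolding same[OF sc[OF n]] .
    qed
  qed
qed

definition rkf :: 'a where
  "rkf = (SOME r. \<forall>x\<in>elts rkdom. elts (r \<cdot> x) = {r \<cdot> y | y. y \<in> elts rkdom \<and> rklt y x} \<and> Ord (r \<cdot> x))"

definition rk :: "'a \<Rightarrow> 'a \<Rightarrow> 'a" where
  "rk S f = rkf \<cdot> opair S f"

lemma dft_rk [dfn_intros]: "dft s \<Longrightarrow> dft t \<Longrightarrow> dft (\<lambda>v. rk (s v) (t v))"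
  unfolding rk_def by (intro dfn_intros)

lemma rkf_props: "\<forall>x\<in>elts rkdom. elts (rkf \<cdot> x) = {rkf \<cdot> y | y. y \<in> elts rkdom \<and> rklt y x} \<and> Ord (rkf \<cdot> x)"
proof -
  have "\<exists>r. \<forall>x\<in>elts rkdom. elts (r \<cdot> x) = {r \<cdot> y | y. y \<in> elts rkdom \<and> rklt y x} \<and> Ord (r \<cdot> x)"
    by (rule wf_order.rank_exists[OF wf_rklt]) blast
  from someI_ex[OF this] show ?thesis unfolding rkf_def .
qed

lemma rk_Ord: "big S \<Longrightarrow> f \<in> elts fns \<Longrightarrow> Ord (rk S f)"
  using rkf_props rkdom_iff[of S f] unfolding rk_def by blast

lemma rk_less:
  assumes "big S" "f \<in> elts fns" "g \<in> elts fns" "evless S g f"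
  shows "rk S g \<in> elts (rk S f)"
proof -
  have "opair S f \<in> elts rkdom" "opair S g \<in> elts rkdom" "rklt (opair S g) (opair S f)"
    using assms by (simp_all add: rkdom_iff rklt_def)
  then show ?thesis using rkf_props unfolding rk_def by blast
qed

lemma rk_realise:
  assumes S: "big S" "f \<in> elts fns" and a: "a \<in> elts (rk S f)"
  obtains g where "g \<in> elts fns" "evless S g f" "rk S g = a"
proof -
  have "opair S f \<in> elts rkdom" using S by (simp add: rkdom_iff)
  then obtain y where y: "a = rkf \<cdot> y" "y \<in> elts rkdom" "rklt y (opair S f)"
    using bspec[OF rkf_props] a unfolding rk_def by blast
  obtain S' g where y': "y = opair S' g" "big S'" "g \<in> elts fns" by (rule rkdomE[OF y(2)])
  have h: "S' = S \<and> evless S' g f" using y(3) unfolding rklt_def y'(1) vfst_opair vsnd_opair .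
  have "evless S g f" using conjunct2[OF h] unfolding conjunct1[OF h] .
  moreover have "rk S g = a" unfolding rk_def y(1) y'(1) conjunct1[OF h] by (rule refl)
  ultimately show thesis using that y'(3) by blast
qed

text \<open>On a smaller set more functions lie below \<open>f\<close>, so the rank can only
  grow.\<close>

lemma rk_antimono:
  assumes S: "big S" "big S'" "evsub S S'" and f: "f \<in> elts fns"
  shows "elts (rk S' f) \<subseteq> elts (rk S f)"
proof -
  have "\<forall>f\<in>elts fns. rk S f = rk S f0 \<longrightarrow> elts (rk S' f) \<subseteq> elts (rk S f0)" if f0: "f0 \<in> elts fns" for f0
  proof (rule Ord_induct[where P = "\<lambda>a. \<forall>f\<in>elts fns. rk S f = a \<longrightarrow> elts (rk S' f) \<subseteq> elts a"])
    show "dfn (\<lambda>v. \<forall>f\<in>elts fns. rk S f = v 0 \<longrightarrow> elts (rk S' f) \<subseteq> elts (v 0))" by (intro dfn_intros)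
    show "Ord (rk S f0)" by (rule rk_Ord[OF S(1) f0])
    fix a assume a: "Ord a" and IH: "\<And>b. b \<in> elts a \<Longrightarrow> \<forall>f\<in>elts fns. rk S f = b \<longrightarrow> elts (rk S' f) \<subseteq> elts b"
    show "\<forall>f\<in>elts fns. rk S f = a \<longrightarrow> elts (rk S' f) \<subseteq> elts a"
    proof (intro ballI impI subsetI)
      fix f z assume f: "f \<in> elts fns" and fa: "rk S f = a" and z: "z \<in> elts (rk S' f)"
      obtain g where g: "g \<in> elts fns" "evless S' g f" "rk S' g = z" by (rule rk_realise[OF S(2) f z])
      have "rk S g \<in> elts a" using rk_less[OF S(1) f g(1) evless_mono[OF g(2) S(3)]] fa by simp
      moreover have "elts z \<subseteq> elts (rk S g)" using IH[OF calculation] g(1,3) by blast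
      moreover have "Ord z" using rk_Ord[OF S(2) g(1)] g(3) by simp
      ultimately show "z \<in> elts a" using Ord_subset_mem[OF a] by blast
    qed
  qed
  then show ?thesis using f by blast
qed

lemma rk_mono:
  assumes S: "big S" and f: "f \<in> elts fns" and g: "g \<in> elts fns"
    and le: "\<And>i. i \<in> elts S \<Longrightarrow> elts (f \<cdot> i) \<subseteq> elts (g \<cdot> i)"
  shows "elts (rk S f) \<subseteq> elts (rk S g)"
proof
  fix z assume z: "z \<in> elts (rk S f)"
  obtain h where h: "h \<in> elts fns" "evless S h f" "rk S h = z" by (rule rk_realise[OF S f z])
  have "evless S h g" using h(2) le unfolding evless_def by blast
  then show "z \<in> elts (rk S g)" using rk_less[OF S g h(1)] h(3) by simp
qed

text \<open>Let \<open>g\<close> and \<open>h\<close> realise \<open>a\<close> on \<open>A\<close>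
  and on \<open>B\<close>. Pasted together they give \<open>k\<close> below \<open>f\<close> on
  \<open>C\<close>. Its rank is at least \<open>a\<close> on both parts, hence on \<open>C\<close>
  by the induction hypothesis for the ordinals below \<open>a\<close>.\<close>

lemma rk_union:
  assumes A: "big A" and B: "big B" and C: "big C" "elts C = elts A \<union> elts B" and disj: "elts A \<inter> elts B = {}"
    and f: "f \<in> elts fns" and a: "a \<in> elts (rk A f)" "a \<in> elts (rk B f)"
  shows "a \<in> elts (rk C f)"
proof -
  have "\<forall>f\<in>elts fns. a \<in> elts (rk A f) \<and> a \<in> elts (rk B f) \<longrightarrow> a \<in> elts (rk C f)"
  proof (rule Ord_induct[where P = "\<lambda>a. \<forall>f\<in>elts fns. a \<in> elts (rk A f) \<and> a \<in> elts (rk B f) \<longrightarrow> a \<in> elts (rk C f)"])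
    show "dfn (\<lambda>v. \<forall>f\<in>elts fns. v 0 \<in> elts (rk A f) \<and> v 0 \<in> elts (rk B f) \<longrightarrow> v 0 \<in> elts (rk C f))"
      by (intro dfn_intros)
    show "Ord a" using Ord_mem[OF rk_Ord[OF A f] a(1)] .
    fix a assume O: "Ord a" and IH: "\<And>b. b \<in> elts a \<Longrightarrow>
        \<forall>f\<in>elts fns. b \<in> elts (rk A f) \<and> b \<in> elts (rk B f) \<longrightarrow> b \<in> elts (rk C f)"
    show "\<forall>f\<in>elts fns. a \<in> elts (rk A f) \<and> a \<in> elts (rk B f) \<longrightarrow> a \<in> elts (rk C f)"
    proof (intro ballI impI, elim conjE)
      fix f assume f: "f \<in> elts fns" and aA: "a \<in> elts (rk A f)" and aB: "a \<in> elts (rk B f)"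
      obtain g where g: "g \<in> elts fns" "evless A g f" "rk A g = a" by (rule rk_realise[OF A f aA])
      obtain h where h: "h \<in> elts fns" "evless B h f" "rk B h = a" by (rule rk_realise[OF B f aB])
      define k where "k = lam \<kappa> (\<lambda>i. if i \<in> elts A then g \<cdot> i else h \<cdot> i)"
      have dk: "dft (\<lambda>v. if v 0 \<in> elts A then g \<cdot> v 0 else h \<cdot> v 0)" by (intro dfn_intros)
      have ki: "k \<cdot> i = (if i \<in> elts A then g \<cdot> i else h \<cdot> i)" if "i \<in> elts \<kappa>" for i
        unfolding k_def using lam_app[OF dk that] .
      have k: "k \<in> elts fns" unfolding k_def
        using maps_app[OF g(1)[unfolded fns_iff]] maps_app[OF h(1)[unfolded fns_iff]] by (intro fns_lam[OF dk]) simp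
      have kA: "k \<cdot> i = g \<cdot> i" if "i \<in> elts A" for i using ki[of i] that big_subset[OF A] by auto
      have kB: "k \<cdot> i = h \<cdot> i" if "i \<in> elts B" for i 
      proof -
        have "i \<in> elts \<kappa>" "i \<notin> elts A" using that big_subset[OF B] disj by blast+
        then show ?thesis using ki[of i] by simp
      qed
      obtain b c where b: "b \<in> elts \<kappa>" "\<forall>i\<in>elts A. elts b \<subseteq> elts i \<longrightarrow> g \<cdot> i \<in> elts (f \<cdot> i)"
        and c: "c \<in> elts \<kappa>" "\<forall>i\<in>elts B. elts c \<subseteq> elts i \<longrightarrow> h \<cdot> i \<in> elts (f \<cdot> i)"
        using g(2) h(2) unfolding evless_def by blast
      have "k \<cdot> i \<in> elts (f \<cdot> i)" if i: "i \<in> elts C" "elts (vun b c) \<subseteq> elts i" for i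
        using i C(2) b(2) c(2) kA[of i] kB[of i] by (cases "i \<in> elts A") auto
      then have "evless C k f" unfolding evless_def using vun_kappa[OF b(1) c(1)] by blast
      then have kf: "rk C k \<in> elts (rk C f)" by (rule rk_less[OF C(1) f k])
      have "elts a \<subseteq> elts (rk A k)" using rk_mono[OF A g(1) k] kA g(3) by simp
      moreover have "elts a \<subseteq> elts (rk B k)" using rk_mono[OF B h(1) k] kB h(3) by simp
      ultimately have "elts a \<subseteq> elts (rk C k)" using IH k by blast
      then show "a \<in> elts (rk C f)" using Ord_subset_mem[OF rk_Ord[OF C(1) f] O _ kf] by blast
    qed
  qed
  then show ?thesis using f a by blast
qed

lemma rk_eq_almost:
  assumes S: "big S" and AS: "elts A \<subseteq> elts S" and b: "b \<in> elts \<kappa>" "\<And>i. i \<in> elts S \<Longrightarrow> elts b \<subseteq> elts i \<Longrightarrow> i \<in> elts A"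
    and f: "f \<in> elts fns"
  shows "big A \<and> rk A f = rk S f"
proof
  show A: "big A" unfolding unbounded_in_def
  proof (intro conjI ballI)
    show "elts A \<subseteq> elts \<kappa>" using AS big_subset[OF S] by blast
    fix a assume "a \<in> elts \<kappa>"
    then obtain i where i: "i \<in> elts S" "elts (vun a b) \<subseteq> elts i" using bigD[OF S vun_kappa[OF _ b(1)]] by blast
    then have "i \<in> elts A" "elts a \<subseteq> elts i" using b(2) by auto
    then show "\<exists>i\<in>elts A. elts a \<subseteq> elts i" by blast
  qed
  have "evsub S A" unfolding evsub_def using b by blast
  then show "rk A f = rk S f"
    using rk_antimono[OF S A _ f] rk_antimono[OF A S evsub_subset[OF AS] f] by (intro extensionality subset_antisym)
qed

text \<open>The sets \<open>C \<subseteq> S\<close> with \<open>rk C f \<noteq> rk S f\<close> form an ideal.\<close>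

lemma rk_split:
  assumes S: "big S" "elts S = elts A \<union> elts B" and f: "f \<in> elts fns"
  shows "big A \<and> rk A f = rk S f \<or> big B \<and> rk B f = rk S f"
proof -
  have AS: "elts A \<subseteq> elts S" and BS: "elts B \<subseteq> elts S" using S(2) by auto
  have sub: "elts S \<subseteq> elts \<kappa>" by (rule big_subset[OF S(1)])
  have not_big: "\<exists>b\<in>elts \<kappa>. \<forall>i\<in>elts T. \<not> elts b \<subseteq> elts i" if "\<not> big T" "elts T \<subseteq> elts S" for T
    using that sub unfolding unbounded_in_def by blast
  show ?thesis
  proof (cases "big A \<and> big (vdiff B A)")
    case False
    then consider "\<not> big A" | "\<not> big (vdiff B A)" by blast
    then show ?thesis
    proof cases
      case 1
      then obtain b where "b \<in> elts \<kappa>" "\<forall>i\<in>elts A. \<not> elts b \<subseteq> elts i" using not_big[OF 1 AS] by blast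
      then show ?thesis using rk_eq_almost[OF S(1) BS _ _ f, of b] S(2) by blast
    next
      case 2
      have "elts (vdiff B A) \<subseteq> elts S" using BS by auto
      then obtain b where "b \<in> elts \<kappa>" "\<forall>i\<in>elts B - elts A. \<not> elts b \<subseteq> elts i"
        using not_big[OF 2] unfolding elts_vdiff by blast
      then show ?thesis using rk_eq_almost[OF S(1) AS _ _ f, of b] S(2) by blast
    qed
  next
    case True
    let ?B = "vdiff B A"
    have A: "big A" and B': "big ?B" using True by blast+
    have B: "big B" unfolding unbounded_in_def using BS sub bigD[OF B'] unfolding elts_vdiff by blast
    have un: "elts S = elts A \<union> elts ?B" "elts A \<inter> elts ?B = {}" using S(2) by auto
    have u: "elts (rk A f) \<inter> elts (rk ?B f) \<subseteq> elts (rk S f)"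
      using rk_union[OF A B' S(1) un f] by blast
    have s1: "elts (rk S f) \<subseteq> elts (rk A f)" by (rule rk_antimono[OF A S(1) evsub_subset[OF AS] f])
    have s2: "elts (rk S f) \<subseteq> elts (rk B f)" by (rule rk_antimono[OF B S(1) evsub_subset[OF BS] f])
    have s3: "elts (rk B f) \<subseteq> elts (rk ?B f)" by (rule rk_antimono[OF B' B evsub_subset f]) auto
    \<comment> \<open>By \<open>rk_union\<close> the smaller of these two ranks is at most the rank
      on \<open>S\<close>, and by antitonicity it is at least that rank.\<close>
    have "elts (rk A f) \<subseteq> elts (rk ?B f) \<or> elts (rk ?B f) \<subseteq> elts (rk A f)"
      by (rule Ord_subset_linear[OF rk_Ord[OF A f] rk_Ord[OF B' f]])
    then show ?thesis
    proof
      assume "elts (rk A f) \<subseteq> elts (rk ?B f)"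
      then have "elts (rk A f) = elts (rk S f)" using u s1 by blast
      from extensionality[OF this] show ?thesis using A by simp
    next
      assume "elts (rk ?B f) \<subseteq> elts (rk A f)"
      then have "elts (rk B f) = elts (rk S f)" using u s2 s3 by blast
      from extensionality[OF this] show ?thesis using B by simp
    qed
  qed
qed

definition rkpos :: "'a \<Rightarrow> 'a" where
  "rkpos f = mkset {S. elts S \<subseteq> elts \<kappa> \<and> big S \<and> rk S f = rk \<kappa> f}"

lemma elts_rkpos: "elts (rkpos f) = {S. big S \<and> rk S f = rk \<kappa> f}"
proof -
  have "elts (rkpos f) = {S. elts S \<subseteq> elts \<kappa> \<and> big S \<and> rk S f = rk \<kappa> f}"
    unfolding rkpos_def by (rule elts_mkset, rule small_Collect[of _ "vpow \<kappa>"]) (intro dfn_intros, simp)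
  then show ?thesis using big_subset by blast
qed

lemma dft_rkpos [dfn_intros]: "dft s \<Longrightarrow> dft (\<lambda>v. rkpos (s v))"
  by (rule dft_sub1[of rkpos]) (unfold rkpos_def, intro dfn_intros)

text \<open>If the common rank were attained on \<open>X\<close>, where \<open>f\<close> is below
  \<open>g\<close>, both functions would have this rank there although one rank is smaller; likewise
  for \<open>Y\<close>. As the remaining sets form an ideal, the rank is attained on
  \<open>Z\<close>, which is therefore unbounded.\<close>

lemma rk_determines:
  assumes f: "f \<in> elts fns" and g: "g \<in> elts fns" and r: "rk \<kappa> f = rk \<kappa> g" and p: "rkpos f = rkpos g"
  shows "\<forall>b\<in>elts \<kappa>. \<exists>i\<in>elts \<kappa>. elts b \<subseteq> elts i \<and> f \<cdot> i = g \<cdot> i"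
proof -
  obtain X where X: "elts X = {i \<in> elts \<kappa>. f \<cdot> i \<in> elts (g \<cdot> i)}"
    by (rule sep_obtain[of "\<lambda>i. f \<cdot> i \<in> elts (g \<cdot> i)" \<kappa>]) (intro dfn_intros)
  obtain Y where Y: "elts Y = {i \<in> elts \<kappa>. g \<cdot> i \<in> elts (f \<cdot> i)}"
    by (rule sep_obtain[of "\<lambda>i. g \<cdot> i \<in> elts (f \<cdot> i)" \<kappa>]) (intro dfn_intros)
  obtain Z where Z: "elts Z = {i \<in> elts \<kappa>. f \<cdot> i = g \<cdot> i}"
    by (rule sep_obtain[of "\<lambda>i. f \<cdot> i = g \<cdot> i" \<kappa>]) (intro dfn_intros)
  have un: "elts \<kappa> = elts X \<union> elts (vun Y Z)"
  proof (rule set_eqI)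
    fix i
    have "f \<cdot> i \<in> elts (g \<cdot> i) \<or> f \<cdot> i = g \<cdot> i \<or> g \<cdot> i \<in> elts (f \<cdot> i)" if "i \<in> elts \<kappa>"
      by (rule Ord_linear[OF fns_Ord[OF f that] fns_Ord[OF g that]])
    then show "i \<in> elts \<kappa> \<longleftrightarrow> i \<in> elts X \<union> elts (vun Y Z)" unfolding elts_vun Un_iff X Y Z mem_Collect_eq by argo
  qed
  have pos: "rk S g = rk \<kappa> g" if "big S" "rk S f = rk \<kappa> f" for S
  proof -
    have "S \<in> elts (rkpos f)" using that by (simp add: elts_rkpos)
    then have "S \<in> elts (rkpos g)" unfolding p .
    then show ?thesis by (simp add: elts_rkpos)
  qed
  have ev: "evless X f g" "evless Y g f" unfolding evless_def X Y using vempty_in_Limit[OF Limit_kappa] by blast+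
  have nX: "\<not> (big X \<and> rk X f = rk \<kappa> f)"
  proof
    assume h: "big X \<and> rk X f = rk \<kappa> f"
    have "rk X f \<in> elts (rk X g)" by (rule rk_less[OF conjunct1[OF h] g f ev(1)])
    then show False unfolding conjunct2[OF h] pos[OF conjunct1[OF h] conjunct2[OF h]] r using mem_irrefl by blast
  qed
  have nY: "\<not> (big Y \<and> rk Y f = rk \<kappa> f)"
  proof
    assume h: "big Y \<and> rk Y f = rk \<kappa> f"
    have "rk Y g \<in> elts (rk Y f)" by (rule rk_less[OF conjunct1[OF h] f g ev(2)])
    then show False unfolding conjunct2[OF h] pos[OF conjunct1[OF h] conjunct2[OF h]] r using mem_irrefl by blast
  qed
  have V: "big (vun Y Z)" "rk (vun Y Z) f = rk \<kappa> f" using rk_split[OF big_kappa un f] nX by (elim disjE; simp)+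
  have "big Z" using rk_split[OF V(1) elts_vun f] nY unfolding V(2) by (elim disjE; simp)
  then show ?thesis using bigD[of Z] unfolding Z by blast
qed

end

section \<open>The power set of a strong singular cardinal\<close>

lemma otimesI:
  assumes dF: "dft (\<lambda>v. F (v 0))"
    and F: "\<And>d. d \<in> elts a \<Longrightarrow> Limit d \<Longrightarrow> unbounded_in (F d) d \<and> R (otp (F (d::'a::zf)))"
  shows "otimes a R"
proof -
  let ?D = "mkset {d \<in> elts a. Limit d}"
  have D: "elts ?D = {d \<in> elts a. Limit d}" by (rule elts_mkset, rule small_sep) (intro dfn_intros)
  have "app (lam ?D F) d = F d" if "d \<in> elts a" "Limit d" for d
  proof -
    have d: "d \<in> elts ?D" using that D by simp
    show ?thesis using app_eq[OF is_fun_lam[OF dF] d] lam_app[OF dF d] by simp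
  qed
  then show ?thesis unfolding otimes_def
    using F by (intro exI[of _ "lam ?D F"] conjI ballI impI is_fun_lam[OF dF]) simp_all
qed

context strong_singular
begin

definition res :: "'a \<Rightarrow> 'a \<Rightarrow> 'a" where
  "res A i = mkset {z. z \<in> elts A \<and> z \<in> elts (cof \<cdot> i)}"

lemma elts_res: "elts (res A i) = elts A \<inter> elts (cof \<cdot> i)"
proof -
  have "elts (res A i) = {z \<in> elts A. z \<in> elts (cof \<cdot> i)}"
    unfolding res_def by (rule elts_mkset, rule small_sep) (intro dfn_intros)
  then show ?thesis by blast
qed

definition cfn :: "'a \<Rightarrow> 'a" where
  "cfn A = lam \<kappa> (\<lambda>i. code \<cdot> res A i)"

lemma dft_res [dfn_intros]: "dft s \<Longrightarrow> dft t \<Longrightarrow> dft (\<lambda>v. res (s v) (t v))"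
  by (rule dft_sub2[of res]) (unfold res_def, intro dfn_intros)

lemma dft_cfn [dfn_intros]: "dft s \<Longrightarrow> dft (\<lambda>v. cfn (s v))"
  by (rule dft_sub1[of cfn]) (unfold cfn_def, intro dfn_intros)

lemma cof_mu: "i \<in> elts \<kappa> \<Longrightarrow> cof \<cdot> i \<in> elts \<mu>"
  using cof_props(1) by blast

lemma cfn_app: "i \<in> elts \<kappa> \<Longrightarrow> cfn A \<cdot> i = code \<cdot> res A i"
proof -
  have "dft (\<lambda>v. code \<cdot> res A (v 0))" by (intro dfn_intros)
  then show "i \<in> elts \<kappa> \<Longrightarrow> ?thesis" unfolding cfn_def by (rule lam_app)
qed

lemma cfn_mu: "i \<in> elts \<kappa> \<Longrightarrow> cfn A \<cdot> i \<in> elts \<mu>"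
  unfolding cfn_app by (rule code_mu[OF cof_mu]) (auto simp: elts_res)

lemma cfn_fns: "cfn A \<in> elts fns"
  unfolding cfn_def
proof (rule fns_lam)
  show "dft (\<lambda>v. code \<cdot> res A (v 0))" by (intro dfn_intros)
  show "code \<cdot> res A i \<in> elts (vsucc \<mu>)" if "i \<in> elts \<kappa>" for i
    using cfn_mu[OF that, of A] unfolding cfn_app[OF that] by simp
qed

lemma cof_mono: "i \<in> elts \<kappa> \<Longrightarrow> j \<in> elts \<kappa> \<Longrightarrow> elts i \<subseteq> elts j \<Longrightarrow> elts (cof \<cdot> i) \<subseteq> elts (cof \<cdot> j)"
proof -
  assume ij: "i \<in> elts \<kappa>" "j \<in> elts \<kappa>" "elts i \<subseteq> elts j"
  then consider "i = j" | "i \<in> elts j" using Ord_subset_iff[of i j] Ord_mem[OF Ord_kappa] by blast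
  then show ?thesis
  proof cases
    case 2
    then have "cof \<cdot> i \<in> elts (cof \<cdot> j)" using cof_props(3) ij by blast
    then show ?thesis by (rule Ord_mem_subset[OF Ord_mem[OF Ord_mu cof_mu[OF ij(2)]]])
  qed simp
qed

text \<open>The two sets differ at some \<open>z\<close> below \<open>cof \<cdot> b\<close>, and
  from \<open>b\<close> on all their restrictions differ there, hence so do the codes.\<close>

lemma cfn_diff:
  assumes A: "elts A \<subseteq> elts \<mu>" and B: "elts B \<subseteq> elts \<mu>" and ne: "A \<noteq> B"
  shows "\<exists>b\<in>elts \<kappa>. \<forall>i\<in>elts \<kappa>. elts b \<subseteq> elts i \<longrightarrow> cfn A \<cdot> i \<noteq> cfn B \<cdot> i"
proof -
  have "elts A \<noteq> elts B" using ne elts_inject by blast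
  then obtain z where z: "(z \<in> elts A) \<noteq> (z \<in> elts B)" by blast
  then have "z \<in> elts \<mu>" using A B by blast
  then have "vsucc z \<in> elts \<mu>" using Limit_mu unfolding Limit_def by blast
  then obtain b where b: "b \<in> elts \<kappa>" "elts (vsucc z) \<subseteq> elts (cof \<cdot> b)" using cof_props(2) by blast
  have "cfn A \<cdot> i \<noteq> cfn B \<cdot> i" if i: "i \<in> elts \<kappa>" "elts b \<subseteq> elts i" for i
  proof
    assume "cfn A \<cdot> i = cfn B \<cdot> i"
    then have "code \<cdot> res A i = code \<cdot> res B i" unfolding cfn_app[OF i(1)] .
    then have e: "res A i = res B i"
      by (rule code_inj[OF cof_mu[OF i(1)] _ cof_mu[OF i(1)], rotated 2]) (simp_all add: elts_res)
    have "z \<in> elts (cof \<cdot> i)" using b(2) cof_mono[OF b(1) i] by auto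
    then have "(z \<in> elts (res A i)) \<noteq> (z \<in> elts (res B i))" unfolding elts_res using z by blast
    then show False unfolding e by blast
  qed
  then show ?thesis using b(1) by blast
qed

text \<open>Order the subsets by the rank and then by the code of \<open>rkpos\<close> of their
  coding functions. Equal keys would make two coding functions agree unboundedly often, which
  \<open>cfn_diff\<close> forbids for different sets. The third key is constant.\<close>

lemma vpow_mu_Ord: "\<exists>a. Ord a \<and> eqpoll (vpow \<mu>) a"
proof -
  let ?F = "\<lambda>A. rk \<kappa> (cfn A)" and ?G = "\<lambda>A. ppcode (rkpos (cfn A))" and ?H = "\<lambda>A::'a. vempty :: 'a"
  have sub: "elts (rkpos f) \<subseteq> elts (vpow \<kappa>)" for f using big_subset by (auto simp: elts_rkpos)
  have d: "dft (\<lambda>v. ?F (v 0))" "dft (\<lambda>v. ?G (v 0))" "dft (\<lambda>v. ?H (v 0))" by (intro dfn_intros)+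
  have O: "Ord (?F A) \<and> Ord (?G A) \<and> Ord (?H A)" for A
    using rk_Ord[OF big_kappa cfn_fns] Ord_mem[OF Ord_mu ppcode_props(1)[OF sub]] by simp
  interpret wf_order "lex ?F ?G ?H" "vpow \<mu>" by (rule lex_wf_order[OF d O])
  have inj: "A = B" if A: "A \<in> elts (vpow \<mu>)" and B: "B \<in> elts (vpow \<mu>)" and e: "?F A = ?F B" "?G A = ?G B" for A B
  proof (rule ccontr)
    assume "A \<noteq> B"
    then obtain b where b: "b \<in> elts \<kappa>" "\<forall>i\<in>elts \<kappa>. elts b \<subseteq> elts i \<longrightarrow> cfn A \<cdot> i \<noteq> cfn B \<cdot> i"
      using cfn_diff[of A B] A B by auto
    have "rkpos (cfn A) = rkpos (cfn B)" by (rule ppcode_props(2)[OF sub sub e(2)])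
    from rk_determines[OF cfn_fns cfn_fns e(1) this] show False using b by blast
  qed
  have lin: "lex ?F ?G ?H x y \<or> lex ?F ?G ?H y x" if "x \<in> elts (vpow \<mu>)" "y \<in> elts (vpow \<mu>)" "x \<noteq> y" for x y
    by (rule lex_linear[OF O O _ that(3)]) (rule inj[OF that(1,2)])
  obtain r a where r: "is_fun r (vpow \<mu>)" "Ord a" "bij_betw (fapp r) (elts (vpow \<mu>)) (elts a)"
    by (rule linear_rank[OF lin]) blast
  then show ?thesis unfolding eqpoll_iff by blast
qed

definition pw :: 'a where
  "pw = vcard (vpow \<mu>)"

lemma Ord_pw: "Ord pw" and eqpoll_pw: "eqpoll (vpow \<mu>) pw" and pw_initial: "b \<in> elts pw \<Longrightarrow> \<not> eqpoll pw b"
proof -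
  obtain a where a: "Ord a" "eqpoll (vpow \<mu>) a" using vpow_mu_Ord by blast
  show "Ord pw" "eqpoll (vpow \<mu>) pw" "b \<in> elts pw \<Longrightarrow> \<not> eqpoll pw b"
    unfolding pw_def using vcard_props[OF a] by blast+
qed

definition ix :: 'a where
  "ix = (SOME f. is_fun f (vpow \<mu>) \<and> bij_betw (fapp f) (elts (vpow \<mu>)) (elts pw))"

lemma ix_bij: "bij_betw (fapp ix) (elts (vpow \<mu>)) (elts pw)"
  using someI_ex[OF eqpoll_pw[unfolded eqpoll_iff]] unfolding ix_def by blast

lemma ix_pw: "elts X \<subseteq> elts \<mu> \<Longrightarrow> ix \<cdot> X \<in> elts pw"
  by (rule bij_betw_apply[OF ix_bij]) simp

definition en :: 'a where
  "en = (SOME f. \<forall>i\<in>elts pw. elts (f \<cdot> i) \<subseteq> elts \<mu> \<and> ix \<cdot> (f \<cdot> i) = i)"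

lemma en_props: "i \<in> elts pw \<Longrightarrow> elts (en \<cdot> i) \<subseteq> elts \<mu>" "i \<in> elts pw \<Longrightarrow> ix \<cdot> (en \<cdot> i) = i"
proof -
  have d: "dft (\<lambda>v. ix \<cdot> v 0)" by (intro dfn_intros)
  obtain G where G: "dft (\<lambda>v. G (v 0))" "bij_betw G (elts pw) (elts (vpow \<mu>))" "\<And>y. y \<in> elts pw \<Longrightarrow> ix \<cdot> G y = y"
    using bij_inverse[OF d ix_bij] by metis
  have "elts (lam pw G \<cdot> i) \<subseteq> elts \<mu> \<and> ix \<cdot> (lam pw G \<cdot> i) = i" if i: "i \<in> elts pw" for i
    unfolding lam_app[OF G(1) i] using bij_betw_apply[OF G(2) i] G(3)[OF i] by simp
  then have "\<exists>f. \<forall>i\<in>elts pw. elts (f \<cdot> i) \<subseteq> elts \<mu> \<and> ix \<cdot> (f \<cdot> i) = i" by blast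
  from someI_ex[OF this] have "\<forall>i\<in>elts pw. elts (en \<cdot> i) \<subseteq> elts \<mu> \<and> ix \<cdot> (en \<cdot> i) = i" unfolding en_def .
  then show "i \<in> elts pw \<Longrightarrow> elts (en \<cdot> i) \<subseteq> elts \<mu>" "i \<in> elts pw \<Longrightarrow> ix \<cdot> (en \<cdot> i) = i" by blast+
qed

lemma en_ix: "elts X \<subseteq> elts \<mu> \<Longrightarrow> en \<cdot> (ix \<cdot> X) = X"
proof -
  assume X: "elts X \<subseteq> elts \<mu>"
  have "ix \<cdot> (en \<cdot> (ix \<cdot> X)) = ix \<cdot> X" by (rule en_props(2)[OF ix_pw[OF X]])
  then show ?thesis by (rule inj_onD[OF bij_betw_imp_inj_on[OF ix_bij]]) (use X en_props(1)[OF ix_pw[OF X]] in simp_all)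
qed

lemma mu_pw: "\<mu> \<in> elts pw"
proof -
  have "\<not> elts pw \<subseteq> elts \<mu>"
  proof
    assume s: "elts pw \<subseteq> elts \<mu>"
    have "dft (\<lambda>v. ix \<cdot> v 0)" by (intro dfn_intros)
    then have "\<not> inj_on (fapp ix) (elts (vpow \<mu>))" by (rule cantor) (use ix_pw s in blast)
    then show False using bij_betw_imp_inj_on[OF ix_bij] by blast
  qed
  then show ?thesis using Ord_not_subset[OF Ord_pw Ord_mu] by blast
qed

lemma mu_subset_pw: "elts \<mu> \<subseteq> elts pw"
  by (rule Ord_mem_subset[OF Ord_pw mu_pw])

lemma aleph_pw: "aleph pw"
  unfolding aleph_def using Ord_pw pw_initial omega_subset_mu mu_subset_pw by blast

section \<open>Choice of subsets of \<mu> and of \<mu>-sequences\<close>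

definition sq :: 'a where
  "sq = (SOME q. square_inj q \<mu>)"

lemma sq: "square_inj sq \<mu>"
  unfolding sq_def by (rule someI_ex[OF square_ex[OF Ord_mu omega_subset_mu]])

text \<open>The least index in the enumeration \<open>en\<close> of all subsets of \<mu> selects a
  witness definably.\<close>

lemma choice_pow:
  assumes dQ: "dfn (\<lambda>v. Q (v 0) (v 1))" and Q: "\<And>d. d \<in> elts D \<Longrightarrow> \<exists>X. elts X \<subseteq> elts \<mu> \<and> Q d X"
  obtains e where "\<forall>d\<in>elts D. elts (e \<cdot> d) \<subseteq> elts \<mu> \<and> Q d (e \<cdot> d)"
proof -
  have [dfn_intros]: "dft s \<Longrightarrow> dft t \<Longrightarrow> dfn (\<lambda>v. Q (s v) (t v))" for s t by (rule dfn_sub2[of Q, OF dQ])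
  let ?P = "\<lambda>d i. i \<in> elts pw \<and> Q d (en \<cdot> i)"
  have dP: "dfn (\<lambda>v. ?P d (v 0))" for d by (intro dfn_intros)
  let ?F = "\<lambda>d. en \<cdot> least_ord (?P d)"
  have dF: "dft (\<lambda>v. ?F (v 0))" by (intro dfn_intros)
  have "elts (lam D ?F \<cdot> d) \<subseteq> elts \<mu> \<and> Q d (lam D ?F \<cdot> d)" if d: "d \<in> elts D" for d
  proof -
    obtain X where X: "elts X \<subseteq> elts \<mu>" "Q d X" using Q[OF d] by blast
    have "?P d (ix \<cdot> X)" using ix_pw[OF X(1)] X(2) en_ix[OF X(1)] by simp
    from least_ord_ex[OF dP Ord_mem[OF Ord_pw ix_pw[OF X(1)]] this]
    show ?thesis unfolding lam_app[OF dF d] using en_props(1) by blast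
  qed
  then show thesis using that by blast
qed

definition row :: "'a \<Rightarrow> 'a \<Rightarrow> 'a" where
  "row X i = mkset {z. z \<in> elts \<mu> \<and> sq \<cdot> opair i z \<in> elts X}"

lemma dft_row [dfn_intros]: "dft s \<Longrightarrow> dft t \<Longrightarrow> dft (\<lambda>v. row (s v) (t v))"
  by (rule dft_sub2[of row]) (unfold row_def, intro dfn_intros)

lemma elts_row: "elts (row X i) = {z. z \<in> elts \<mu> \<and> sq \<cdot> opair i z \<in> elts X}"
proof -
  have "elts (row X i) = {z \<in> elts \<mu>. sq \<cdot> opair i z \<in> elts X}"
    unfolding row_def by (rule elts_mkset, rule small_sep) (intro dfn_intros)
  then show ?thesis .
qed

text \<open>Via the pairing of \<mu>, one subset codes a \<mu>-sequence of subsets, that is, of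
  ordinals below \<open>pw\<close>. This extends \<open>choice_pow\<close> from subsets to functions
  from \<mu> to \<open>pw\<close>.\<close>

definition sfun :: "'a \<Rightarrow> 'a" where
  "sfun X = lam \<mu> (\<lambda>i. ix \<cdot> row X i)"

lemma dft_sfun [dfn_intros]: "dft s \<Longrightarrow> dft (\<lambda>v. sfun (s v))"
  by (rule dft_sub1[of sfun]) (unfold sfun_def, intro dfn_intros)

lemma sfun_maps: "maps (sfun X) \<mu> pw"
  unfolding sfun_def
proof (rule maps_lam)
  show "dft (\<lambda>v. ix \<cdot> row X (v 0))" by (intro dfn_intros)
  show "ix \<cdot> row X i \<in> elts pw" for i by (rule ix_pw) (auto simp: elts_row)
qed

lemma sfun_ex:
  assumes s: "maps s \<mu> pw"
  shows "\<exists>X. elts X \<subseteq> elts \<mu> \<and> sfun X = s"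
proof -
  have sp: "s \<cdot> i \<in> elts pw" if "i \<in> elts \<mu>" for i by (rule maps_app[OF s that])
  obtain X where X: "elts X = {z \<in> elts \<mu>. \<exists>i\<in>elts \<mu>. \<exists>y\<in>elts (en \<cdot> (s \<cdot> i)). z = sq \<cdot> opair i y}"
    by (rule sep_obtain[of "\<lambda>z. \<exists>i\<in>elts \<mu>. \<exists>y\<in>elts (en \<cdot> (s \<cdot> i)). z = sq \<cdot> opair i y" \<mu>]) (intro dfn_intros)
  have row: "row X i = en \<cdot> (s \<cdot> i)" if i: "i \<in> elts \<mu>" for i
  proof (rule extensionality, rule set_eqI)
    fix y
    show "y \<in> elts (row X i) \<longleftrightarrow> y \<in> elts (en \<cdot> (s \<cdot> i))"
    proof
      assume "y \<in> elts (row X i)"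
      then have y: "y \<in> elts \<mu>" "sq \<cdot> opair i y \<in> elts X" by (simp_all add: elts_row)
      then obtain j z where j: "j \<in> elts \<mu>" "z \<in> elts (en \<cdot> (s \<cdot> j))" "sq \<cdot> opair i y = sq \<cdot> opair j z"
        unfolding X by blast
      have "z \<in> elts \<mu>" using en_props(1)[OF sp[OF j(1)]] j(2) by blast
      then have "i = j \<and> y = z" using square_injD(2)[OF sq i y(1) j(1)] j(3) by blast
      then show "y \<in> elts (en \<cdot> (s \<cdot> i))" using j(2) by simp
    next
      assume y: "y \<in> elts (en \<cdot> (s \<cdot> i))"
      then have ym: "y \<in> elts \<mu>" using en_props(1)[OF sp[OF i]] by blast
      have "sq \<cdot> opair i y \<in> elts X" unfolding X using square_injD(1)[OF sq i ym] i y by blast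
      then show "y \<in> elts (row X i)" using ym by (simp add: elts_row)
    qed
  qed
  have d: "dft (\<lambda>v. ix \<cdot> row X (v 0))" by (intro dfn_intros)
  have "sfun X = s"
  proof (rule is_fun_ext)
    show "is_fun (sfun X) \<mu>" "is_fun s \<mu>" using sfun_maps s by (simp_all add: maps_iff)
    show "sfun X \<cdot> i = s \<cdot> i" if i: "i \<in> elts \<mu>" for i
      unfolding sfun_def lam_app[OF d i] row[OF i] by (rule en_props(2)[OF sp[OF i]])
  qed
  moreover have "elts X \<subseteq> elts \<mu>" unfolding X by blast
  ultimately show ?thesis by blast
qed

lemma choice_fun:
  assumes dQ: "dfn (\<lambda>v. Q (v 0) (v 1))" and Q: "\<And>d. d \<in> elts D \<Longrightarrow> \<exists>s. maps s \<mu> pw \<and> Q d s"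
  obtains e where "\<forall>d\<in>elts D. maps (e \<cdot> d) \<mu> pw \<and> Q d (e \<cdot> d)"
proof -
  have dQ' [dfn_intros]: "dft s \<Longrightarrow> dft t \<Longrightarrow> dfn (\<lambda>v. Q (s v) (t v))" for s t by (rule dfn_sub2[of Q, OF dQ])
  have d: "dfn (\<lambda>v. Q (v 0) (sfun (v 1)))" by (intro dfn_intros)
  obtain e where e: "\<forall>d\<in>elts D. elts (e \<cdot> d) \<subseteq> elts \<mu> \<and> Q d (sfun (e \<cdot> d))"
  proof (rule choice_pow[of "\<lambda>d X. Q d (sfun X)", OF d])
    fix d assume "d \<in> elts D"
    then obtain s where s: "maps s \<mu> pw" "Q d s" using Q by blast
    obtain X where "elts X \<subseteq> elts \<mu>" "sfun X = s" using sfun_ex[OF s(1)] by blast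
    then show "\<exists>X. elts X \<subseteq> elts \<mu> \<and> Q d (sfun X)" using s(2) by blast
  qed
  have dl: "dft (\<lambda>v. sfun (e \<cdot> v 0))" by (intro dfn_intros)
  have "maps (lam D (\<lambda>d. sfun (e \<cdot> d)) \<cdot> d) \<mu> pw \<and> Q d (lam D (\<lambda>d. sfun (e \<cdot> d)) \<cdot> d)" if "d \<in> elts D" for d
    unfolding lam_app[OF dl that] using sfun_maps e that by blast
  then show thesis using that by blast
qed

section \<open>The successor, cofinal sequences and measurability\<close>

lemma csucc_props: "aleph (csucc \<mu>)" "\<mu> \<in> elts (csucc \<mu>)" "elts (csucc \<mu>) \<subseteq> elts pw"
  "aleph k \<Longrightarrow> \<mu> \<in> elts k \<Longrightarrow> k \<notin> elts (csucc \<mu>)"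
proof -
  let ?P = "\<lambda>a. aleph a \<and> \<mu> \<in> elts a"
  have d: "dfn (\<lambda>v. ?P (v 0))" by (intro dfn_intros)
  have P: "?P pw" using aleph_pw mu_pw by blast
  show "aleph (csucc \<mu>)" "\<mu> \<in> elts (csucc \<mu>)" "aleph k \<Longrightarrow> \<mu> \<in> elts k \<Longrightarrow> k \<notin> elts (csucc \<mu>)"
    using least_ord_ex[OF d Ord_pw P] unfolding csucc_def by blast+
  show "elts (csucc \<mu>) \<subseteq> elts pw" using least_ord_le[OF d Ord_pw P] unfolding csucc_def .
qed

lemma below_csucc_surj:
  assumes b: "b \<in> elts (csucc \<mu>)" and ne: "b \<noteq> vempty"
  shows "\<exists>s. maps s \<mu> pw \<and> (\<forall>i\<in>elts \<mu>. s \<cdot> i \<in> elts b) \<and> (\<forall>z\<in>elts b. \<exists>i\<in>elts \<mu>. s \<cdot> i = z)"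
proof -
  note cO = aleph_Ord[OF csucc_props(1)]
  have bO: "Ord b" by (rule Ord_mem[OF cO b])
  let ?k = "vcard b"
  note V = vcard_subset[OF bO subset_refl]
  have kc: "?k \<in> elts (csucc \<mu>)" by (rule Ord_subset_mem[OF cO V(1,3) b])
  have km: "elts ?k \<subseteq> elts \<mu>"
  proof (cases "elts omega \<subseteq> elts ?k")
    case True
    then have "aleph ?k" unfolding aleph_def using V(1,4) by blast
    then have "\<mu> \<notin> elts ?k" using csucc_props(4) kc by blast
    then show ?thesis using Ord_not_mem[OF Ord_mu V(1)] by blast
  next
    case False
    then have "?k \<in> elts omega" using Ord_not_subset[OF Ord_omega V(1)] by blast
    then have "?k \<in> elts \<mu>" using omega_subset_mu by blast
    then show ?thesis by (rule Ord_mem_subset[OF Ord_mu])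
  qed
  obtain g where g: "bij_betw (fapp g) (elts ?k) (elts b)" by (rule eqpollE[OF eqpoll_sym[OF V(2)]])
  have zb: "vempty \<in> elts b" using Ord_linear[OF Ord_vempty bO] ne by auto
  let ?F = "\<lambda>i. if i \<in> elts ?k then g \<cdot> i else vempty"
  have dF: "dft (\<lambda>v. ?F (v 0))" by (intro dfn_intros)
  have Fb: "?F i \<in> elts b" for i using bij_betw_apply[OF g] zb by simp
  have bp: "elts b \<subseteq> elts pw" using Ord_mem_subset[OF cO b] csucc_props(3) by blast
  have "maps (lam \<mu> ?F) \<mu> pw" using Fb bp by (intro maps_lam[OF dF]) blast
  moreover have "\<forall>i\<in>elts \<mu>. lam \<mu> ?F \<cdot> i \<in> elts b" using Fb lam_app[OF dF] by auto
  moreover have "\<exists>i\<in>elts \<mu>. lam \<mu> ?F \<cdot> i = z" if z: "z \<in> elts b" for z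
  proof -
    have "z \<in> fapp g ` elts ?k" using bij_betw_imp_surj_on[OF g] z by simp
    then obtain i where i: "z = g \<cdot> i" "i \<in> elts ?k" by (rule imageE)
    then have im: "i \<in> elts \<mu>" using km by blast
    have "lam \<mu> ?F \<cdot> i = z" unfolding lam_app[OF dF im] using i by simp
    then show ?thesis using im by blast
  qed
  ultimately show ?thesis by blast
qed

text \<open>Surjections from \<mu> onto all nonzero ordinals below the successor are chosen at once.
  A cofinal set of size at most \<mu> would then map \<mu> x \<mu> onto the successor, and least
  codes of preimages would inject it into \<mu>.\<close>

lemma csucc_Reg: "Reg (csucc \<mu>)"
proof -
  let ?m = "csucc \<mu>" and ?a = "cf (csucc \<mu>)"
  note cO = aleph_Ord[OF csucc_props(1)]
  have Lm: "Limit ?m" by (rule initial_Limit[OF csucc_props(1)])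
  let ?Q = "\<lambda>b s. (\<forall>i\<in>elts \<mu>. s \<cdot> i \<in> elts b) \<and> (\<forall>z\<in>elts b. \<exists>i\<in>elts \<mu>. s \<cdot> i = z)"
  have dQ: "dfn (\<lambda>v. ?Q (v 0) (v 1))" by (intro dfn_intros)
  \<comment> \<open>Zero is removed because \<mu> does not map onto it.\<close>
  let ?D = "vdiff ?m (vsucc vempty)"
  have D: "elts ?D = {b \<in> elts ?m. b \<noteq> vempty}" by auto
  obtain e where e: "\<forall>d\<in>elts ?D. maps (e \<cdot> d) \<mu> pw \<and> ?Q d (e \<cdot> d)"
    by (rule choice_fun[of ?Q ?D, OF dQ]) (use below_csucc_surj D in blast)+
  have "?a = ?m"
  proof (rule ccontr)
    assume "?a \<noteq> ?m"
    then have am: "?a \<in> elts ?m" using cf_props(3)[OF cO] Ord_subset_iff[OF cf_props(1)[OF cO] cO] by blast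
    have "?a \<noteq> vempty" using vempty_in_Limit[OF cf_Limit[OF Lm]] by auto
    then have "?a \<in> elts ?D" unfolding D using am by blast
    then have t: "\<forall>z\<in>elts ?a. \<exists>i\<in>elts \<mu>. e \<cdot> ?a \<cdot> i = z" "\<forall>i\<in>elts \<mu>. e \<cdot> ?a \<cdot> i \<in> elts ?a" using e by blast+
    let ?t = "e \<cdot> ?a"
    obtain h where h: "\<forall>i\<in>elts ?a. h \<cdot> i \<in> elts ?m" "\<forall>b\<in>elts ?m. \<exists>i\<in>elts ?a. elts b \<subseteq> elts (h \<cdot> i)"
      by (rule cf_enum[OF cO]) blast
    let ?P = "\<lambda>x c. c \<in> elts \<mu> \<and> (\<exists>i\<in>elts \<mu>. \<exists>j\<in>elts \<mu>. c = sq \<cdot> opair i j \<and> e \<cdot> (h \<cdot> (?t \<cdot> i)) \<cdot> j = x)"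
    have dP: "dfn (\<lambda>v. ?P x (v 0))" for x by (intro dfn_intros)
    have P: "?P x (least_ord (?P x))" if x: "x \<in> elts ?m" for x
    proof -
      have "vsucc x \<in> elts ?m" using Lm x unfolding Limit_def by blast
      then obtain i' where i': "i' \<in> elts ?a" "elts (vsucc x) \<subseteq> elts (h \<cdot> i')" using h(2) by blast
      obtain i where i: "i \<in> elts \<mu>" "?t \<cdot> i = i'" using t(1) i'(1) by blast
      have xh: "x \<in> elts (h \<cdot> i')" using i'(2) by auto
      have "h \<cdot> i' \<in> elts ?D" unfolding D using h(1) i'(1) xh by auto
      then obtain j where j: "j \<in> elts \<mu>" "e \<cdot> (h \<cdot> i') \<cdot> j = x" using e xh by blast
      have "?P x (sq \<cdot> opair i j)" using square_injD(1)[OF sq i(1) j(1)] i j by blast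
      from least_ord_ex[OF dP Ord_mem[OF Ord_mu conjunct1[OF this]] this] show ?thesis by (rule conjunct1[OF conjunct2])
    qed
    have "\<not> inj_on (\<lambda>x. least_ord (?P x)) (elts ?m)"
    proof (rule aleph_no_inj[OF csucc_props(1,2)])
      show "dft (\<lambda>v. least_ord (?P (v 0)))" by (intro dfn_intros)
      show "least_ord (?P x) \<in> elts \<mu>" if "x \<in> elts ?m" for x by (rule conjunct1[OF P[OF that]])
    qed
    moreover have "inj_on (\<lambda>x. least_ord (?P x)) (elts ?m)"
    proof (rule inj_onI)
      fix x y assume x: "x \<in> elts ?m" and y: "y \<in> elts ?m" and eq: "least_ord (?P x) = least_ord (?P y)"
      obtain i j where ij: "i \<in> elts \<mu>" "j \<in> elts \<mu>" "least_ord (?P x) = sq \<cdot> opair i j" "e \<cdot> (h \<cdot> (?t \<cdot> i)) \<cdot> j = x"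
        using conjunct2[OF P[OF x]] by (elim bexE conjE)
      obtain i' j' where ij': "i' \<in> elts \<mu>" "j' \<in> elts \<mu>" "least_ord (?P y) = sq \<cdot> opair i' j'" "e \<cdot> (h \<cdot> (?t \<cdot> i')) \<cdot> j' = y"
        using conjunct2[OF P[OF y]] by (elim bexE conjE)
      have "sq \<cdot> opair i j = sq \<cdot> opair i' j'" using eq unfolding ij(3) ij'(3) .
      then have "i = i' \<and> j = j'" using square_injD(2)[OF sq ij(1,2) ij'(1,2)] by blast
      then show "x = y" using ij(4) ij'(4) by simp
    qed
    ultimately show False by blast
  qed
  then show ?thesis unfolding Reg_def using csucc_props(1) by blast
qed

text \<open>A cofinal set of type cf \<open>d\<close>, if this is at most \<mu>, is the range of a
  function from \<mu> to \<open>pw\<close>. So \<open>choice_fun\<close> selects such sets for all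
  these \<open>d\<close> simultaneously.\<close>

lemma short_cofinal:
  obtains e where "\<forall>d\<in>elts pw. Limit d \<longrightarrow> elts (cf d) \<subseteq> elts \<mu> \<longrightarrow> unbounded_in (e \<cdot> d) d \<and> otp (e \<cdot> d) = cf d"
proof -
  let ?rng = "\<lambda>s. mkset {z. \<exists>i\<in>elts \<mu>. z = s \<cdot> i}"
  let ?Q = "\<lambda>d s. unbounded_in (?rng s) d \<and> otp (?rng s) = cf d"
  have dQ: "dfn (\<lambda>v. ?Q (v 0) (v 1))" by (intro dfn_intros)
  obtain D where D: "elts D = {d \<in> elts pw. Limit d \<and> elts (cf d) \<subseteq> elts \<mu>}"
    by (rule sep_obtain[of "\<lambda>d. Limit d \<and> elts (cf d) \<subseteq> elts \<mu>" pw]) (intro dfn_intros)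
  obtain e where e: "\<forall>d\<in>elts D. maps (e \<cdot> d) \<mu> pw \<and> ?Q d (e \<cdot> d)"
  proof (rule choice_fun[of ?Q D, OF dQ])
    fix d assume "d \<in> elts D"
    then have d: "d \<in> elts pw" "Limit d" "elts (cf d) \<subseteq> elts \<mu>" unfolding D by blast+
    have dO: "Ord d" by (rule Limit_Ord[OF d(2)])
    obtain x where x: "unbounded_in x d" "otp x = cf d" using cf_props(2)[OF dO] by blast
    have xd: "elts x \<subseteq> elts d" using x(1) unfolding unbounded_in_def by blast
    have xO: "Ord y" if "y \<in> elts x" for y using xd that Ord_mem[OF dO] by blast
    obtain h where "ord_iso h (otp x) x" using otp_exists[OF xO] by blast
    then have h: "ord_iso h (cf d) x" unfolding x(2) .
    have z: "vempty \<in> elts (cf d)" by (rule vempty_in_Limit[OF cf_Limit[OF d(2)]])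
    let ?F = "\<lambda>i. if i \<in> elts (cf d) then h \<cdot> i else h \<cdot> vempty"
    have dF: "dft (\<lambda>v. ?F (v 0))" by (intro dfn_intros)
    have Fx: "?F i \<in> elts x" for i using ord_isoD(1)[OF h] z by simp
    have dp: "elts d \<subseteq> elts pw" by (rule Ord_mem_subset[OF Ord_pw d(1)])
    have m: "maps (lam \<mu> ?F) \<mu> pw" using Fx xd dp by (intro maps_lam[OF dF]) blast
    have "{z. \<exists>i\<in>elts \<mu>. z = lam \<mu> ?F \<cdot> i} = elts x"
    proof (intro set_eqI iffI)
      fix y assume "y \<in> {z. \<exists>i\<in>elts \<mu>. z = lam \<mu> ?F \<cdot> i}"
      then obtain i where i: "i \<in> elts \<mu>" "y = lam \<mu> ?F \<cdot> i" by blast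
      show "y \<in> elts x" unfolding i(2) lam_app[OF dF i(1)] by (rule Fx)
    next
      fix y assume "y \<in> elts x"
      then obtain i where i: "i \<in> elts (cf d)" "h \<cdot> i = y" using ord_isoD(2)[OF h] by blast
      then have im: "i \<in> elts \<mu>" using d(3) by blast
      have "y = lam \<mu> ?F \<cdot> i" unfolding lam_app[OF dF im] using i by simp
      then show "y \<in> {z. \<exists>i\<in>elts \<mu>. z = lam \<mu> ?F \<cdot> i}" using im by blast
    qed
    then have "?rng (lam \<mu> ?F) = x" by simp
    then have "?Q d (lam \<mu> ?F)" using x by simp
    then show "\<exists>s. maps s \<mu> pw \<and> ?Q d s" using m by blast
  qed
  let ?E = "lam pw (\<lambda>d. ?rng (e \<cdot> d))"
  have dE: "dft (\<lambda>v. ?rng (e \<cdot> v 0))" by (intro dfn_intros)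
  have "unbounded_in (?E \<cdot> d) d \<and> otp (?E \<cdot> d) = cf d" if d: "d \<in> elts pw" "Limit d" "elts (cf d) \<subseteq> elts \<mu>" for d
  proof -
    have "d \<in> elts D" unfolding D using d by blast
    then show ?thesis unfolding lam_app[OF dE d(1)] using e by blast
  qed
  then show thesis using that by blast
qed

text \<open>A limit of cofinality above \<mu> serves as its own cofinal set. Every other limit gets
  one whose type is its cofinality, a regular aleph.\<close>

lemma otimes_star_pw: "otimes_star pw (\<lambda>\<delta>. \<delta> \<in> elts pw \<and> \<mu> \<in> elts (cf \<delta>))"
  unfolding otimes_star_def
proof -
  obtain e where e: "\<forall>d\<in>elts pw. Limit d \<longrightarrow> elts (cf d) \<subseteq> elts \<mu> \<longrightarrow> unbounded_in (e \<cdot> d) d \<and> otp (e \<cdot> d) = cf d"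
    by (rule short_cofinal)
  let ?F = "\<lambda>d. if elts (cf d) \<subseteq> elts \<mu> then e \<cdot> d else d"
  show "otimes pw (\<lambda>x. (x \<in> elts pw \<and> \<mu> \<in> elts (cf x)) \<or> x \<in> elts pw \<and> Reg x)"
  proof (rule otimesI[of ?F])
    show "dft (\<lambda>v. ?F (v 0))" by (intro dfn_intros)
    fix d assume d: "d \<in> elts pw" "Limit d"
    have dO: "Ord d" by (rule Limit_Ord[OF d(2)])
    have cO: "Ord (cf d)" by (rule cf_props(1)[OF dO])
    show "unbounded_in (?F d) d \<and> ((otp (?F d) \<in> elts pw \<and> \<mu> \<in> elts (cf (otp (?F d)))) \<or> otp (?F d) \<in> elts pw \<and> Reg (otp (?F d)))"
    proof (cases "elts (cf d) \<subseteq> elts \<mu>")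
      case True
      then have "unbounded_in (e \<cdot> d) d" "otp (e \<cdot> d) = cf d" using e d by blast+
      moreover have "cf d \<in> elts pw" by (rule Ord_subset_mem[OF Ord_pw cO True mu_pw])
      ultimately show ?thesis using True cf_Reg[OF d(2)] by simp
    next
      case False
      then have "\<mu> \<in> elts (cf d)" using Ord_not_subset[OF cO Ord_mu] by blast
      then show ?thesis using False d(1) otp_Ord[OF dO] unbounded_in_self by simp
    qed
  qed
qed

text \<open>For each i < \<mu> one side of the question whether i belongs to
  \<open>en \<cdot> j\<close> is in the ultrafilter, and completeness puts the intersection
  \<open>?Y\<close> into it. The answers determine \<open>en \<cdot> j\<close>, hence j, so
  \<open>?Y\<close> is a singleton and the ultrafilter is principal.\<close>

lemma not_measurable:
  assumes l: "aleph l" "\<mu> \<in> elts l" "elts l \<subseteq> elts pw"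
  shows "\<not> measurable l"
proof
  assume "measurable l"
  then obtain D where D: "ultrafilter l D" "\<not> principal l D" "filter_complete l l D" unfolding measurable_def by blast
  have F: "is_filter l D" and u: "\<And>X. elts X \<subseteq> elts l \<Longrightarrow> X \<in> elts D \<or> vdiff l X \<in> elts D"
    using D(1) unfolding ultrafilter_def by simp_all
  have up: "Y \<in> elts D" if "X \<in> elts D" "elts X \<subseteq> elts Y" "elts Y \<subseteq> elts l" for X Y
    using F that unfolding is_filter_def by blast
  have int: "mkset (elts X \<inter> elts Y) \<in> elts D" if "X \<in> elts D" "Y \<in> elts D" for X Y
    using F that unfolding is_filter_def by blast
  have ne: "X \<noteq> vempty" if "X \<in> elts D" for X using F that unfolding is_filter_def by blast
  have sub: "elts X \<subseteq> elts l" if "X \<in> elts D" for X using F that unfolding is_filter_def by auto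
  let ?B = "\<lambda>i. mkset {j. j \<in> elts l \<and> i \<in> elts (en \<cdot> j)}"
  have B: "elts (?B i) = {j. j \<in> elts l \<and> i \<in> elts (en \<cdot> j)}" for i
    by (rule elts_mkset, rule small_Collect[of _ l]) (intro dfn_intros, simp)
  let ?s = "\<lambda>i. if ?B i \<in> elts D then ?B i else vdiff l (?B i)"
  have ds: "dft (\<lambda>v. ?s (v 0))" by (intro dfn_intros)
  have sD: "?s i \<in> elts D" for i using u[of "?B i"] B by auto
  have m: "maps (lam \<mu> ?s) \<mu> D" by (rule maps_lam[OF ds sD])
  let ?Y = "mkset {x \<in> elts l. \<forall>i\<in>elts \<mu>. x \<in> elts (app (lam \<mu> ?s) i)}"
  have YD: "?Y \<in> elts D" using D(3) l(2) m unfolding filter_complete_def by blast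
  have as: "app (lam \<mu> ?s) i = ?s i" if "i \<in> elts \<mu>" for i
    using app_eq[OF is_fun_lam[OF ds] that] lam_app[OF ds that] by (rule trans)
  have Y': "?Y = mkset {x \<in> elts l. \<forall>i\<in>elts \<mu>. x \<in> elts (?s i)}"
    by (rule arg_cong[of _ _ mkset]) (use as in auto)
  have Y: "elts ?Y = {x \<in> elts l. \<forall>i\<in>elts \<mu>. x \<in> elts (?s i)}"
    unfolding Y' by (rule elts_mkset, rule small_sep) (intro dfn_intros)
  obtain j where j: "j \<in> elts ?Y" using ne[OF YD] eq_vempty_iff by blast
  have one: "k = j" if k: "k \<in> elts ?Y" for k
  proof -
    have jl: "j \<in> elts pw" and kl: "k \<in> elts pw" using j k l(3) unfolding Y by blast+
    have "i \<in> elts (en \<cdot> j) \<longleftrightarrow> i \<in> elts (en \<cdot> k)" if i: "i \<in> elts \<mu>" for i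
    proof -
      have "j \<in> elts (?s i)" "k \<in> elts (?s i)" "j \<in> elts l" "k \<in> elts l" using j k i unfolding Y by blast+
      then show ?thesis using B[of i] by (cases "?B i \<in> elts D") auto
    qed
    then have "elts (en \<cdot> k) = elts (en \<cdot> j)" using en_props(1)[OF jl] en_props(1)[OF kl] by blast
    then have "en \<cdot> k = en \<cdot> j" by (rule extensionality)
    then have "ix \<cdot> (en \<cdot> k) = ix \<cdot> (en \<cdot> j)" by simp
    then show ?thesis unfolding en_props(2)[OF jl] en_props(2)[OF kl] .
  qed
  have "elts D = {X \<in> elts (vpow l). elts ?Y \<subseteq> elts X}"
  proof (intro set_eqI iffI)
    fix X assume X: "X \<in> elts D"
    have sm: "small (elts X \<inter> elts ?Y)" by (rule small_subset[of "elts X"]) (simp, unfold Int_iff, intro dfn_intros, simp)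
    have "elts (mkset (elts X \<inter> elts ?Y)) \<noteq> {}" using ne[OF int[OF X YD]] eq_vempty_iff by blast
    then obtain k where "k \<in> elts X" "k \<in> elts ?Y" unfolding elts_mkset[OF sm] by blast
    then have "j \<in> elts X" using one by blast
    then have "elts ?Y \<subseteq> elts X" using one by blast
    then show "X \<in> {X \<in> elts (vpow l). elts ?Y \<subseteq> elts X}" using sub[OF X] by simp
  next
    fix X assume "X \<in> {X \<in> elts (vpow l). elts ?Y \<subseteq> elts X}"
    then show "X \<in> elts D" using up[OF YD] by simp
  qed
  then have "principal l D" unfolding principal_def using sub[OF YD] by (intro bexI[of _ ?Y]) simp_all
  then show False using D(2) by blast
qed

end

section \<open>Cofinal sequences from the rank\<close>

text \<open>Uniqueness allows the enumeration of a set of ordinals to be named by a description,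
  which keeps it definable.\<close>

lemma ord_iso_fun_unique:
  assumes h: "ord_iso h a x" and g: "ord_iso g a x" and a: "Ord a" and x: "\<And>y. y \<in> elts x \<Longrightarrow> Ord (y::'a::zf)"
  shows "h = g"
proof (rule is_fun_ext[OF ord_isoD(5)[OF h] ord_isoD(5)[OF g]])
  fix i assume i: "i \<in> elts a"
  have not_less: "h \<cdot> i \<notin> elts (g \<cdot> i)"
    if i: "i \<in> elts a" and h: "ord_iso h a x" and g: "ord_iso g a x" and eq: "\<And>j. j \<in> elts i \<Longrightarrow> h \<cdot> j = g \<cdot> j" for h g i
  proof
    assume l: "h \<cdot> i \<in> elts (g \<cdot> i)"
    obtain j where j: "j \<in> elts a" "g \<cdot> j = h \<cdot> i" using ord_isoD(2)[OF g ord_isoD(1)[OF h i]] by blast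
    have ji: "j \<in> elts i" using ord_isoD(3)[OF g j(1) i] l unfolding j(2) by blast
    have "h \<cdot> j = h \<cdot> i" unfolding eq[OF ji] by (rule j(2))
    then have "j = i" using ord_isoD(4)[OF h j(1) i] by blast
    then show False using ji mem_irrefl[of i] by simp
  qed
  have "i \<in> elts a \<longrightarrow> h \<cdot> i = g \<cdot> i"
  proof (rule Ord_induct[where P = "\<lambda>i. i \<in> elts a \<longrightarrow> h \<cdot> i = g \<cdot> i", OF _ Ord_mem[OF a i]])
    show "dfn (\<lambda>v. v 0 \<in> elts a \<longrightarrow> h \<cdot> v 0 = g \<cdot> v 0)" by (intro dfn_intros)
    fix i assume IH: "\<And>j. j \<in> elts i \<Longrightarrow> j \<in> elts a \<longrightarrow> h \<cdot> j = g \<cdot> j"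
    show "i \<in> elts a \<longrightarrow> h \<cdot> i = g \<cdot> i"
    proof
      assume i: "i \<in> elts a"
      have eq: "h \<cdot> j = g \<cdot> j" if "j \<in> elts i" for j using IH[OF that] Ord_trans[OF a that i] by blast
      have "h \<cdot> i \<notin> elts (g \<cdot> i)" "g \<cdot> i \<notin> elts (h \<cdot> i)"
        using not_less[OF i h g eq] not_less[OF i g h eq[symmetric]] by blast+
      then show "h \<cdot> i = g \<cdot> i" using Ord_linear[OF x[OF ord_isoD(1)[OF h i]] x[OF ord_isoD(1)[OF g i]]] by blast
    qed
  qed
  then show "h \<cdot> i = g \<cdot> i" using i by blast
qed

text \<open>The side conditions belong to the description because \<open>dft_The\<close> asks for
  uniqueness at every argument, including those that are no sets of ordinals.\<close>

definition enum :: "'a::zf \<Rightarrow> 'a" where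
  "enum x = (THE h. (\<forall>y\<in>elts x. Ord y) \<and> Ord (otp x) \<and> ord_iso h (otp x) x)"

lemma dft_enum [dfn_intros]: "dft s \<Longrightarrow> dft (\<lambda>v. enum (s v :: 'a::zf))"
proof (rule dft_sub1[of enum], unfold enum_def, rule dft_The)
  show "dfn (\<lambda>v. (\<forall>y\<in>elts (v (Suc 0)). Ord y) \<and> Ord (otp (v (Suc 0))) \<and> ord_iso (v 0) (otp (v (Suc 0))) (v (Suc 0) :: 'a))"
    by (intro dfn_intros)
  fix v :: "nat \<Rightarrow> 'a" and h g
  assume h: "(\<forall>y\<in>elts (v 0). Ord y) \<and> Ord (otp (v 0)) \<and> ord_iso h (otp (v 0)) (v 0)"
    and g: "(\<forall>y\<in>elts (v 0). Ord y) \<and> Ord (otp (v 0)) \<and> ord_iso g (otp (v 0)) (v 0)"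
  show "h = g" by (rule ord_iso_fun_unique[of h "otp (v 0)" "v 0" g]) (use h g in blast)+
qed

lemma enum:
  assumes "\<And>y. y \<in> elts x \<Longrightarrow> Ord (y::'a::zf)"
  shows "Ord (otp x)" "ord_iso (enum x) (otp x) x"
proof -
  obtain h where h: "Ord (otp x)" "ord_iso h (otp x) x" using otp_exists[OF assms] by blast
  have "enum x = h" unfolding enum_def
  proof (rule the_equality)
    show "(\<forall>y\<in>elts x. Ord y) \<and> Ord (otp x) \<and> ord_iso h (otp x) x" using assms h by blast
    show "g = h" if "(\<forall>y\<in>elts x. Ord y) \<and> Ord (otp x) \<and> ord_iso g (otp x) x" for g
      by (rule ord_iso_fun_unique[OF _ h(2,1) assms]) (use that in blast)+
  qed
  then show "Ord (otp x)" "ord_iso (enum x) (otp x) x" using h by simp_all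
qed

context strong_singular
begin

text \<open>Enumerations of all subsets of \<mu> chosen simultaneously, by \<open>choice_fun\<close>
  on the power set. Through them any row of values can be compared with its cardinal.\<close>

definition piF :: 'a where
  "piF = (SOME e. \<forall>x\<in>elts (vpow \<mu>). maps (e \<cdot> x) \<mu> pw \<and> bij_betw (fapp (e \<cdot> x)) (elts x) (elts (vcard x)))"

definition pi :: "'a \<Rightarrow> 'a \<Rightarrow> 'a" where
  "pi x z = piF \<cdot> x \<cdot> z"

lemma dft_pi [dfn_intros]: "dft s \<Longrightarrow> dft t \<Longrightarrow> dft (\<lambda>v. pi (s v) (t v))"
  unfolding pi_def by (intro dfn_intros)

lemma pi_bij: "elts x \<subseteq> elts \<mu> \<Longrightarrow> bij_betw (pi x) (elts x) (elts (vcard x))"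
proof -
  let ?Q = "\<lambda>x s. bij_betw (fapp s) (elts x) (elts (vcard x))"
  have dQ: "dfn (\<lambda>v. ?Q (v 0) (v 1))" by (intro dfn_intros)
  obtain e where e: "\<forall>x\<in>elts (vpow \<mu>). maps (e \<cdot> x) \<mu> pw \<and> ?Q x (e \<cdot> x)"
  proof (rule choice_fun[of ?Q "vpow \<mu>", OF dQ])
    fix x assume "x \<in> elts (vpow \<mu>)"
    then have x: "elts x \<subseteq> elts \<mu>" by simp
    note V = vcard_subset[OF Ord_mu x]
    obtain f where f: "bij_betw (fapp f) (elts x) (elts (vcard x))" using V(2) by (rule eqpollE)
    let ?F = "\<lambda>z. if z \<in> elts x then f \<cdot> z else vempty"
    have dF: "dft (\<lambda>v. ?F (v 0))" by (intro dfn_intros)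
    have z: "vempty \<in> elts pw" using mu_subset_pw vempty_in_Limit[OF Limit_mu] by blast
    have "?F z \<in> elts pw" for z using z V(3) mu_subset_pw bij_betw_apply[OF f, of z] by auto
    then have "maps (lam \<mu> ?F) \<mu> pw" by (intro maps_lam[OF dF])
    moreover have "bij_betw (fapp (lam \<mu> ?F)) (elts x) (elts (vcard x))"
    proof (subst bij_betw_cong[of _ _ "fapp f"])
      show "lam \<mu> ?F \<cdot> z = f \<cdot> z" if z: "z \<in> elts x" for z
      proof -
        have "z \<in> elts \<mu>" using z x by blast
        from lam_app[OF dF this] show ?thesis using z by simp
      qed
    qed (rule f)
    ultimately show "\<exists>s. maps s \<mu> pw \<and> ?Q x s" by blast
  qed
  then have "\<exists>e. \<forall>x\<in>elts (vpow \<mu>). maps (e \<cdot> x) \<mu> pw \<and> ?Q x (e \<cdot> x)" by blast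
  from someI_ex[OF this] have *: "\<forall>x\<in>elts (vpow \<mu>). maps (piF \<cdot> x) \<mu> pw \<and> ?Q x (piF \<cdot> x)" unfolding piF_def .
  assume "elts x \<subseteq> elts \<mu>"
  then have "?Q x (piF \<cdot> x)" using * by simp
  moreover have "pi x = fapp (piF \<cdot> x)" unfolding pi_def by (rule refl)
  ultimately show ?thesis by simp
qed

section \<open>Coding functions restricted to prescribed sets of values\<close>

definition fn :: "'a \<Rightarrow> 'a" where
  "fn j = cfn (en \<cdot> j)"

lemma dft_fn [dfn_intros]: "dft s \<Longrightarrow> dft (\<lambda>v. fn (s v))"
  unfolding fn_def by (intro dfn_intros)

lemma fn_mu: "i \<in> elts \<kappa> \<Longrightarrow> fn j \<cdot> i \<in> elts \<mu>"
  unfolding fn_def by (rule cfn_mu)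

lemma fn_diff:
  assumes "j \<in> elts pw" "k \<in> elts pw" "j \<noteq> k"
  shows "\<exists>b\<in>elts \<kappa>. \<forall>i\<in>elts \<kappa>. elts b \<subseteq> elts i \<longrightarrow> fn j \<cdot> i \<noteq> fn k \<cdot> i"
  unfolding fn_def
proof (rule cfn_diff[OF en_props(1)[OF assms(1)] en_props(1)[OF assms(2)]])
  show "en \<cdot> j \<noteq> en \<cdot> k"
  proof
    assume e: "en \<cdot> j = en \<cdot> k"
    have "ix \<cdot> (en \<cdot> j) = ix \<cdot> (en \<cdot> k)" unfolding e by (rule refl)
    then show False using assms(3) unfolding en_props(2)[OF assms(1)] en_props(2)[OF assms(2)] by blast
  qed
qed

definition trow :: "'a \<Rightarrow> 'a \<Rightarrow> 'a" where
  "trow T i = mkset {x. x \<in> elts \<mu> \<and> opair i x \<in> elts T}"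

lemma elts_trow: "elts (trow T i) = {x. x \<in> elts \<mu> \<and> opair i x \<in> elts T}"
proof -
  have "elts (trow T i) = {x \<in> elts \<mu>. opair i x \<in> elts T}"
    unfolding trow_def by (rule elts_mkset, rule small_sep) (intro dfn_intros)
  then show ?thesis .
qed

lemma dft_trow [dfn_intros]: "dft s \<Longrightarrow> dft t \<Longrightarrow> dft (\<lambda>v. trow (s v) (t v))"
  by (rule dft_sub2[of trow]) (unfold trow_def, intro dfn_intros)

lemma trow_subset: "elts (trow T i) \<subseteq> elts \<mu>"
  by (auto simp: elts_trow)

definition tdom :: "'a \<Rightarrow> 'a" where
  "tdom T = mkset {i. i \<in> elts \<kappa> \<and> trow T i \<noteq> vempty}"

lemma elts_tdom: "elts (tdom T) = {i. i \<in> elts \<kappa> \<and> trow T i \<noteq> vempty}"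
proof -
  have "elts (tdom T) = {i \<in> elts \<kappa>. trow T i \<noteq> vempty}"
    unfolding tdom_def by (rule elts_mkset, rule small_sep) (intro dfn_intros)
  then show ?thesis .
qed

lemma dft_tdom [dfn_intros]: "dft s \<Longrightarrow> dft (\<lambda>v. tdom (s v))"
  by (rule dft_sub1[of tdom]) (unfold tdom_def, intro dfn_intros)

definition cT :: "'a \<Rightarrow> 'a" where
  "cT T = lam \<kappa> (\<lambda>i. vcard (trow T i))"

lemma dft_cT [dfn_intros]: "dft s \<Longrightarrow> dft (\<lambda>v. cT (s v))"
  by (rule dft_sub1[of cT]) (unfold cT_def, intro dfn_intros)

lemma dft_cT_body: "dft (\<lambda>v. vcard (trow T (v 0)))"
  by (intro dfn_intros)

lemma cT_app: "i \<in> elts \<kappa> \<Longrightarrow> cT T \<cdot> i = vcard (trow T i)"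
  unfolding cT_def by (rule lam_app[OF dft_cT_body])

lemma subset_mu_vsucc: "Ord x \<Longrightarrow> elts x \<subseteq> elts \<mu> \<Longrightarrow> x \<in> elts (vsucc \<mu>)"
  using Ord_subset_iff[OF _ Ord_mu, of x] by auto

lemma cT_fns: "cT T \<in> elts fns"
  unfolding cT_def
proof (rule fns_lam[OF dft_cT_body])
  show "vcard (trow T i) \<in> elts (vsucc \<mu>)" for i
    by (rule subset_mu_vsucc[OF vcard_subset(1,3)[OF Ord_mu trow_subset]])
qed

definition nrk :: "'a \<Rightarrow> 'a" where
  "nrk T = rk (tdom T) (cT T)"

lemma dft_nrk [dfn_intros]: "dft s \<Longrightarrow> dft (\<lambda>v. nrk (s v))"
  unfolding nrk_def by (intro dfn_intros)

text \<open>The functions compatible with \<open>T\<close>. An empty row imposes no condition: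
  \<open>T\<close> lives on \<open>tdom T\<close>, and there its rank is taken.\<close>

definition FX :: "'a \<Rightarrow> 'a" where
  "FX T = mkset {j. j \<in> elts pw \<and> (\<forall>i\<in>elts (tdom T). fn j \<cdot> i \<in> elts (trow T i))}"

lemma elts_FX: "elts (FX T) = {j. j \<in> elts pw \<and> (\<forall>i\<in>elts (tdom T). fn j \<cdot> i \<in> elts (trow T i))}"
proof -
  have "elts (FX T) = {j \<in> elts pw. \<forall>i\<in>elts (tdom T). fn j \<cdot> i \<in> elts (trow T i)}"
    unfolding FX_def by (rule elts_mkset, rule small_sep) (intro dfn_intros)
  then show ?thesis .
qed

lemma dft_FX [dfn_intros]: "dft s \<Longrightarrow> dft (\<lambda>v. FX (s v))"
  by (rule dft_sub1[of FX]) (unfold FX_def, intro dfn_intros)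

lemma FX_pw: "j \<in> elts (FX T) \<Longrightarrow> j \<in> elts pw"
  by (simp add: elts_FX)

lemma FX_row: "j \<in> elts (FX T) \<Longrightarrow> i \<in> elts (tdom T) \<Longrightarrow> fn j \<cdot> i \<in> elts (trow T i)"
  by (simp add: elts_FX)

text \<open>\<open>pdS T S h k\<close>: on the set \<open>S\<close>, which computes the rank of \<open>T\<close>, the \<open>k\<close>-th function lies below
  the \<open>h\<close>-th one in the enumerations of the rows of \<open>T\<close>.\<close>

definition pdS :: "'a \<Rightarrow> 'a \<Rightarrow> 'a \<Rightarrow> 'a \<Rightarrow> bool" where
  "pdS T S h k \<longleftrightarrow> elts S \<subseteq> elts (tdom T) \<and> big S \<and> rk S (cT T) = nrk T \<and>
     (\<forall>i\<in>elts S. pi (trow T i) (fn k \<cdot> i) \<in> elts (pi (trow T i) (fn h \<cdot> i)))"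

lemma dfn_pdS [dfn_intros]:
  "dft s \<Longrightarrow> dft t \<Longrightarrow> dft u \<Longrightarrow> dft w \<Longrightarrow> dfn (\<lambda>v. pdS (s v) (t v) (u v) (w v))"
  unfolding pdS_def by (intro dfn_intros dft_shift)

definition cut :: "'a \<Rightarrow> 'a \<Rightarrow> 'a \<Rightarrow> 'a" where
  "cut T S h = mkset {p \<in> elts (vtimes \<kappa> \<mu>). vfst p \<in> elts S \<and> p \<in> elts T \<and>
     pi (trow T (vfst p)) (vsnd p) \<in> elts (pi (trow T (vfst p)) (fn h \<cdot> vfst p))}"

lemma elts_cut: "elts (cut T S h) = {p \<in> elts (vtimes \<kappa> \<mu>). vfst p \<in> elts S \<and> p \<in> elts T \<and>
     pi (trow T (vfst p)) (vsnd p) \<in> elts (pi (trow T (vfst p)) (fn h \<cdot> vfst p))}"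
  unfolding cut_def by (rule elts_mkset, rule small_sep) (intro dfn_intros)

definition valid :: "'a \<Rightarrow> bool" where
  "valid T \<longleftrightarrow> elts T \<subseteq> elts (vtimes \<kappa> \<mu>) \<and> big (tdom T)"

lemma dfn_valid [dfn_intros]: "dft s \<Longrightarrow> dfn (\<lambda>v. valid (s v))"
  unfolding valid_def by (intro dfn_intros)

lemma nrk_Ord: "valid T \<Longrightarrow> Ord (nrk T)"
  unfolding nrk_def valid_def using rk_Ord cT_fns by blast

text \<open>Over \<open>S\<close> a row shrinks to the values enumerated before
  \<open>fn h \<cdot> i\<close>, so its cardinality drops below the old one. Since \<open>S\<close>
  computes the rank of \<open>T\<close>, the new rank is smaller as well.\<close>

lemma cut_props:
  assumes T: "valid T" and h: "h \<in> elts (FX T)" and k: "k \<in> elts (FX T)" and p: "pdS T S h k"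
  shows "valid (cut T S h)" "k \<in> elts (FX (cut T S h))" "nrk (cut T S h) \<in> elts (nrk T)"
proof -
  let ?T = "cut T S h"
  have S: "elts S \<subseteq> elts (tdom T)" "big S" "rk S (cT T) = nrk T"
    and less: "\<And>i. i \<in> elts S \<Longrightarrow> pi (trow T i) (fn k \<cdot> i) \<in> elts (pi (trow T i) (fn h \<cdot> i))"
    using p unfolding pdS_def by blast+
  have Sk: "i \<in> elts \<kappa>" if "i \<in> elts S" for i using S(1) that by (auto simp: elts_tdom)
  have row: "elts (trow ?T i) = {x. i \<in> elts S \<and> x \<in> elts (trow T i) \<and> pi (trow T i) x \<in> elts (pi (trow T i) (fn h \<cdot> i))}" for i
    unfolding elts_trow[of ?T] elts_cut elts_trow[of T i] using Sk by auto
  have kS: "fn k \<cdot> i \<in> elts (trow ?T i)" if i: "i \<in> elts S" for i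
    unfolding row using i FX_row[OF k] S(1) less[OF i] by blast
  have dom: "tdom ?T = S"
  proof (rule extensionality, rule set_eqI)
    fix i
    have "trow ?T i \<noteq> vempty \<longleftrightarrow> i \<in> elts S" unfolding eq_vempty_iff using kS[of i] row[of i] by blast
    then show "i \<in> elts (tdom ?T) \<longleftrightarrow> i \<in> elts S" unfolding elts_tdom using Sk by blast
  qed
  show "valid ?T" unfolding valid_def dom using S(2) by (auto simp: elts_cut)
  show "k \<in> elts (FX ?T)" unfolding elts_FX dom using FX_pw[OF k] kS by blast
  have "cT ?T \<cdot> i \<in> elts (cT T \<cdot> i)" if i: "i \<in> elts S" for i
  proof -
    let ?x = "trow T i"
    note V = vcard_subset[OF Ord_mu trow_subset[of T i]]
    note b = pi_bij[OF trow_subset[of T i]]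
    have "fn h \<cdot> i \<in> elts ?x" using FX_row[OF h] S(1) i by blast
    then have bh: "pi ?x (fn h \<cdot> i) \<in> elts (vcard ?x)" by (rule bij_betw_apply[OF b])
    have sub: "elts (trow ?T i) \<subseteq> elts ?x" unfolding row by blast
    have "dft (\<lambda>v. pi ?x (v 0))" by (intro dfn_intros)
    then have "elts (vcard (trow ?T i)) \<subseteq> elts (pi ?x (fn h \<cdot> i))"
    proof (rule vcard_le_inj[OF Ord_mem[OF V(1) bh]])
      show "inj_on (pi ?x) (elts (trow ?T i))" by (rule inj_on_subset[OF bij_betw_imp_inj_on[OF b] sub])
    qed (simp add: row)
    then have "vcard (trow ?T i) \<in> elts (vcard ?x)"
      using Ord_subset_mem[OF V(1) vcard_subset(1)[OF Ord_mu trow_subset] _ bh] by blast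
    then show ?thesis unfolding cT_app[OF Sk[OF i]] .
  qed
  then have "evless S (cT ?T) (cT T)" unfolding evless_def using vempty_in_Limit[OF Limit_kappa] by blast
  then show "nrk ?T \<in> elts (nrk T)" unfolding nrk_def[of ?T] dom S(3)[symmetric]
    by (rule rk_less[OF S(2) cT_fns cT_fns])
qed

text \<open>Positions in the enumerations agree only where the two functions do, which happens on a
  bounded set. By \<open>rk_split\<close> one of the two strict comparisons holds on a set that
  computes the rank.\<close>

lemma pdS_total:
  assumes T: "valid T" and j: "j \<in> elts (FX T)" and k: "k \<in> elts (FX T)" and ne: "j \<noteq> k"
  shows "(\<exists>S. pdS T S j k) \<or> (\<exists>S. pdS T S k j)"
proof -
  let ?D = "tdom T" and ?p = "\<lambda>i. pi (trow T i) (fn j \<cdot> i)" and ?q = "\<lambda>i. pi (trow T i) (fn k \<cdot> i)"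
  have D: "big ?D" using T unfolding valid_def by blast
  have Dk: "elts ?D \<subseteq> elts \<kappa>" by (rule big_subset[OF D])
  obtain X where X: "elts X = {i \<in> elts ?D. ?p i \<in> elts (?q i)}"
    by (rule sep_obtain[of "\<lambda>i. ?p i \<in> elts (?q i)" ?D]) (intro dfn_intros)
  obtain Y where Y: "elts Y = {i \<in> elts ?D. ?q i \<in> elts (?p i)}"
    by (rule sep_obtain[of "\<lambda>i. ?q i \<in> elts (?p i)" ?D]) (intro dfn_intros)
  obtain Z where Z: "elts Z = {i \<in> elts ?D. fn j \<cdot> i = fn k \<cdot> i}"
    by (rule sep_obtain[of "\<lambda>i. fn j \<cdot> i = fn k \<cdot> i" ?D]) (intro dfn_intros)
  have un: "elts ?D = elts X \<union> elts (vun Y Z)"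
  proof (rule set_eqI)
    fix i
    have "?p i \<in> elts (?q i) \<or> fn j \<cdot> i = fn k \<cdot> i \<or> ?q i \<in> elts (?p i)" if i: "i \<in> elts ?D"
    proof -
      note b = pi_bij[OF trow_subset[of T i]]
      have V: "Ord (vcard (trow T i))" by (rule vcard_subset(1)[OF Ord_mu trow_subset])
      have jk: "fn j \<cdot> i \<in> elts (trow T i)" "fn k \<cdot> i \<in> elts (trow T i)" using FX_row[OF j i] FX_row[OF k i] by blast+
      have "?p i \<in> elts (?q i) \<or> ?p i = ?q i \<or> ?q i \<in> elts (?p i)"
        by (rule Ord_linear[OF Ord_mem[OF V bij_betw_apply[OF b jk(1)]] Ord_mem[OF V bij_betw_apply[OF b jk(2)]]])
      moreover have "fn j \<cdot> i = fn k \<cdot> i" if "?p i = ?q i"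
        by (rule inj_onD[OF bij_betw_imp_inj_on[OF b] that jk])
      ultimately show ?thesis by argo
    qed
    then show "i \<in> elts ?D \<longleftrightarrow> i \<in> elts X \<union> elts (vun Y Z)" unfolding elts_vun Un_iff X Y Z mem_Collect_eq by argo
  qed
  have nZ: "\<not> big Z"
  proof
    assume "big Z"
    obtain b where b: "b \<in> elts \<kappa>" "\<forall>i\<in>elts \<kappa>. elts b \<subseteq> elts i \<longrightarrow> fn j \<cdot> i \<noteq> fn k \<cdot> i"
      using fn_diff[OF FX_pw[OF j] FX_pw[OF k] ne] by blast
    obtain i where "i \<in> elts Z" "elts b \<subseteq> elts i" using bigD[OF \<open>big Z\<close> b(1)] by blast
    then show False using b(2) Dk unfolding Z by blast
  qed
  consider "big X" "rk X (cT T) = nrk T" | "big (vun Y Z)" "rk (vun Y Z) (cT T) = nrk T"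
    using rk_split[OF D un cT_fns] unfolding nrk_def by blast
  then show ?thesis
  proof cases
    case 1
    then have "pdS T X k j" unfolding pdS_def X by blast
    then show ?thesis by blast
  next
    case 2
    then have "big Y \<and> rk Y (cT T) = nrk T" using rk_split[OF 2(1) elts_vun cT_fns[of T], unfolded 2(2)] nZ by blast
    then have "pdS T Y j k" unfolding pdS_def Y by blast
    then show ?thesis by blast
  qed
qed

text \<open>Going through the compatible indices in increasing order, \<open>j\<close> is taken
  unless it lies below an earlier member. The condition determines \<open>H\<close>, so that a
  description can name it definably.\<close>

definition greedy :: "'a \<Rightarrow> 'a \<Rightarrow> bool" where
  "greedy T H \<longleftrightarrow> elts H \<subseteq> elts (FX T) \<and>
     (\<forall>j\<in>elts (FX T). j \<in> elts H \<longleftrightarrow> \<not> (\<exists>k\<in>elts H. k \<in> elts j \<and> (\<exists>S. pdS T S k j)))"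

lemma FX_Ord: "j \<in> elts (FX T) \<Longrightarrow> Ord j"
  using FX_pw Ord_mem[OF Ord_pw] by blast

lemma greedy_unique:
  assumes H: "greedy T H" and K: "greedy T K"
  shows "H = K"
proof -
  have "j \<in> elts (FX T) \<longrightarrow> (j \<in> elts H \<longleftrightarrow> j \<in> elts K)" if j: "Ord j" for j
  proof (rule Ord_induct[where P = "\<lambda>j. j \<in> elts (FX T) \<longrightarrow> (j \<in> elts H \<longleftrightarrow> j \<in> elts K)", OF _ j])
    show "dfn (\<lambda>v. v 0 \<in> elts (FX T) \<longrightarrow> (v 0 \<in> elts H \<longleftrightarrow> v 0 \<in> elts K))" by (intro dfn_intros)
    fix j assume "\<And>k. k \<in> elts j \<Longrightarrow> k \<in> elts (FX T) \<longrightarrow> (k \<in> elts H \<longleftrightarrow> k \<in> elts K)"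
    then have "(\<exists>k\<in>elts H. k \<in> elts j \<and> (\<exists>S. pdS T S k j)) \<longleftrightarrow> (\<exists>k\<in>elts K. k \<in> elts j \<and> (\<exists>S. pdS T S k j))"
      using H K unfolding greedy_def by blast
    then show "j \<in> elts (FX T) \<longrightarrow> (j \<in> elts H \<longleftrightarrow> j \<in> elts K)" using H K unfolding greedy_def by blast
  qed
  then have "elts H = elts K" using H K FX_Ord unfolding greedy_def by blast
  then show ?thesis by (rule extensionality)
qed

lemma greedy_ex: "\<exists>H. greedy T H"
proof -
  interpret wf_order "\<lambda>x y. x \<in> elts y" "FX T" by (rule Ord_wf_order) (rule FX_Ord)
  let ?one = "vsucc vempty :: 'a"
  \<comment> \<open>The recursion builds the characteristic function of \<open>H\<close>, with value
    \<open>?one\<close> for the members taken.\<close>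
  let ?G = "\<lambda>j g. if \<exists>k\<in>elts (seg (\<lambda>x y. x \<in> elts y) (FX T) j). g \<cdot> k = ?one \<and> (\<exists>S. pdS T S k j) then vempty else ?one"
  have dG: "dft (\<lambda>v. ?G (v 0) (v 1))" by (intro dfn_intros)
  obtain f where f: "\<forall>j\<in>elts (FX T). f \<cdot> j = ?G j (lam (seg (\<lambda>x y. x \<in> elts y) (FX T) j) (fapp f))"
    by (rule wf_rec[of ?G, OF dG]) blast
  have ne: "vempty \<noteq> ?one" using eq_vempty_iff[of ?one] by auto
  obtain H where H: "elts H = {j \<in> elts (FX T). f \<cdot> j = ?one}"
    by (rule sep_obtain[of "\<lambda>j. f \<cdot> j = ?one" "FX T"]) (intro dfn_intros)
  have df: "dft (\<lambda>v. f \<cdot> v 0)" by (intro dfn_intros)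
  have "j \<in> elts H \<longleftrightarrow> \<not> (\<exists>k\<in>elts H. k \<in> elts j \<and> (\<exists>S. pdS T S k j))" if j: "j \<in> elts (FX T)" for j
  proof -
    let ?s = "seg (\<lambda>x y. x \<in> elts y) (FX T) j"
    have "(\<exists>k\<in>elts ?s. lam ?s (fapp f) \<cdot> k = ?one \<and> (\<exists>S. pdS T S k j)) \<longleftrightarrow> (\<exists>k\<in>elts H. k \<in> elts j \<and> (\<exists>S. pdS T S k j))"
      using lam_app[OF df, of _ ?s] unfolding H elts_seg by auto
    then have "f \<cdot> j = (if \<exists>k\<in>elts H. k \<in> elts j \<and> (\<exists>S. pdS T S k j) then vempty else ?one)"
      using bspec[OF f j] by simp
    then show ?thesis using ne j unfolding H by auto
  qed
  then have "greedy T H" unfolding greedy_def H by blast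
  then show ?thesis by blast
qed

definition HT :: "'a \<Rightarrow> 'a" where
  "HT T = (THE H. greedy T H)"

lemma greedy_HT: "greedy T (HT T)"
  unfolding HT_def using greedy_ex greedy_unique by (metis theI)

lemma dft_HT [dfn_intros]: "dft s \<Longrightarrow> dft (\<lambda>v. HT (s v))"
proof (rule dft_sub1[of HT], unfold HT_def, rule dft_The)
  show "dfn (\<lambda>v. greedy (v (Suc 0)) (v 0))" unfolding greedy_def by (intro dfn_intros)
qed (rule greedy_unique)

lemma HT_FX: "j \<in> elts (HT T) \<Longrightarrow> j \<in> elts (FX T)"
  using greedy_HT[of T] unfolding greedy_def by blast

lemma HT_cover: "j \<in> elts (FX T) \<Longrightarrow> j \<notin> elts (HT T) \<Longrightarrow> \<exists>k\<in>elts (HT T). \<exists>S. pdS T S k j"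
  using greedy_HT[of T] unfolding greedy_def by blast

text \<open>A later member was taken because it does not lie below the earlier one, so by
  \<open>pdS_total\<close> the earlier one lies below it.\<close>

lemma HT_less:
  assumes T: "valid T" and j: "j \<in> elts (HT T)" and k: "k \<in> elts (HT T)" and kj: "k \<in> elts j"
  shows "\<exists>S. pdS T S j k"
proof -
  have "\<not> (\<exists>S. pdS T S k j)" using greedy_HT[of T] j k kj HT_FX[OF j] unfolding greedy_def by blast
  moreover have "j \<noteq> k" using kj mem_irrefl by blast
  ultimately show ?thesis using pdS_total[OF T HT_FX[OF j] HT_FX[OF k]] by blast
qed

definition ell :: "'a \<Rightarrow> 'a" where
  "ell T = otp (HT T)"

lemma dft_ell [dfn_intros]: "dft s \<Longrightarrow> dft (\<lambda>v. ell (s v))"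
  unfolding ell_def by (intro dfn_intros)

lemma ell_iso: "Ord (ell T)" "ord_iso (enum (HT T)) (ell T) (HT T)"
  unfolding ell_def by (rule enum, rule FX_Ord, erule HT_FX)+

text \<open>Decodes an index below \<open>pw\<close> into a subset of \<kappa> x \<mu>. Every such
  set has an index, so that some \<open>T\<close> can be selected by a least ordinal.\<close>

definition dec :: "'a \<Rightarrow> 'a" where
  "dec i = mkset {p \<in> elts (vtimes \<kappa> \<mu>). sq \<cdot> p \<in> elts (en \<cdot> i)}"

lemma elts_dec: "elts (dec i) = {p \<in> elts (vtimes \<kappa> \<mu>). sq \<cdot> p \<in> elts (en \<cdot> i)}"
  unfolding dec_def by (rule elts_mkset, rule small_sep) (intro dfn_intros)

lemma dft_dec [dfn_intros]: "dft s \<Longrightarrow> dft (\<lambda>v. dec (s v))"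
  by (rule dft_sub1[of dec]) (unfold dec_def, intro dfn_intros)

lemma dec_ex:
  assumes T: "elts T \<subseteq> elts (vtimes \<kappa> \<mu>)"
  shows "\<exists>i\<in>elts pw. dec i = T"
proof -
  obtain X where X: "elts X = {z \<in> elts \<mu>. \<exists>p\<in>elts T. z = sq \<cdot> p}"
    by (rule sep_obtain[of "\<lambda>z. \<exists>p\<in>elts T. z = sq \<cdot> p" \<mu>]) (intro dfn_intros)
  have Xm: "elts X \<subseteq> elts \<mu>" unfolding X by blast
  have "p \<in> elts T" if p: "p \<in> elts (vtimes \<kappa> \<mu>)" and s: "sq \<cdot> p \<in> elts X" for p
  proof -
    obtain p' where p': "p' \<in> elts T" "sq \<cdot> p = sq \<cdot> p'" using s unfolding X by blast
    obtain i x where ix: "p = opair i x" "i \<in> elts \<kappa>" "x \<in> elts \<mu>" by (rule in_vtimesE[OF p])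
    have "p' \<in> elts (vtimes \<kappa> \<mu>)" using p'(1) T by blast
    then obtain i' x' where ix': "p' = opair i' x'" "i' \<in> elts \<kappa>" "x' \<in> elts \<mu>" by (rule in_vtimesE)
    have "i = i' \<and> x = x'"
      using square_injD(2)[OF sq, of i x i' x'] p'(2) ix ix' kappa_subset_mu by blast
    then show ?thesis using p'(1) ix(1) ix'(1) by simp
  qed
  moreover have "sq \<cdot> p \<in> elts X" if p: "p \<in> elts T" for p
  proof -
    have "p \<in> elts (vtimes \<kappa> \<mu>)" using p T by blast
    then obtain i x where ix: "p = opair i x" "i \<in> elts \<kappa>" "x \<in> elts \<mu>" by (rule in_vtimesE)
    have "i \<in> elts \<mu>" using ix(2) kappa_subset_mu by blast
    from square_injD(1)[OF sq this ix(3)] have "sq \<cdot> p \<in> elts \<mu>" unfolding ix(1) .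
    then show ?thesis unfolding X using p by blast
  qed
  ultimately have "elts (dec (ix \<cdot> X)) = elts T" unfolding elts_dec en_ix[OF Xm] using T by blast
  then show ?thesis using ix_pw[OF Xm] extensionality by blast
qed

section \<open>Canonical choice of a T of least rank\<close>

definition pickable :: "('a \<Rightarrow> 'a \<Rightarrow> bool) \<Rightarrow> 'a \<Rightarrow> 'a \<Rightarrow> 'a \<Rightarrow> bool" where
  "pickable P d r i \<longleftrightarrow> i \<in> elts pw \<and> valid (dec i) \<and> P d (dec i) \<and> nrk (dec i) = r"

text \<open>The rank is minimised before the index: the index only makes the choice canonical, while
  minimality of the rank drives the arguments.\<close>

definition pick :: "('a \<Rightarrow> 'a \<Rightarrow> bool) \<Rightarrow> 'a \<Rightarrow> 'a" where
  "pick P d = dec (least_ord (pickable P d (least_ord (\<lambda>r. \<exists>i. pickable P d r i))))"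

lemma pick:
  assumes dP: "dfn (\<lambda>v. P (v 0) (v 1))" 
  shows "dft s \<Longrightarrow> dft (\<lambda>v. pick P (s v))"
    and "valid T \<Longrightarrow> P d T \<Longrightarrow> valid (pick P d) \<and> P d (pick P d) \<and> elts (nrk (pick P d)) \<subseteq> elts (nrk T)"
proof -
  have [dfn_intros]: "dft s \<Longrightarrow> dft t \<Longrightarrow> dfn (\<lambda>v. P (s v) (t v))" for s t by (rule dfn_sub2[of P, OF dP])
  have dp [dfn_intros]: "dft s \<Longrightarrow> dft t \<Longrightarrow> dft u \<Longrightarrow> dfn (\<lambda>v. pickable P (s v) (t v) (u v))" for s t u
    unfolding pickable_def by (intro dfn_intros)
  show "dft s \<Longrightarrow> dft (\<lambda>v. pick P (s v))"
    by (rule dft_sub1[of "pick P"]) (unfold pick_def, intro dfn_intros)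
  assume T: "valid T" "P d T"
  let ?R = "\<lambda>r. \<exists>i. pickable P d r i"
  let ?r = "least_ord ?R"
  have dR: "dfn (\<lambda>v. ?R (v 0))" by (intro dfn_intros)
  obtain i where i: "i \<in> elts pw" "dec i = T" using dec_ex T(1) unfolding valid_def by blast
  have R: "?R (nrk T)" unfolding pickable_def using i T by blast
  have r: "?R ?r" "elts ?r \<subseteq> elts (nrk T)"
    using least_ord_ex[OF dR nrk_Ord[OF T(1)] R] least_ord_le[OF dR nrk_Ord[OF T(1)] R] by blast+
  obtain j where j: "pickable P d ?r j" using r(1) by blast
  have dj: "dfn (\<lambda>v. pickable P d ?r (v 0))" by (intro dfn_intros)
  have "Ord j" using j Ord_mem[OF Ord_pw] unfolding pickable_def by blast
  from least_ord_ex[OF dj this j] have "pickable P d ?r (least_ord (pickable P d ?r))" by (rule conjunct1[OF conjunct2])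
  then have "valid (pick P d)" "P d (pick P d)" "nrk (pick P d) = ?r" unfolding pickable_def pick_def by blast+
  then show "valid (pick P d) \<and> P d (pick P d) \<and> elts (nrk (pick P d)) \<subseteq> elts (nrk T)" using r(2) by simp
qed

definition unb :: "'a \<Rightarrow> 'a \<Rightarrow> 'a \<Rightarrow> bool" where
  "unb g d T \<longleftrightarrow> (\<forall>a\<in>elts d. \<exists>x\<in>elts d. g \<cdot> x \<in> elts (FX T) \<and> elts a \<subseteq> elts x)"

lemma dfn_unb [dfn_intros]: "dft s \<Longrightarrow> dft t \<Longrightarrow> dft u \<Longrightarrow> dfn (\<lambda>v. unb (s v) (t v) (u v))"
  by (rule dfn_sub3[of unb]) (unfold unb_def, intro dfn_intros)

text \<open>Each comparison with \<open>h\<close> has a witness S, a subset of \<kappa>. There are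
  fewer than \<mu> of these and cf \<open>d\<close> exceeds \<mu>, so one S works for unboundedly
  many \<open>x\<close>, and cutting along it keeps them all.\<close>

lemma unb_cut:
  assumes d: "Ord d" "\<mu> \<in> elts (cf d)" and T: "valid T" and h: "h \<in> elts (FX T)"
    and u: "\<And>a. a \<in> elts d \<Longrightarrow> \<exists>x\<in>elts d. (g \<cdot> x \<in> elts (FX T) \<and> (\<exists>S. pdS T S h (g \<cdot> x))) \<and> elts a \<subseteq> elts x"
  shows "\<exists>T'. valid T' \<and> unb g d T' \<and> nrk T' \<in> elts (nrk T)"
proof -
  let ?m = "vcard (vpow \<kappa>)"
  have m: "?m \<in> elts (cf d)"
    using Ord_trans[OF cf_props(1)[OF d(1)] vpow_card(1)[OF kappa_mu] d(2)] .
  have mO: "Ord ?m" by (rule vpow_card(2)[OF kappa_mu])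
  let ?P = "\<lambda>x. g \<cdot> x \<in> elts (FX T) \<and> (\<exists>S. pdS T S h (g \<cdot> x))"
  \<comment> \<open>The witness S is replaced by the least code of one, an ordinal below 2^\<kappa>,
    to give \<open>unbounded_fibre\<close> a definable function.\<close>
  let ?Q = "\<lambda>x c. c \<in> elts ?m \<and> (\<exists>S. pdS T S h (g \<cdot> x) \<and> pcode \<cdot> S = c)"
  have dQ: "dfn (\<lambda>v. ?Q x (v 0))" for x by (intro dfn_intros)
  have Sk: "S \<in> elts (vpow \<kappa>)" if "pdS T S h k" for S k using that big_subset unfolding pdS_def by simp
  have Q: "?Q x (least_ord (?Q x))" if x: "?P x" for x
  proof -
    obtain S where S: "pdS T S h (g \<cdot> x)" using x by blast
    have "?Q x (pcode \<cdot> S)" using bij_betw_apply[OF pcode_bij Sk[OF S]] S by blast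
    from least_ord_ex[OF dQ Ord_mem[OF mO conjunct1[OF this]] this] show ?thesis by (rule conjunct1[OF conjunct2])
  qed
  have "\<exists>c\<in>elts ?m. \<forall>a\<in>elts d. \<exists>x\<in>elts d. ?P x \<and> least_ord (?Q x) = c \<and> elts a \<subseteq> elts x"
  proof (rule unbounded_fibre[OF d(1) m])
    show "dfn (\<lambda>v. ?P (v 0))" "dft (\<lambda>v. least_ord (?Q (v 0)))" by (intro dfn_intros)+
    show "least_ord (?Q x) \<in> elts ?m" if "?P x" for x by (rule conjunct1[OF Q[OF that]])
  qed (rule u)
  then obtain c where c: "\<forall>a\<in>elts d. \<exists>x\<in>elts d. ?P x \<and> least_ord (?Q x) = c \<and> elts a \<subseteq> elts x" by blast
  have "vempty \<in> elts d" using d(2) cf_props(3)[OF d(1)] Ord_linear[OF Ord_vempty d(1)] by auto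
  then obtain x0 where x0: "?P x0" "least_ord (?Q x0) = c" using c by blast
  obtain S where S: "pdS T S h (g \<cdot> x0)" "pcode \<cdot> S = c" using conjunct2[OF Q[OF x0(1)]] unfolding x0(2) by blast
  have same: "pdS T S h (g \<cdot> x)" if x: "?P x" and e: "least_ord (?Q x) = c" for x
  proof -
    obtain S' where S': "pdS T S' h (g \<cdot> x)" "pcode \<cdot> S' = c" using conjunct2[OF Q[OF x]] unfolding e by blast
    have "pcode \<cdot> S' = pcode \<cdot> S" unfolding S(2) S'(2) by (rule refl)
    then have "S' = S" by (rule inj_onD[OF bij_betw_imp_inj_on[OF pcode_bij] _ Sk[OF S'(1)] Sk[OF S(1)]])
    then show ?thesis using S'(1) by simp
  qed
  note C = cut_props[OF T h]
  have "unb g d (cut T S h)" unfolding unb_def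
  proof
    fix a assume "a \<in> elts d"
    then obtain x where x: "x \<in> elts d" "?P x" "least_ord (?Q x) = c" "elts a \<subseteq> elts x" using c by blast
    have "g \<cdot> x \<in> elts (FX (cut T S h))" by (rule C(2)[OF conjunct1[OF x(2)] same[OF x(2,3)]])
    then show "\<exists>x\<in>elts d. g \<cdot> x \<in> elts (FX (cut T S h)) \<and> elts a \<subseteq> elts x" using x by blast
  qed
  moreover have "valid (cut T S h)" "nrk (cut T S h) \<in> elts (nrk T)"
    using C(1,3)[OF conjunct1[OF x0(1)] S(1)] by blast+
  ultimately show ?thesis by blast
qed

text \<open>The i-th greedy function is sent to the least strict bound of those \<open>x\<close> for
  which \<open>g \<cdot> x\<close> is this function or lies below it. The bounds need not increase
  with i, hence \<open>records\<close>.\<close>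

definition cofset :: "'a \<Rightarrow> 'a \<Rightarrow> 'a \<Rightarrow> 'a" where
  "cofset g d T = records (lam (ell T) (\<lambda>i. least_ord (\<lambda>b. b \<in> elts d \<and> (\<forall>x\<in>elts d. g \<cdot> x \<in> elts (FX T) \<and>
     (g \<cdot> x = enum (HT T) \<cdot> i \<or> (\<exists>S. pdS T S (enum (HT T) \<cdot> i) (g \<cdot> x))) \<longrightarrow> x \<in> elts b)))) (ell T)"

text \<open>A bound exists for each i, since otherwise \<open>unb_cut\<close> would give a T of
  smaller rank. Each compatible \<open>g \<cdot> x\<close> is a greedy function or lies below one,
  so the bounds are unbounded in \<open>d\<close>.\<close>

lemma cofset:
  assumes d: "Limit d" "\<mu> \<in> elts (cf d)" and T: "valid T" and u: "unb g d T"
    and inj: "\<And>x y. x \<in> elts d \<Longrightarrow> y \<in> elts d \<Longrightarrow> g \<cdot> x = g \<cdot> y \<Longrightarrow> x = y"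
    and min: "\<And>T'. valid T' \<Longrightarrow> unb g d T' \<Longrightarrow> elts (nrk T) \<subseteq> elts (nrk T')"
  shows "unbounded_in (cofset g d T) d" "elts (otp (cofset g d T)) \<subseteq> elts (ell T)"
proof -
  have dO: "Ord d" by (rule Limit_Ord[OF d(1)])
  let ?h = "\<lambda>i. enum (HT T) \<cdot> i"
  let ?C = "\<lambda>i x. g \<cdot> x \<in> elts (FX T) \<and> (g \<cdot> x = ?h i \<or> (\<exists>S. pdS T S (?h i) (g \<cdot> x)))"
  let ?B = "\<lambda>i b. b \<in> elts d \<and> (\<forall>x\<in>elts d. ?C i x \<longrightarrow> x \<in> elts b)"
  let ?p = "lam (ell T) (\<lambda>i. least_ord (?B i))"
  have dB: "dfn (\<lambda>v. ?B i (v 0))" for i by (intro dfn_intros)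
  have dp: "dft (\<lambda>v. least_ord (?B (v 0)))" by (intro dfn_intros)
  have hF: "?h i \<in> elts (FX T)" if "i \<in> elts (ell T)" for i
    by (rule HT_FX[OF ord_isoD(1)[OF ell_iso(2) that]])
  have ex: "\<exists>b. ?B i b" if i: "i \<in> elts (ell T)" for i
  proof (rule ccontr)
    assume n: "\<not> (\<exists>b. ?B i b)"
    have C: "\<exists>x\<in>elts d. ?C i x \<and> elts b \<subseteq> elts x" if b: "b \<in> elts d" for b
    proof -
      obtain x where x: "x \<in> elts d" "?C i x" "x \<notin> elts b" using n b by blast
      then show ?thesis using Ord_not_mem[OF Ord_mem[OF dO x(1)] Ord_mem[OF dO b]] by blast
    qed
    have "\<exists>T'. valid T' \<and> unb g d T' \<and> nrk T' \<in> elts (nrk T)"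
    proof (rule unb_cut[OF dO d(2) T hF[OF i]])
      fix b assume b: "b \<in> elts d"
      \<comment> \<open>By injectivity \<open>g\<close> takes the i-th greedy function as value at
        most once. Beyond that argument only the strict comparison remains, as
        \<open>unb_cut\<close> wants.\<close>
      obtain b' where b': "b' \<in> elts d" "elts b \<subseteq> elts b'" "\<And>x. x \<in> elts d \<Longrightarrow> elts b' \<subseteq> elts x \<Longrightarrow> g \<cdot> x \<noteq> ?h i"
      proof (cases "\<exists>x0\<in>elts d. g \<cdot> x0 = ?h i")
        case True
        then obtain x0 where x0: "x0 \<in> elts d" "g \<cdot> x0 = ?h i" by blast
        have s: "vsucc x0 \<in> elts d" using d(1) x0(1) unfolding Limit_def by blast
        show thesis
        proof (rule that)
          show "vun b (vsucc x0) \<in> elts d" by (rule vun_mem[OF dO b s])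
          fix x assume x: "x \<in> elts d" "elts (vun b (vsucc x0)) \<subseteq> elts x"
          show "g \<cdot> x \<noteq> ?h i"
          proof
            assume "g \<cdot> x = ?h i"
            then have "g \<cdot> x = g \<cdot> x0" unfolding x0(2) .
            then have "x = x0" by (rule inj[OF x(1) x0(1)])
            then show False using x(2) mem_irrefl[of x0] by simp
          qed
        qed auto
      next
        case False
        then show thesis using that b by blast
      qed
      obtain x where x: "x \<in> elts d" "?C i x" "elts b' \<subseteq> elts x" using C[OF b'(1)] by blast
      then have "\<exists>S. pdS T S (?h i) (g \<cdot> x)" using b'(3)[OF x(1,3)] by blast
      then show "\<exists>x\<in>elts d. (g \<cdot> x \<in> elts (FX T) \<and> (\<exists>S. pdS T S (?h i) (g \<cdot> x))) \<and> elts b \<subseteq> elts x"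
        using x b'(2) by blast
    qed
    then obtain T' where T': "valid T'" "unb g d T'" "nrk T' \<in> elts (nrk T)" by blast
    have "nrk T' \<in> elts (nrk T')" using min[OF T'(1,2)] T'(3) by blast
    then show False using mem_irrefl by blast
  qed
  have B: "?B i (?p \<cdot> i)" if i: "i \<in> elts (ell T)" for i
  proof -
    from ex[OF i] obtain b where b: "?B i b" by (elim exE)
    have "?B i (least_ord (?B i))"
      using least_ord_ex[where P = "?B i" and a = b, OF dB[of i] Ord_mem[OF dO conjunct1[OF b]] b]
      by (elim conjE) (intro conjI)
    then show ?thesis using lam_app[OF dp i] by simp
  qed
  have pd: "?p \<cdot> i \<in> elts d" if "i \<in> elts (ell T)" for i by (rule conjunct1[OF B[OF that]])
  have pu: "\<exists>i\<in>elts (ell T). elts b \<subseteq> elts (?p \<cdot> i)" if b: "b \<in> elts d" for b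
  proof -
    obtain x where x: "x \<in> elts d" "g \<cdot> x \<in> elts (FX T)" "elts b \<subseteq> elts x" using u b unfolding unb_def by blast
    obtain k where k: "k \<in> elts (HT T)" "g \<cdot> x = k \<or> (\<exists>S. pdS T S k (g \<cdot> x))"
      using HT_cover[OF x(2)] by blast
    obtain i where i: "i \<in> elts (ell T)" "?h i = k" using ord_isoD(2)[OF ell_iso(2) k(1)] by blast
    have "x \<in> elts (?p \<cdot> i)" using conjunct2[OF B[OF i(1)]] x(1,2) k(2) unfolding i(2) by blast
    then have "elts b \<subseteq> elts (?p \<cdot> i)" using x(3) Ord_mem_subset[OF Ord_mem[OF dO pd[OF i(1)]]] by blast
    then show ?thesis using i(1) by blast
  qed
  note R = records_cofinal[OF ell_iso(1) dO pd pu]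
  show "unbounded_in (cofset g d T) d" unfolding cofset_def by (rule R(1))
  show "elts (otp (cofset g d T)) \<subseteq> elts (ell T)" unfolding cofset_def by (rule R(2))
qed

end

section \<open>Few order types of cofinal sequences\<close>

text \<open>Composition of cofinal sets: a cofinal subset of the order type of \<open>x\<close> is
  carried back into \<open>x\<close>. This is the step by which the construction is
  iterated.\<close>

definition enum_image :: "'a::zf \<Rightarrow> 'a \<Rightarrow> 'a" where
  "enum_image x y = mkset {w. \<exists>j\<in>elts y. w = enum x \<cdot> j}"

lemma dft_enum_image [dfn_intros]: "dft s \<Longrightarrow> dft t \<Longrightarrow> dft (\<lambda>v. enum_image (s v) (t v :: 'a::zf))"
  by (rule dft_sub2[of enum_image]) (unfold enum_image_def, intro dfn_intros)

lemma elts_enum_image: "elts (enum_image x y) = {w. \<exists>j\<in>elts y. w = enum x \<cdot> (j::'a::zf)}"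
proof -
  have "dft (\<lambda>v. enum x \<cdot> v 0)" by (intro dfn_intros)
  moreover have "{w. \<exists>j\<in>elts y. w = enum x \<cdot> j} = fapp (enum x) ` elts y" by blast
  ultimately show ?thesis unfolding enum_image_def by (simp only: elts_mkset small_image)
qed

lemma enum_image_props:
  assumes d: "Ord d" and x: "unbounded_in x d" and y: "unbounded_in y (otp (x::'a::zf))"
  shows "unbounded_in (enum_image x y) d" "otp (enum_image x y) = otp y"
proof -
  have xd: "elts x \<subseteq> elts d" using x unfolding unbounded_in_def by blast
  have xO: "Ord z" if "z \<in> elts x" for z using xd that Ord_mem[OF d] by blast
  have E: "Ord (otp x)" "ord_iso (enum x) (otp x) x" by (rule enum, erule xO)+
  note iso = ord_isoD[OF E(2)]
  have yx: "elts y \<subseteq> elts (otp x)" using y unfolding unbounded_in_def by blast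
  have yO: "Ord z" if "z \<in> elts y" for z using yx that Ord_mem[OF E(1)] by blast
  show "unbounded_in (enum_image x y) d" unfolding unbounded_in_def
  proof (intro conjI ballI subsetI)
    fix w assume "w \<in> elts (enum_image x y)"
    then obtain j where j: "j \<in> elts y" "w = enum x \<cdot> j" unfolding elts_enum_image by blast
    have "enum x \<cdot> j \<in> elts x" using iso(1) j(1) yx by blast
    then show "w \<in> elts d" unfolding j(2) using xd by blast
  next
    fix a assume "a \<in> elts d"
    then obtain b where b: "b \<in> elts x" "elts a \<subseteq> elts b" using x unfolding unbounded_in_def by blast
    obtain i where i: "i \<in> elts (otp x)" "enum x \<cdot> i = b" using iso(2)[OF b(1)] by blast
    obtain j where j: "j \<in> elts y" "elts i \<subseteq> elts j" using y i(1) unfolding unbounded_in_def by blast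
    have jx: "j \<in> elts (otp x)" using j(1) yx by blast
    have "i = j \<or> i \<in> elts j" using Ord_subset_iff[OF Ord_mem[OF E(1) i(1)] yO[OF j(1)]] j(2) by blast
    then have "elts b \<subseteq> elts (enum x \<cdot> j)"
    proof
      assume "i = j" then show ?thesis using i(2) by simp
    next
      assume "i \<in> elts j"
      then have "enum x \<cdot> i \<in> elts (enum x \<cdot> j)" using iso(3)[OF i(1) jx] by blast
      then show ?thesis unfolding i(2) by (rule Ord_mem_subset[OF xO[OF iso(1)[OF jx]]])
    qed
    moreover have "enum x \<cdot> j \<in> elts (enum_image x y)" unfolding elts_enum_image using j(1) by blast
    ultimately show "\<exists>b\<in>elts (enum_image x y). elts a \<subseteq> elts b" using b(2) by blast
  qed
  have F: "Ord (otp y)" "ord_iso (enum y) (otp y) y" by (rule enum, erule yO)+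
  note iso' = ord_isoD[OF F(2)]
  have in_x: "enum y \<cdot> i \<in> elts (otp x)" if "i \<in> elts (otp y)" for i using iso'(1)[OF that] yx by blast
  show "otp (enum_image x y) = otp y"
  proof (rule otp_eqI[OF ord_iso_lam F(1)])
    show "dft (\<lambda>v. enum x \<cdot> (enum y \<cdot> v 0))" by (intro dfn_intros)
    show "i \<in> elts j \<longleftrightarrow> enum x \<cdot> (enum y \<cdot> i) \<in> elts (enum x \<cdot> (enum y \<cdot> j))"
      if "i \<in> elts (otp y)" "j \<in> elts (otp y)" for i j
      unfolding iso(3)[OF in_x[OF that(1)] in_x[OF that(2)]] iso'(3)[OF that] by (rule refl)
    show "bij_betw (\<lambda>i. enum x \<cdot> (enum y \<cdot> i)) (elts (otp y)) (elts (enum_image x y))"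
      unfolding bij_betw_def
    proof
      show "inj_on (\<lambda>i. enum x \<cdot> (enum y \<cdot> i)) (elts (otp y))"
        by (rule inj_onI) (simp only: iso(4)[OF in_x in_x] iso'(4))
      show "(\<lambda>i. enum x \<cdot> (enum y \<cdot> i)) ` elts (otp y) = elts (enum_image x y)"
      proof (intro set_eqI iffI)
        fix w assume "w \<in> (\<lambda>i. enum x \<cdot> (enum y \<cdot> i)) ` elts (otp y)"
        then obtain i where "w = enum x \<cdot> (enum y \<cdot> i)" "i \<in> elts (otp y)" by (rule imageE)
        then show "w \<in> elts (enum_image x y)" unfolding elts_enum_image using iso'(1) by blast
      next
        fix w assume "w \<in> elts (enum_image x y)"
        then obtain j where j: "j \<in> elts y" "w = enum x \<cdot> j" unfolding elts_enum_image by blast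
        obtain i where i: "i \<in> elts (otp y)" "enum y \<cdot> i = j" using iso'(2)[OF j(1)] by blast
        then show "w \<in> (\<lambda>i. enum x \<cdot> (enum y \<cdot> i)) ` elts (otp y)" using j(2) by (intro image_eqI[of _ _ i]) simp_all
      qed
    qed
  qed
qed

context strong_singular
begin

text \<open>Finite cardinals and \<mu> itself are included, as rows of \<open>T\<close> may have any
  of these sizes.\<close>

definition cards :: 'a where
  "cards = mkset {z \<in> elts (vsucc \<mu>). \<forall>b\<in>elts z. \<not> eqpoll z b}"

lemma elts_cards: "elts cards = {z \<in> elts (vsucc \<mu>). \<forall>b\<in>elts z. \<not> eqpoll z b}"
  unfolding cards_def by (rule elts_mkset, rule small_sep) (intro dfn_intros)

lemma cT_cards: "cT T \<in> elts (vfuns \<kappa> cards)"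
  unfolding elts_vfuns mem_Collect_eq cT_def
proof (rule maps_lam[OF dft_cT_body])
  fix i
  note V = vcard_subset[OF Ord_mu trow_subset[of T i]]
  show "vcard (trow T i) \<in> elts cards" unfolding elts_cards using subset_mu_vsucc[OF V(1,3)] V(4) by blast
qed

definition csupp :: "'a \<Rightarrow> 'a" where
  "csupp c = mkset {i. i \<in> elts \<kappa> \<and> c \<cdot> i \<noteq> vempty}"

lemma elts_csupp: "elts (csupp c) = {i. i \<in> elts \<kappa> \<and> c \<cdot> i \<noteq> vempty}"
proof -
  have "elts (csupp c) = {i \<in> elts \<kappa>. c \<cdot> i \<noteq> vempty}"
    unfolding csupp_def by (rule elts_mkset, rule small_sep) (intro dfn_intros)
  then show ?thesis .
qed

lemma dft_csupp [dfn_intros]: "dft s \<Longrightarrow> dft (\<lambda>v. csupp (s v))"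
  by (rule dft_sub1[of csupp]) (unfold csupp_def, intro dfn_intros)

text \<open>Hence the rank of \<open>T\<close> can be recovered from \<open>cT T\<close> alone, so
  that functions from \<kappa> to \<open>cards\<close> can stand for the rank thresholds.\<close>

lemma csupp_cT: "csupp (cT T) = tdom T"
proof (rule extensionality, rule set_eqI)
  fix i
  have "vcard (trow T i) = vempty \<longleftrightarrow> trow T i = vempty"
  proof
    assume e: "vcard (trow T i) = vempty"
    obtain f where "bij_betw (fapp f) (elts (trow T i)) (elts (vcard (trow T i)))"
      by (rule eqpollE[OF vcard_subset(2)[OF Ord_mu trow_subset]])
    then show "trow T i = vempty" unfolding e eq_vempty_iff[of "trow T i"] bij_betw_def by simp
  next
    assume "trow T i = vempty"
    then have "elts (trow T i) \<subseteq> elts vempty" by simp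
    from vcard_subset(3)[OF Ord_vempty this] show "vcard (trow T i) = vempty" unfolding eq_vempty_iff by simp
  qed
  then show "i \<in> elts (csupp (cT T)) \<longleftrightarrow> i \<in> elts (tdom T)"
    unfolding elts_csupp elts_tdom using cT_app[of i T] by auto
qed

definition lower :: "'a \<Rightarrow> 'a \<Rightarrow> bool" where
  "lower c T \<longleftrightarrow> valid T \<and> (big (csupp c) \<longrightarrow> nrk T \<in> elts (rk (csupp c) c))"

lemma dfn_lower [dfn_intros]: "dft s \<Longrightarrow> dft t \<Longrightarrow> dfn (\<lambda>v. lower (s v) (t v))"
  unfolding lower_def by (intro dfn_intros)

text \<open>The ordinals \<open>Th c\<close> play the role of the cardinals between \<open>\<mu>\<close> and its power in the
  Galvin-Hajnal theorem. A function \<open>c\<close> with bounded support stands for an infinite rank.\<close>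

definition Th :: "'a \<Rightarrow> 'a" where
  "Th c = vsup (mkset {l. \<exists>i\<in>elts pw. lower c (dec i) \<and> l = ell (dec i)})"

lemma dft_Th [dfn_intros]: "dft s \<Longrightarrow> dft (\<lambda>v. Th (s v))"
  by (rule dft_sub1[of Th]) (unfold Th_def, intro dfn_intros)

lemma elts_Th_set: "elts (mkset {l. \<exists>i\<in>elts pw. lower c (dec i) \<and> l = ell (dec i)}) =
    {l. \<exists>i\<in>elts pw. lower c (dec i) \<and> l = ell (dec i)}"
proof (rule elts_mkset, rule small_Collect)
  have "dft (\<lambda>v. ell (dec (v 0)))" by (intro dfn_intros)
  from elts_mkset[OF small_image[OF this, of pw]]
  show "l \<in> elts (mkset ((\<lambda>i. ell (dec i)) ` elts pw))" if "\<exists>i\<in>elts pw. lower c (dec i) \<and> l = ell (dec i)" for l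
    using that by blast
qed (intro dfn_intros)

lemma Th_Ord: "Ord (Th c)"
  unfolding Th_def by (rule Ord_vsup, unfold elts_Th_set) (use ell_iso(1) in blast)

lemma Th_upper: "lower c T \<Longrightarrow> elts (ell T) \<subseteq> elts (Th c)"
proof -
  assume T: "lower c T"
  then obtain i where i: "i \<in> elts pw" "dec i = T" using dec_ex unfolding lower_def valid_def by blast
  have "ell T \<in> {l. \<exists>i\<in>elts pw. lower c (dec i) \<and> l = ell (dec i)}" using T i by blast
  then show ?thesis unfolding Th_def elts_vsup elts_Th_set by blast
qed

lemma Th_least: "(\<And>T. lower c T \<Longrightarrow> elts (ell T) \<subseteq> elts d) \<Longrightarrow> elts (Th c) \<subseteq> elts d"
  unfolding Th_def elts_vsup elts_Th_set by blast

section \<open>The cofinal set attached to an ordinal of large cofinality\<close>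

definition caseA :: "'a \<Rightarrow> bool" where
  "caseA d \<longleftrightarrow> (\<exists>T. valid T \<and> d \<in> elts (ell T))"

lemma dfn_caseA [dfn_intros]: "dft s \<Longrightarrow> dfn (\<lambda>v. caseA (s v))"
  unfolding caseA_def by (intro dfn_intros dft_shift)

definition pickA :: "'a \<Rightarrow> 'a" where
  "pickA d = pick (\<lambda>d T. d \<in> elts (ell T)) d"

lemma dfn_pickA: "dfn (\<lambda>v. v 0 \<in> elts (ell (v 1)))"
  by (intro dfn_intros)

lemma dft_pickA [dfn_intros]: "dft s \<Longrightarrow> dft (\<lambda>v. pickA (s v))"
  unfolding pickA_def by (rule pick(1)[of "\<lambda>d T. d \<in> elts (ell T)", OF dfn_pickA])

text \<open>In case A only the part below \<open>d\<close> of the greedy sequence is used. All of it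
  lies below the member at \<open>d\<close>, and cutting there gives a rank below that of
  \<open>pickA d\<close>. Otherwise the sequence consists of all coding functions in their given
  order.\<close>

definition gsel :: "'a \<Rightarrow> 'a" where
  "gsel d = (if caseA d then enum (HT (pickA d)) else lam pw (\<lambda>x. x))"

lemma dft_gsel [dfn_intros]: "dft s \<Longrightarrow> dft (\<lambda>v. gsel (s v))"
  by (rule dft_sub1[of gsel]) (unfold gsel_def, intro dfn_intros)

definition pickB :: "'a \<Rightarrow> 'a" where
  "pickB d = pick (\<lambda>d T. unb (gsel d) d T) d"

lemma dfn_pickB: "dfn (\<lambda>v. unb (gsel (v 0)) (v 0) (v 1))"
  by (intro dfn_intros)

lemma dft_pickB [dfn_intros]: "dft s \<Longrightarrow> dft (\<lambda>v. pickB (s v))"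
  unfolding pickB_def by (rule pick(1)[of "\<lambda>d T. unb (gsel d) d T", OF dfn_pickB])

definition short :: "'a \<Rightarrow> 'a" where
  "short d = cofset (gsel d) d (pickB d)"

lemma dft_short [dfn_intros]: "dft s \<Longrightarrow> dft (\<lambda>v. short (s v))"
  by (rule dft_sub1[of short]) (unfold short_def cofset_def, intro dfn_intros)

lemma top_props: "valid (vtimes \<kappa> \<mu>)" "j \<in> elts pw \<Longrightarrow> j \<in> elts (FX (vtimes \<kappa> \<mu>))"
proof -
  have row: "trow (vtimes \<kappa> \<mu>) i = \<mu>" if "i \<in> elts \<kappa>" for i
    using that by (intro extensionality) (auto simp: elts_trow)
  have m: "\<mu> \<noteq> vempty" using omega_mu by auto
  have dom: "tdom (vtimes \<kappa> \<mu>) = \<kappa>"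
    by (rule extensionality) (use row m in \<open>auto simp: elts_tdom\<close>)
  show "valid (vtimes \<kappa> \<mu>)" unfolding valid_def dom using big_kappa by simp
  show "j \<in> elts pw \<Longrightarrow> j \<in> elts (FX (vtimes \<kappa> \<mu>))" unfolding elts_FX dom using row fn_mu by auto
qed

text \<open>In case A put c = \<open>cT (pickA d)\<close>. The rank of \<open>pickB d\<close> is
  below that of \<open>pickA d\<close>, so its length is at most \<open>Th c\<close>. By minimality
  of \<open>pickA d\<close> no T of smaller rank has length above \<open>d\<close>, whence
  \<open>Th c\<close> is at most \<open>d\<close>. Otherwise no valid T has length above
  \<open>d\<close>, and a c of infinite rank serves.\<close>

lemma short_props:
  assumes d: "d \<in> elts pw" "Limit d" "\<mu> \<in> elts (cf d)"
  shows "unbounded_in (short d) d \<and> (\<exists>c\<in>elts (vfuns \<kappa> cards). elts (otp (short d)) \<subseteq> elts (Th c) \<and> elts (Th c) \<subseteq> elts d)"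
proof -
  have dO: "Ord d" by (rule Limit_Ord[OF d(2)])
  note pB = pick(2)[of "\<lambda>d T. unb (gsel d) d T", OF dfn_pickB, folded pickB_def]
  have main: "unbounded_in (short d) d" "elts (otp (short d)) \<subseteq> elts (ell (pickB d))" "valid (pickB d)"
      "elts (nrk (pickB d)) \<subseteq> elts (nrk T)"
    if T: "valid T" "unb (gsel d) d T"
      and inj: "\<And>x y. x \<in> elts d \<Longrightarrow> y \<in> elts d \<Longrightarrow> gsel d \<cdot> x = gsel d \<cdot> y \<Longrightarrow> x = y" for T
  proof -
    have v: "valid (pickB d)" "unb (gsel d) d (pickB d)" using pB[OF T] by blast+
    have m: "elts (nrk (pickB d)) \<subseteq> elts (nrk T')" if "valid T'" "unb (gsel d) d T'" for T'
      using pB[OF that] by blast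
    show "unbounded_in (short d) d" "elts (otp (short d)) \<subseteq> elts (ell (pickB d))"
      unfolding short_def by (rule cofset[OF d(2,3) v inj m], assumption+)+
    show "valid (pickB d)" "elts (nrk (pickB d)) \<subseteq> elts (nrk T)" using v m[OF T] by blast+
  qed
  show ?thesis
  proof (cases "caseA d")
    case True
    then obtain T where T: "valid T" "d \<in> elts (ell T)" unfolding caseA_def by blast
    note pA = pick(2)[of "\<lambda>d T. d \<in> elts (ell T)", OF dfn_pickA, folded pickA_def]
    let ?T = "pickA d"
    have v: "valid ?T" and dl: "d \<in> elts (ell ?T)" using pA[OF T] by blast+
    have g: "gsel d = enum (HT ?T)" unfolding gsel_def using True by simp
    note iso = ord_isoD[OF ell_iso(2)[of ?T]]
    have xl: "x \<in> elts (ell ?T)" if "x \<in> elts d" for x using Ord_trans[OF ell_iso(1) that dl] .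
    have hd: "gsel d \<cdot> d \<in> elts (HT ?T)" unfolding g by (rule iso(1)[OF dl])
    have "\<exists>T'. valid T' \<and> unb (gsel d) d T' \<and> nrk T' \<in> elts (nrk ?T)"
    proof (rule unb_cut[OF dO d(3) v HT_FX[OF hd]])
      fix a assume a: "a \<in> elts d"
      have ha: "gsel d \<cdot> a \<in> elts (HT ?T)" unfolding g by (rule iso(1)[OF xl[OF a]])
      have "gsel d \<cdot> a \<in> elts (gsel d \<cdot> d)" unfolding g using iso(3)[OF xl[OF a] dl] a by blast
      then have "\<exists>S. pdS ?T S (gsel d \<cdot> d) (gsel d \<cdot> a)" by (rule HT_less[OF v hd ha])
      then show "\<exists>x\<in>elts d. (gsel d \<cdot> x \<in> elts (FX ?T) \<and> (\<exists>S. pdS ?T S (gsel d \<cdot> d) (gsel d \<cdot> x))) \<and> elts a \<subseteq> elts x"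
        using a HT_FX[OF ha] by blast
    qed
    then obtain T' where T': "valid T'" "unb (gsel d) d T'" "nrk T' \<in> elts (nrk ?T)" by blast
    have inj: "x = y" if "x \<in> elts d" "y \<in> elts d" "gsel d \<cdot> x = gsel d \<cdot> y" for x y
      using iso(4)[OF xl[OF that(1)] xl[OF that(2)]] that(3) unfolding g by blast
    note M = main[OF T'(1,2) inj]
    let ?c = "cT ?T"
    have bc: "big (csupp ?c)" unfolding csupp_cT using v unfolding valid_def by blast
    have rc: "rk (csupp ?c) ?c = nrk ?T" unfolding csupp_cT nrk_def by (rule refl)
    have "nrk (pickB d) \<in> elts (nrk ?T)"
      by (rule Ord_subset_mem[OF nrk_Ord[OF v] nrk_Ord[OF M(3)] M(4) T'(3)])
    then have "lower ?c (pickB d)" unfolding lower_def rc using M(3) by blast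
    then have 1: "elts (otp (short d)) \<subseteq> elts (Th ?c)" using Th_upper M(2) by blast
    have "elts (Th ?c) \<subseteq> elts d"
    proof (rule Th_least)
      fix T assume "lower ?c T"
      then have T: "valid T" "nrk T \<in> elts (nrk ?T)" using bc unfolding lower_def rc by blast+
      have "d \<notin> elts (ell T)"
      proof
        assume "d \<in> elts (ell T)"
        then have "elts (nrk ?T) \<subseteq> elts (nrk T)" using pA[OF T(1)] by blast
        then show False using T(2) mem_irrefl by blast
      qed
      then show "elts (ell T) \<subseteq> elts d" using Ord_not_mem[OF dO ell_iso(1)] by blast
    qed
    then show ?thesis using M(1) 1 cT_cards by blast
  next
    case False
    have g: "gsel d = lam pw (\<lambda>x. x)" unfolding gsel_def using False by simp
    have dp: "x \<in> elts pw" if "x \<in> elts d" for x using Ord_trans[OF Ord_pw that d(1)] .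
    have gx: "gsel d \<cdot> x = x" if "x \<in> elts d" for x unfolding g by (rule lam_app[OF dft_var dp[OF that]])
    have u: "unb (gsel d) d (vtimes \<kappa> \<mu>)" unfolding unb_def
    proof
      fix a assume a: "a \<in> elts d"
      have "gsel d \<cdot> a \<in> elts (FX (vtimes \<kappa> \<mu>))" unfolding gx[OF a] by (rule top_props(2)[OF dp[OF a]])
      then show "\<exists>x\<in>elts d. gsel d \<cdot> x \<in> elts (FX (vtimes \<kappa> \<mu>)) \<and> elts a \<subseteq> elts x" using a by blast
    qed
    have inj: "x = y" if "x \<in> elts d" "y \<in> elts d" "gsel d \<cdot> x = gsel d \<cdot> y" for x y
      using that(3) unfolding gx[OF that(1)] gx[OF that(2)] .
    note M = main[OF top_props(1) u inj]
    \<comment> \<open>The zero function has empty, hence bounded, support and so imposes no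
      restriction on the rank in \<open>lower\<close>.\<close>
    let ?c = "lam \<kappa> (\<lambda>_. vempty)"
    have c0: "?c \<cdot> i = vempty" if "i \<in> elts \<kappa>" for i by (rule lam_app[OF dft_const that])
    have "elts (csupp ?c) = {}" unfolding elts_csupp using c0 by blast
    then have nb: "\<not> big (csupp ?c)" using bigD[of "csupp ?c"] omega_kappa by blast
    have "vempty \<in> elts (vsucc \<mu>)" using vempty_in_Limit[OF Limit_mu] by simp
    then have c: "?c \<in> elts (vfuns \<kappa> cards)"
      unfolding elts_vfuns mem_Collect_eq by (intro maps_lam[OF dft_const]) (simp add: elts_cards)
    have "lower ?c (pickB d)" unfolding lower_def using M(3) nb by blast
    then have 1: "elts (otp (short d)) \<subseteq> elts (Th ?c)" using Th_upper M(2) by blast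
    have "elts (Th ?c) \<subseteq> elts d"
    proof (rule Th_least)
      fix T assume "lower ?c T"
      then have "d \<notin> elts (ell T)" using False unfolding lower_def caseA_def by blast
      then show "elts (ell T) \<subseteq> elts d" using Ord_not_mem[OF dO ell_iso(1)] by blast
    qed
    then show ?thesis using M(1) 1 c by blast
  qed
qed

text \<open>Values \<open>Th c\<close> below \<mu> are discarded so that exactly the regular alephs
  remain below \<mu>.\<close>

definition types :: 'a where
  "types = mkset {x. (x \<in> elts \<mu> \<and> Reg x) \<or> (x \<notin> elts \<mu> \<and> (\<exists>c\<in>elts (vfuns \<kappa> cards). x = Th c))}"

lemma elts_types: "elts types = {x. (x \<in> elts \<mu> \<and> Reg x) \<or> (x \<notin> elts \<mu> \<and> (\<exists>c\<in>elts (vfuns \<kappa> cards). x = Th c))}"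
  unfolding types_def
proof (rule elts_mkset, rule small_Collect)
  let ?I = "mkset (Th ` elts (vfuns \<kappa> cards))"
  have d: "dft (\<lambda>v. Th (v 0))" by (intro dfn_intros)
  have "elts ?I = Th ` elts (vfuns \<kappa> cards)" by (rule elts_mkset[OF small_image[OF d]])
  then show "x \<in> elts (vun \<mu> ?I)"
    if "(x \<in> elts \<mu> \<and> Reg x) \<or> (x \<notin> elts \<mu> \<and> (\<exists>c\<in>elts (vfuns \<kappa> cards). x = Th c))" for x
    unfolding elts_vun using that by blast
qed (intro dfn_intros)

text \<open>Recursion on \<open>d\<close>. For cofinality above \<mu>, either \<open>d\<close> is
  some \<open>Th c\<close> and serves itself, or \<open>short d\<close> has a type strictly below
  \<open>d\<close>, being at most some \<open>Th c\<close> that differs from \<open>d\<close>. In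
  the latter case the set already found for this type is carried into
  \<open>short d\<close>.\<close>

lemma otimes_types: "otimes pw (\<lambda>x. x \<in> elts types)"
proof -
  obtain e where e: "\<forall>d\<in>elts pw. Limit d \<longrightarrow> elts (cf d) \<subseteq> elts \<mu> \<longrightarrow> unbounded_in (e \<cdot> d) d \<and> otp (e \<cdot> d) = cf d"
    by (rule short_cofinal)
  interpret wf_order "\<lambda>x y. x \<in> elts y" pw by (rule Ord_wf_order) (rule Ord_mem[OF Ord_pw])
  let ?G = "\<lambda>d g. if elts (cf d) \<subseteq> elts \<mu> then e \<cdot> d
    else if \<exists>c\<in>elts (vfuns \<kappa> cards). d = Th c then d else enum_image (short d) (g \<cdot> otp (short d))"
  have dG: "dft (\<lambda>v. ?G (v 0) (v 1))" by (intro dfn_intros)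
  obtain f where f: "\<forall>d\<in>elts pw. f \<cdot> d = ?G d (lam (seg (\<lambda>x y. x \<in> elts y) pw d) (fapp f))"
    by (rule wf_rec[of ?G, OF dG]) blast
  have df: "dft (\<lambda>v. f \<cdot> v 0)" by (intro dfn_intros)
  have good: "Limit d \<longrightarrow> unbounded_in (f \<cdot> d) d \<and> otp (f \<cdot> d) \<in> elts types" if d: "d \<in> elts pw" for d
  proof (rule wf_induct[where P = "\<lambda>d. Limit d \<longrightarrow> unbounded_in (f \<cdot> d) d \<and> otp (f \<cdot> d) \<in> elts types", OF _ d])
    show "dfn (\<lambda>v. Limit (v 0) \<longrightarrow> unbounded_in (f \<cdot> v 0) (v 0) \<and> otp (f \<cdot> v 0) \<in> elts types)" by (intro dfn_intros)
    fix d assume d: "d \<in> elts pw"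
      and IH: "\<And>x. x \<in> elts pw \<Longrightarrow> x \<in> elts d \<Longrightarrow> Limit x \<longrightarrow> unbounded_in (f \<cdot> x) x \<and> otp (f \<cdot> x) \<in> elts types"
    show "Limit d \<longrightarrow> unbounded_in (f \<cdot> d) d \<and> otp (f \<cdot> d) \<in> elts types"
    proof
      assume L: "Limit d"
      have dO: "Ord d" by (rule Limit_Ord[OF L])
      have cO: "Ord (cf d)" by (rule cf_props(1)[OF dO])
      let ?s = "seg (\<lambda>x y. x \<in> elts y) pw d"
      have fd: "f \<cdot> d = ?G d (lam ?s (fapp f))" by (rule bspec[OF f d])
      show "unbounded_in (f \<cdot> d) d \<and> otp (f \<cdot> d) \<in> elts types"
      proof (cases "elts (cf d) \<subseteq> elts \<mu>")
        case True
        then have "f \<cdot> d = e \<cdot> d" using fd by simp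
        moreover have "unbounded_in (e \<cdot> d) d" "otp (e \<cdot> d) = cf d" using e d L True by blast+
        moreover have "cf d \<in> elts \<mu>"
        proof -
          \<comment> \<open>Cofinalities are regular while \<mu> is singular, so the type even lies
            below \<mu>, as membership in \<open>types\<close> requires.\<close>
          have "cf d \<noteq> \<mu>"
          proof
            assume c: "cf d = \<mu>"
            have "cf (cf d) = cf d" by (rule cf_cf[OF dO])
            then have "\<kappa> = \<mu>" unfolding c cf_mu .
            then show False using kappa_mu mem_irrefl[of \<mu>] by simp
          qed
          then show ?thesis using Ord_subset_iff[OF cO Ord_mu] True by blast
        qed
        ultimately show ?thesis unfolding elts_types using cf_Reg[OF L] by simp
      next
        case False
        then have mc: "\<mu> \<in> elts (cf d)" using Ord_not_subset[OF cO Ord_mu] by blast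
        then have md: "\<mu> \<in> elts d" using cf_props(3)[OF dO] by blast
        have dm: "d \<notin> elts \<mu>" using mem_asym[OF md] .
        show ?thesis
        proof (cases "\<exists>c\<in>elts (vfuns \<kappa> cards). d = Th c")
          case True
          then have "f \<cdot> d = d" using fd False by simp
          then show ?thesis unfolding elts_types using unbounded_in_self otp_Ord[OF dO] True dm by simp
        next
          case nT: False
          let ?o = "otp (short d)"
          obtain c where u: "unbounded_in (short d) d" and c: "c \<in> elts (vfuns \<kappa> cards)"
            "elts ?o \<subseteq> elts (Th c)" "elts (Th c) \<subseteq> elts d"
            using short_props[OF d L mc] by blast
          have Lo: "Limit ?o" by (rule otp_unbounded_Limit[OF L u])
          have "Th c \<noteq> d" using nT c(1) by blast
          then have "Th c \<in> elts d" using Ord_subset_iff[OF Th_Ord dO] c(3) by blast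
          then have od: "?o \<in> elts d" by (rule Ord_subset_mem[OF dO Limit_Ord[OF Lo] c(2)])
          have op: "?o \<in> elts pw" by (rule Ord_trans[OF Ord_pw od d])
          have "?o \<in> elts ?s" using od op by (simp add: elts_seg)
          then have "lam ?s (fapp f) \<cdot> ?o = f \<cdot> ?o" by (rule lam_app[OF df])
          then have fe: "f \<cdot> d = enum_image (short d) (f \<cdot> ?o)" using fd False nT by simp
          have I: "unbounded_in (f \<cdot> ?o) ?o" "otp (f \<cdot> ?o) \<in> elts types" using IH[OF op od] Lo by blast+
          show ?thesis unfolding fe enum_image_props(2)[OF dO u I(1)] using enum_image_props(1)[OF dO u I(1)] I(2) by blast
        qed
      qed
    qed
  qed
  show ?thesis
    by (rule otimesI[OF df]) (use good in blast)
qed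

lemma types_props: "\<forall>x\<in>elts types. Ord x" "elts types \<inter> elts \<mu> = {x \<in> elts \<mu>. Reg x}"
  "elts (vdiff types \<mu>) \<subseteq> {x. \<exists>c\<in>elts (vfuns \<kappa> cards). x = Th c}"
  using Th_Ord Ord_mem[OF Ord_mu] unfolding elts_vdiff elts_types by blast+

section \<open>Counting\<close>

text \<open>The alephs below \<mu> are enumerated by \<open>g\<close>. Being unbounded in \<mu> they
  make \<open>g\<close> a limit ordinal, so \<omega> is contained in \<open>g\<close> and has room
  for the finite cardinals and for \<mu> as well.\<close>

lemma card_surj:
  assumes g: "Ord g" "\<mu> = Aleph g"
  obtains s where "dft (\<lambda>v. s (v 0))" "\<And>z. z \<in> elts cards \<Longrightarrow> \<exists>j\<in>elts g. s j = z"
proof -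
  let ?A = "alephs_below \<mu>"
  have og: "otp ?A = g" unfolding g(2) by (rule Aleph_index[OF g(1)])
  have "unbounded_in ?A \<mu>" unfolding unbounded_in_def
  proof (intro conjI ballI)
    show "elts ?A \<subseteq> elts \<mu>" unfolding elts_alephs_below by blast
    fix a assume "a \<in> elts \<mu>"
    then obtain k where k: "k \<in> elts \<mu>" "aleph k" "a \<in> elts k" using aleph_between by blast
    then have "elts a \<subseteq> elts k" using Ord_mem_subset[OF aleph_Ord[OF k(2)]] by blast
    then show "\<exists>k\<in>elts ?A. elts a \<subseteq> elts k" unfolding elts_alephs_below using k by blast
  qed
  then have "Limit g" using otp_unbounded_Limit[OF Limit_mu] og by metis
  then have om: "elts omega \<subseteq> elts g" by (rule omega_least)
  have AO: "Ord y" if "y \<in> elts ?A" for y using that Ord_mem[OF Ord_mu] unfolding elts_alephs_below by blast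
  have "ord_iso (enum ?A) (otp ?A) ?A" by (rule enum(2), erule AO)
  then have iso: "ord_iso (enum ?A) g ?A" unfolding og .
  obtain q where q: "square_inj q (omega::'a)" using square_ex[OF Ord_omega subset_refl] by blast
  let ?h = "enum ?A" and ?z = "vempty :: 'a" and ?o = "vsucc vempty :: 'a"
  let ?P = "\<lambda>t j b. b \<in> elts omega \<and> j = q \<cdot> opair t b"
  \<comment> \<open>Indices below \<omega> are read as tagged pairs: tag 0 for a finite cardinal,
    tag 1 for an aleph with finite index. All others, in particular those with tag 2, give \<mu>.
    Indices from \<omega> on keep their aleph.\<close>
  let ?s = "\<lambda>j. if j \<notin> elts omega then ?h \<cdot> j else if \<exists>b. ?P ?z j b then least_ord (?P ?z j)
     else if \<exists>b. ?P ?o j b then ?h \<cdot> least_ord (?P ?o j) else \<mu>"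
  have z: "?z \<in> elts omega" by (rule vempty_in_Limit[OF omega_Limit])
  have o: "?o \<in> elts omega" and t: "vsucc ?o \<in> elts omega" using omega_Limit z unfolding Limit_def by blast+
  have ne: "?z \<noteq> ?o" "?z \<noteq> vsucc ?o" "?o \<noteq> vsucc ?o"
  proof -
    have "?z \<in> elts ?o" "?o \<in> elts (vsucc ?o)" by simp_all
    then show "?z \<noteq> ?o" "?z \<noteq> vsucc ?o" "?o \<noteq> vsucc ?o"
      using mem_irrefl[of ?o] mem_irrefl[of "vsucc ?o"] by auto
  qed
  have qi: "q \<cdot> opair u b = q \<cdot> opair u' b' \<longleftrightarrow> u = u' \<and> b = b'"
    if "u \<in> elts omega" "b \<in> elts omega" "u' \<in> elts omega" "b' \<in> elts omega" for u b u' b'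
    by (rule square_injD(2)[OF q that])
  have qo: "q \<cdot> opair u b \<in> elts omega" if "u \<in> elts omega" "b \<in> elts omega" for u b by (rule square_injD(1)[OF q that])
  have lst: "least_ord (?P u (q \<cdot> opair u b)) = b" if "u \<in> elts omega" "b \<in> elts omega" for u b
  proof (rule least_ord_eq)
    show "Ord b" by (rule Ord_mem[OF Ord_omega that(2)])
    show "?P u (q \<cdot> opair u b) b" using that by blast
    show "\<not> ?P u (q \<cdot> opair u b) b'" if b': "b' \<in> elts b" for b'
    proof
      assume "?P u (q \<cdot> opair u b) b'"
      then have "b = b'" using qi[OF \<open>u \<in> elts omega\<close> \<open>b \<in> elts omega\<close> \<open>u \<in> elts omega\<close>] by blast
      then show False using b' mem_irrefl[of b] by simp
    qed
  qed
  have nP: "\<not> (\<exists>b'. ?P u (q \<cdot> opair w b) b')"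
    if uw: "u \<in> elts omega" "w \<in> elts omega" "b \<in> elts omega" "u \<noteq> w" for u w b
  proof
    assume "\<exists>b'. ?P u (q \<cdot> opair w b) b'"
    then obtain b' where b': "b' \<in> elts omega" "q \<cdot> opair w b = q \<cdot> opair u b'" by (elim exE conjE)
    have "w = u" using qi[OF uw(2,3,1) b'(1)] b'(2) by simp
    then show False using uw(4) by simp
  qed
  have s0: "?s (q \<cdot> opair ?z b) = b" if b: "b \<in> elts omega" for b
  proof -
    have "\<exists>b'. ?P ?z (q \<cdot> opair ?z b) b'" using b by blast
    then show ?thesis using qo[OF z b] lst[OF z b] by simp
  qed
  have s1: "?s (q \<cdot> opair ?o b) = ?h \<cdot> b" if b: "b \<in> elts omega" for b
  proof -
    have "\<exists>b'. ?P ?o (q \<cdot> opair ?o b) b'" using b by blast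
    note ex = if_P[OF this]
    show ?thesis
      by (simp only: qo[OF o b] not_True_eq_False if_False if_not_P[OF nP[OF z o b ne(1)]] ex lst[OF o b])
  qed
  have s2: "?s (q \<cdot> opair (vsucc ?o) ?z) = \<mu>"
  proof -
    show ?thesis
      by (simp only: qo[OF t z] not_True_eq_False if_False if_not_P[OF nP[OF z t z ne(2)]] if_not_P[OF nP[OF o t z ne(3)]])
  qed
  have "\<exists>j\<in>elts g. ?s j = y" if y: "y \<in> elts cards" for y
  proof -
    have y': "y = \<mu> \<or> y \<in> elts \<mu>" "\<forall>b\<in>elts y. \<not> eqpoll y b" using y unfolding elts_cards by auto
    have yO: "Ord y" using y'(1) Ord_mu Ord_mem[OF Ord_mu] by blast
    consider "y = \<mu>" | "y \<in> elts omega" | "y \<in> elts \<mu>" "aleph y"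
      using y' Ord_not_mem[OF yO Ord_omega] yO unfolding aleph_def by blast
    then show ?thesis
    proof cases
      case 1
      then show ?thesis using s2 qo[OF t z] om by blast
    next
      case 2
      then show ?thesis using s0[OF 2] qo[OF z 2] om by blast
    next
      case 3
      then have "y \<in> elts ?A" unfolding elts_alephs_below by blast
      then obtain b where b: "b \<in> elts g" "?h \<cdot> b = y" using ord_isoD(2)[OF iso] by blast
      show ?thesis
      proof (cases "b \<in> elts omega")
        case True
        then show ?thesis using s1[OF True] qo[OF o True] om b(2) by blast
      next
        case False
        then have "?s b = y" using b(2) by simp
        then show ?thesis using b(1) by blast
      qed
    qed
  qed
  moreover have "dft (\<lambda>v. ?s (v 0))" by (intro dfn_intros)
  ultimately show thesis using that[of ?s] by blast
qed

lemma types_card: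
  assumes g: "Ord g" "\<mu> = Aleph g" and E: "e0 \<in> elts E"
  shows "elts (vcard (vdiff types \<mu>)) \<subseteq> elts (theta (vtimes (vfuns \<kappa> g) (vtimes E E)))"
proof -
  let ?R = "vdiff types \<mu>" and ?A = "vtimes (vfuns \<kappa> g) (vtimes E E)"
  have RO: "Ord x" if "x \<in> elts ?R" for x using types_props(1) that by simp
  have "dft (\<lambda>v::nat \<Rightarrow> 'a. v 0)" by (rule dft_var)
  then obtain a where a: "Ord a" "eqpoll ?R a"
  proof (rule inj_eqpoll_Ord[where F = "\<lambda>x. x" and X = ?R])
    show "Ord x" if "x \<in> elts ?R" for x by (rule RO[OF that])
  qed (rule inj_on_id2, rule that)
  note V = vcard_props[OF a]
  show ?thesis
  proof (cases "elts ?R = {}")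
    case True
    then have "elts ?R \<subseteq> elts vempty" by simp
    from vcard_subset(3)[OF Ord_vempty this] show ?thesis by simp
  next
    case False
    then obtain r0 where r0: "r0 \<in> elts ?R" by blast
    obtain s where ds: "dft (\<lambda>v. s (v 0))" and s: "\<And>z. z \<in> elts cards \<Longrightarrow> \<exists>j\<in>elts g. s j = z"
      using card_surj[OF g] by blast
    have [dfn_intros]: "dft t \<Longrightarrow> dft (\<lambda>v. s (t v))" for t by (rule dft_sub1[OF ds])
    obtain b where b: "bij_betw (fapp b) (elts ?R) (elts (vcard ?R))" using V(2) by (rule eqpollE)
    \<comment> \<open>A function from \<kappa> to \<open>g\<close> is turned into one with values in
      the cardinals by composition with \<open>s\<close>, and then into its value of
      \<open>Th\<close>. The default \<open>r0\<close> below handles results outside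
      \<open>?R\<close>.\<close>
    let ?t = "\<lambda>p. Th (lam \<kappa> (\<lambda>i. s (vfst p \<cdot> i)))"
    let ?F = "\<lambda>p. b \<cdot> (if ?t p \<in> elts ?R then ?t p else r0)"
    have "surjects ?A (vcard ?R)"
    proof (rule surjectsI)
      show "dft (\<lambda>v. ?F (v 0))" by (intro dfn_intros)
      show "?F p \<in> elts (vcard ?R)" for p using r0 by (intro bij_betw_apply[OF b]) simp
      fix y assume "y \<in> elts (vcard ?R)"
      then have "y \<in> fapp b ` elts ?R" using bij_betw_imp_surj_on[OF b] by simp
      then obtain r where r: "y = b \<cdot> r" "r \<in> elts ?R" by (rule imageE)
      obtain c where c: "c \<in> elts (vfuns \<kappa> cards)" "r = Th c" using types_props(3) r(2) by blast
      have cm: "maps c \<kappa> cards" using c(1) by (simp add: elts_vfuns)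
      \<comment> \<open>Taking the least index of each cardinal \<open>c \<cdot> i\<close> lifts
        \<open>c\<close> to a function into \<open>g\<close> without choice.\<close>
      let ?P = "\<lambda>i j. j \<in> elts g \<and> s j = c \<cdot> i"
      have dP: "dfn (\<lambda>v. ?P i (v 0))" for i by (intro dfn_intros)
      have P: "?P i (least_ord (?P i))" if i: "i \<in> elts \<kappa>" for i
      proof -
        obtain j where j: "?P i j" using s[OF maps_app[OF cm i]] by blast
        from least_ord_ex[OF dP Ord_mem[OF g(1) conjunct1[OF j]] j] show ?thesis by (rule conjunct1[OF conjunct2])
      qed
      let ?phi = "lam \<kappa> (\<lambda>i. least_ord (?P i))"
      have dphi: "dft (\<lambda>v. least_ord (?P (v 0)))" by (intro dfn_intros)
      have phi: "maps ?phi \<kappa> g" by (rule maps_lam[OF dphi conjunct1[OF P]])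
      have dsp: "dft (\<lambda>v. s (?phi \<cdot> v 0))" by (intro dfn_intros)
      have eq: "lam \<kappa> (\<lambda>i. s (?phi \<cdot> i)) = c"
      proof (rule is_fun_ext)
        show "is_fun (lam \<kappa> (\<lambda>i. s (?phi \<cdot> i))) \<kappa>" by (rule is_fun_lam[OF dsp])
        show "is_fun c \<kappa>" using cm by (simp add: maps_iff)
        show "lam \<kappa> (\<lambda>i. s (?phi \<cdot> i)) \<cdot> i = c \<cdot> i" if i: "i \<in> elts \<kappa>" for i
          unfolding lam_app[OF dsp i] lam_app[OF dphi i] by (rule conjunct2[OF P[OF i]])
      qed
      \<comment> \<open>Nonemptiness of \<open>E\<close> supplies the last two coordinates.\<close>
      let ?p = "opair ?phi (opair e0 e0)"
      have "?p \<in> elts ?A" using phi E by (simp add: elts_vfuns)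
      moreover have "?F ?p = y" unfolding vfst_opair eq c(2)[symmetric] r(1) using r(2) by simp
      ultimately show "\<exists>p\<in>elts ?A. ?F p = y" by blast
    qed
    then show ?thesis by (rule theta_upper[OF V(1)])
  qed
qed

end

theorem theorem4p6:
  fixes \<mu> \<kappa> E :: "'a::zf_dc"
  assumes "aleph \<mu>" and "cf \<mu> = \<kappa>" and "\<kappa> \<in> elts \<mu>" and "omega \<in> elts \<kappa>"
    and "eqpoll (mkset (\<Union>\<alpha>\<in>elts \<mu>. elts (vpow \<alpha>))) \<mu>"
    and "nice_family \<kappa> E"
  shows "(\<exists>k. aleph k \<and> eqpoll (vpow \<mu>) k) \<and>
    (Reg (csucc \<mu>) \<and>
     otimes_star (vcard (vpow \<mu>)) (\<lambda>\<delta>. \<delta> \<in> elts (vcard (vpow \<mu>)) \<and> \<mu> \<in> elts (cf \<delta>)) \<and>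
     (\<forall>\<gamma>. Ord \<gamma> \<and> \<mu> = Aleph \<gamma> \<longrightarrow>
        (\<exists>R. (\<forall>x\<in>elts R. Ord x) \<and>
             otimes (vcard (vpow \<mu>)) (\<lambda>x. x \<in> elts R) \<and>
             elts R \<inter> elts \<mu> = {x \<in> elts \<mu>. Reg x} \<and>
             elts (vcard (vdiff R \<mu>)) \<subseteq> elts (theta (vtimes (vfuns \<kappa> \<gamma>) (vtimes E E)))))) \<and>
    (\<forall>l. aleph l \<and> \<mu> \<in> elts l \<and> elts l \<subseteq> elts (vcard (vpow \<mu>)) \<longrightarrow> \<not> measurable l)"
proof -
  interpret strong_singular \<mu> \<kappa> by unfold_locales (rule assms)+
  obtain e0 where E: "e0 \<in> elts E" using assms(6) unfolding nice_family_def by blast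
  show ?thesis unfolding pw_def[symmetric]
  proof (intro conjI allI impI)
    show "\<exists>k. aleph k \<and> eqpoll (vpow \<mu>) k" using aleph_pw eqpoll_pw by blast
    show "Reg (csucc \<mu>)" by (rule csucc_Reg)
    show "otimes_star pw (\<lambda>\<delta>. \<delta> \<in> elts pw \<and> \<mu> \<in> elts (cf \<delta>))" by (rule otimes_star_pw)
    show "\<not> measurable l" if "aleph l \<and> \<mu> \<in> elts l \<and> elts l \<subseteq> elts pw" for l
      using not_measurable that by blast
    fix \<gamma> assume "Ord \<gamma> \<and> \<mu> = Aleph \<gamma>"
    then show "\<exists>R. (\<forall>x\<in>elts R. Ord x) \<and> otimes pw (\<lambda>x. x \<in> elts R) \<and>
             elts R \<inter> elts \<mu> = {x \<in> elts \<mu>. Reg x} \<and>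
             elts (vcard (vdiff R \<mu>)) \<subseteq> elts (theta (vtimes (vfuns \<kappa> \<gamma>) (vtimes E E)))"
      using types_props(1,2) otimes_types types_card[OF _ _ E] by blast
  qed
qed

end
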